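(* (i) Let $m\ge1$ be an integer, and let $q\ge3$ be a Fermat prime. Then $$v_2\big(f_\lambda^{(q)}(m)\big)\ \ge\ v_2(m)\,(\lambda+q-2),\qquad \lambda\ge1.$$ In particular, if $m$ is even, then $f_\lambda^{(q)}(m)$ is zero modulo any given $2$-power for all sufficiently large values of $\lambda$. (ii) For $q=3$ (and any integer $m\ge1$), and $\lambda\ge1$, the equality $v_2\big(f_\lambda^{(3)}(m)\big)=v_2(m)\,(\lambda+1)$ holds if, and only if, $\lambda+1$ is a $2$-power.
   Context: For integers $m\ge1$ and primes $q\ge3$, $\Gamma_m(q)=\langle x,y\mid x^{2m}=y^{qm}=1,\ x^2=y^q\rangle=C_{2m}\underset{C_m}{\ast}C_{qm}$, and $f_\lambda^{(q)}(m)$ is the number of free subgroups of index $2qm\lambda$ in $\Gamma_m(q)$. $v_2$ denotes the $2$-adic valuation. *)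

theory Defs
  imports "HOL-Algebra.Coset" "HOL-Number_Theory.Cong"
begin

text \<open>Words over an alphabet and its formal inverses: the letter \<open>(a, True)\<close> stands for the
  generator \<open>a\<close> and \<open>(a, False)\<close> for its inverse.\<close>

type_synonym 'a word = "('a \<times> bool) list"

definition words :: "'a set \<Rightarrow> 'a word set" where
  "words X = lists (X \<times> UNIV)"

text \<open>A presentation consists of generators \<open>X\<close> and relations \<open>R\<close>, where the pair \<open>(l, r)\<close>
  of words over \<open>X\<close> encodes the relation \<open>l = r\<close>.\<close>

inductive_set pres_rel :: "'a set \<Rightarrow> ('a word \<times> 'a word) set \<Rightarrow> ('a word \<times> 'a word) set"
  for X :: "'a set" and R :: "('a word \<times> 'a word) set" where
  pres_rel_refl: "w \<in> words X \<Longrightarrow> (w, w) \<in> pres_rel X R"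
| pres_rel_sym: "(u, v) \<in> pres_rel X R \<Longrightarrow> (v, u) \<in> pres_rel X R"
| pres_rel_trans: "(u, v) \<in> pres_rel X R \<Longrightarrow> (v, w) \<in> pres_rel X R \<Longrightarrow> (u, w) \<in> pres_rel X R"
| pres_rel_cancel: "a \<in> X \<Longrightarrow> u \<in> words X \<Longrightarrow> v \<in> words X \<Longrightarrow>
    (u @ (a, b) # (a, \<not> b) # v, u @ v) \<in> pres_rel X R"
| pres_rel_rel: "(l, r) \<in> R \<Longrightarrow> l \<in> words X \<Longrightarrow> r \<in> words X \<Longrightarrow> u \<in> words X \<Longrightarrow> v \<in> words X \<Longrightarrow>
    (u @ l @ v, u @ r @ v) \<in> pres_rel X R"

definition presented_group :: "'a set \<Rightarrow> ('a word \<times> 'a word) set \<Rightarrow> 'a word set monoid" where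
  "presented_group X R =
    \<lparr>carrier = words X // pres_rel X R,
     monoid.mult = (\<lambda>A B. \<Union>u\<in>A. \<Union>v\<in>B. pres_rel X R `` {u @ v}),
     monoid.one = pres_rel X R `` {[]}\<rparr>"

definition free_group :: "'a set \<Rightarrow> 'a word set monoid" where
  "free_group X = presented_group X {}"

text \<open>A basis of a free group \<open>G\<close> may be taken inside \<open>G\<close>, so it is no restriction that the
  set \<open>B\<close> below has the element type of \<open>G\<close>.\<close>

definition is_free :: "('a, 'b) monoid_scheme \<Rightarrow> bool" where
  "is_free G \<longleftrightarrow> (\<exists>B :: 'a set. G \<cong> free_group B)"

datatype gen = GenX | GenY

definition gen_pow :: "gen \<Rightarrow> nat \<Rightarrow> gen word" where
  "gen_pow a n = replicate n (a, True)"

definition Gamma :: "nat \<Rightarrow> nat \<Rightarrow> gen word set monoid" where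
  "Gamma m q = presented_group UNIV
    {(gen_pow GenX (2 * m), []), (gen_pow GenY (q * m), []), (gen_pow GenX 2, gen_pow GenY q)}"

text \<open>For \<open>l \<ge> 1\<close> the prescribed index is positive, so a subgroup of infinite index
  (for which \<^const>\<open>card\<close> yields \<open>0\<close>) is not counted.\<close>

definition free_subgroup_number :: "nat \<Rightarrow> nat \<Rightarrow> nat \<Rightarrow> nat" where
  "free_subgroup_number q l m =
    card {H. subgroup H (Gamma m q) \<and> card (rcosets\<^bsub>Gamma m q\<^esub> H) = 2 * q * m * l \<and>
             is_free ((Gamma m q)\<lparr>carrier := H\<rparr>)}"

definition fermat_prime :: "nat \<Rightarrow> bool" where
  "fermat_prime q \<longleftrightarrow> prime q \<and> (\<exists>k. q = 2 ^ (2 ^ k) + 1)"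

lemma words_append_iff [simp]: "u @ v \<in> words X \<longleftrightarrow> u \<in> words X \<and> v \<in> words X"
  by (auto simp: words_def)

lemma words_Nil [simp]: "[] \<in> words X"
  by (simp add: words_def)

lemma words_Cons [simp]: "(a, b) # w \<in> words X \<longleftrightarrow> a \<in> X \<and> w \<in> words X"
  by (auto simp: words_def)

lemma pres_rel_words: "(u, v) \<in> pres_rel X R \<Longrightarrow> u \<in> words X \<and> v \<in> words X"
  by (induction rule: pres_rel.induct) auto

lemma equiv_pres_rel: "equiv (words X) (pres_rel X R)"
proof (rule equivI)
  show "pres_rel X R \<subseteq> words X \<times> words X"
    by (auto dest: pres_rel_words)
  show "refl_on (words X) (pres_rel X R)"
    by (simp add: refl_on_def pres_rel_refl)
  show "sym (pres_rel X R)"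
    by (meson symI pres_rel_sym)
  show "trans (pres_rel X R)"
    by (meson transI pres_rel_trans)
qed

lemma pres_rel_context:
  assumes "(u, v) \<in> pres_rel X R" "s \<in> words X" "t \<in> words X"
  shows "(s @ u @ t, s @ v @ t) \<in> pres_rel X R"
  using assms
proof (induction rule: pres_rel.induct)
  case (pres_rel_refl w)
  then show ?case by (intro pres_rel.pres_rel_refl) auto
next
  case (pres_rel_sym u v)
  then show ?case by (blast intro: pres_rel.pres_rel_sym)
next
  case (pres_rel_trans u v w)
  then show ?case by (blast intro: pres_rel.pres_rel_trans)
next
  case (pres_rel_cancel a u v b)
  then show ?case using pres_rel.pres_rel_cancel[of a X "s @ u" "v @ t" b R] by simp
next
  case (pres_rel_rel l r u v)
  then show ?case using pres_rel.pres_rel_rel[of l r R X "s @ u" "v @ t"] by simp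
qed

lemma pres_rel_append:
  assumes "(u, u') \<in> pres_rel X R" "(v, v') \<in> pres_rel X R"
  shows "(u @ v, u' @ v') \<in> pres_rel X R"
proof -
  have "(u @ v, u' @ v) \<in> pres_rel X R"
    using pres_rel_context[OF assms(1), of "[]" v] pres_rel_words[OF assms(2)] by simp
  moreover have "(u' @ v, u' @ v') \<in> pres_rel X R"
    using pres_rel_context[OF assms(2), of u' "[]"] pres_rel_words[OF assms(1)] by simp
  ultimately show ?thesis by (rule pres_rel_trans)
qed

lemma presented_group_mult:
  assumes "u \<in> words X" "v \<in> words X"
  shows "pres_rel X R `` {u} \<otimes>\<^bsub>presented_group X R\<^esub> pres_rel X R `` {v} =
    pres_rel X R `` {u @ v}"
proof -
  have eq: "pres_rel X R `` {u' @ v'} = pres_rel X R `` {u @ v}"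
    if "(u, u') \<in> pres_rel X R" "(v, v') \<in> pres_rel X R" for u' v'
    using equiv_class_eq[OF equiv_pres_rel pres_rel_append[OF that]] by simp
  have "u \<in> pres_rel X R `` {u}" "v \<in> pres_rel X R `` {v}"
    using assms by (auto intro: pres_rel_refl)
  have "(\<Union>u' \<in> pres_rel X R `` {u}. \<Union>v' \<in> pres_rel X R `` {v}. pres_rel X R `` {u' @ v'}) =
      (\<Union>u' \<in> pres_rel X R `` {u}. \<Union>v' \<in> pres_rel X R `` {v}. pres_rel X R `` {u @ v})"
    by (rule SUP_cong[OF refl], rule SUP_cong[OF refl], rule eq) simp_all
  also have "\<dots> = pres_rel X R `` {u @ v}"
    using \<open>u \<in> pres_rel X R `` {u}\<close> \<open>v \<in> pres_rel X R `` {v}\<close> by blast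
  finally show ?thesis by (simp add: presented_group_def)
qed

lemma words_inverse:
  "w \<in> words X \<Longrightarrow> \<exists>w' \<in> words X. (w' @ w, []) \<in> pres_rel X R"
proof (induction w)
  case Nil
  then show ?case by (intro bexI[of _ "[]"]) (auto intro: pres_rel_refl)
next
  case (Cons p w)
  obtain a b where p: "p = (a, b)" by (cases p)
  with Cons obtain w' where w': "w' \<in> words X" "(w' @ w, []) \<in> pres_rel X R" by auto
  have "(w' @ (a, \<not> b) # (a, \<not> \<not> b) # w, w' @ w) \<in> pres_rel X R"
    using Cons.prems p w' by (intro pres_rel_cancel) auto
  then have "((w' @ [(a, \<not> b)]) @ p # w, []) \<in> pres_rel X R"
    using pres_rel_trans[OF _ w'(2)] p by simp
  then show ?case using Cons.prems w' p by (intro bexI[of _ "w' @ [(a, \<not> b)]"]) auto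
qed

lemma carrier_presented_group: "carrier (presented_group X R) = (\<lambda>w. pres_rel X R `` {w}) ` words X"
  by (auto simp: presented_group_def quotient_def)

lemma one_presented_group: "\<one>\<^bsub>presented_group X R\<^esub> = pres_rel X R `` {[]}"
  by (simp add: presented_group_def)

lemma group_presented_group: "group (presented_group X R)"
proof (rule groupI)
  fix A assume "A \<in> carrier (presented_group X R)"
  then obtain w where w: "w \<in> words X" "A = pres_rel X R `` {w}"
    by (auto simp: carrier_presented_group)
  obtain w' where w': "w' \<in> words X" "(w' @ w, []) \<in> pres_rel X R"
    using words_inverse[OF w(1)] by blast
  show "\<exists>B \<in> carrier (presented_group X R).
      B \<otimes>\<^bsub>presented_group X R\<^esub> A = \<one>\<^bsub>presented_group X R\<^esub>"
  proof (rule bexI)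
    show "pres_rel X R `` {w'} \<otimes>\<^bsub>presented_group X R\<^esub> A = \<one>\<^bsub>presented_group X R\<^esub>"
      using w w'(1) equiv_class_eq[OF equiv_pres_rel w'(2)]
      by (simp add: presented_group_mult one_presented_group)
    show "pres_rel X R `` {w'} \<in> carrier (presented_group X R)"
      using w'(1) by (simp add: carrier_presented_group)
  qed
qed (auto simp: carrier_presented_group one_presented_group presented_group_mult)

end

theory Submission
  imports Defs "HOL-Combinatorics.Orbits" "HOL-Computational_Algebra.Formal_Power_Series"
begin

text \<open>By M. Hall's transitive-action argument, a subgroup of index \<open>n\<close> is a transitive right action on
  \<open>n\<close> points with a base point, up to relabelling the other \<open>n - 1\<close> points. It is free exactly when
  all cycles of \<open>x\<close> and \<open>y\<close> have full lengths \<open>2m\<close> and \<open>qm\<close>: free groups are torsion-free, and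
  conversely the stabilizer is the fundamental group of the graph whose vertices are the \<open>x\<close>-cycles
  and \<open>y\<close>-cycles and whose edges are the cycles of \<open>x\<^sup>2\<close>; a skew product of the action with the free
  group on the edges outside a spanning tree yields the isomorphism. Counting all such actions (first
  \<open>x\<close>, then \<open>y\<close> as a \<open>q\<close>-th root of \<open>x\<^sup>2\<close>) and splitting off the orbit of the base point shows that
  \<open>\<Sum> f\<^sub>l(m) z\<^sup>l = 2qm z H'(z) / H(z)\<close> with \<open>H(z) = \<Sum> m\<^bsup>l(q-2)\<^esup> c\<^sub>l z\<^sup>l\<close>, where the \<open>c\<^sub>l\<close> do not
  depend on \<open>m\<close>. Hence \<open>f\<^sub>l(m) = m\<^bsup>l(q-2)+1\<^esup> f\<^sub>l(1)\<close>, which gives (i) once \<open>f\<^sub>l(1) > 0\<close>; this follows from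
  the log-convexity of \<open>c\<close>. For \<open>q = 3\<close> the series satisfies a Riccati equation, which modulo 2
  reads \<open>f\<^bsub>2k+1\<^esub> \<equiv> f\<^sub>k\<close>, \<open>f\<^bsub>2k\<^esub> \<equiv> 0\<close>, and gives (ii).\<close>

text \<open>The exponent of m is a balance: for an action on 2qml points the choice of y as a root
  contributes m^(2l(q-1)) and the count of x loses m^(ql), which leaves m^(l(q-2)). The one further
  factor m in f_l(m) is that of 2qm, the number of points per unit of l. Now l(q-2) + 1 = (l + q -
  2) + (l-1)(q-3), whence the bound; the surplus vanishes for q = 3, and equality there says that
  f_l(1) is odd. Positivity of f_l(1) matters because \<open>multiplicity 2 0\<close> is 0.
  Torsion-freeness yields full cycles only if x and y have exact orders 2m and qm, while a
  presentation gives only upper bounds. The lower bounds come from the count itself: it is positive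
  on 2qm points, and the cycles of any action counted there show the orders. The isomorphism with a
  free group needs a homomorphism out of a subgroup of the presented group. A larger action supplies
  it, because for an action only the relations have to be checked.\<close>

section \<open>Classes of words and their powers\<close>

abbreviation pcls :: "'a set \<Rightarrow> ('a word \<times> 'a word) set \<Rightarrow> 'a word \<Rightarrow> 'a word set" where
  "pcls X R w \<equiv> pres_rel X R `` {w}"

lemma pcls_eq_iff:
  assumes "u \<in> words X" "v \<in> words X"
  shows "pcls X R u = pcls X R v \<longleftrightarrow> (u, v) \<in> pres_rel X R"
  using eq_equiv_class_iff[OF equiv_pres_rel] assms by blast

lemma pcls_pow:
  assumes "w \<in> words X"
  shows "pcls X R w [^]\<^bsub>presented_group X R\<^esub> (k::nat) = pcls X R (concat (replicate k w))"
proof -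
  interpret group "presented_group X R" by (rule group_presented_group)
  have words: "concat (replicate k w) \<in> words X" for k
    by (induction k) (use assms in auto)
  show ?thesis
  proof (induction k)
    case 0
    then show ?case by (simp add: one_presented_group)
  next
    case (Suc k)
    have "concat (replicate k w) @ w = w @ concat (replicate k w)"
      by (induction k) auto
    then show ?case using Suc presented_group_mult[OF words assms, of R k] by simp
  qed
qed

subsection \<open>Reduced words\<close>

definition flip :: "'a \<times> bool \<Rightarrow> 'a \<times> bool" where
  "flip p = (fst p, \<not> snd p)"

lemma flip_flip [simp]: "flip (flip p) = p"
  by (simp add: flip_def)

lemma flip_neq [simp]: "p \<noteq> flip p"
  by (simp add: flip_def prod_eq_iff)

definition reduced :: "'a word \<Rightarrow> bool" where
  "reduced w \<longleftrightarrow> successively (\<lambda>p q. q \<noteq> flip p) w"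

text \<open>Left multiplication by a letter, as an operation on reduced words (van der Waerden's
  device). On reduced words \<open>push p\<close> and \<open>push (flip p)\<close> are inverse to
  each other, so \<open>reduce\<close> is invariant under cancellation without any confluence
  argument.\<close>

definition push :: "'a \<times> bool \<Rightarrow> 'a word \<Rightarrow> 'a word" where
  "push p w = (if w \<noteq> [] \<and> hd w = flip p then tl w else p # w)"

definition reduce :: "'a word \<Rightarrow> 'a word" where
  "reduce w = foldr push w []"

lemma reduced_push: "reduced w \<Longrightarrow> reduced (push p w)"
  by (cases w) (auto simp: push_def reduced_def successively_Cons)

lemma push_flip_push: "reduced w \<Longrightarrow> push (flip p) (push p w) = w"
  by (cases w rule: list.exhaust; cases "tl w") (auto simp: push_def reduced_def)

lemma reduced_foldr_push: "reduced w \<Longrightarrow> reduced (foldr push u w)"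
  by (induction u) (auto simp: reduced_push)

lemma reduced_reduce: "reduced (reduce w)"
  unfolding reduce_def by (rule reduced_foldr_push) (simp add: reduced_def)

lemma reduce_eq_if_reduced: "reduced w \<Longrightarrow> reduce w = w"
  by (induction w) (auto simp: reduce_def push_def reduced_def successively_Cons)

lemma reduce_invariant: "(u, v) \<in> pres_rel X {} \<Longrightarrow> reduce u = reduce v"
proof (induction rule: pres_rel.induct)
  case (pres_rel_cancel a u v b)
  have "push (a, b) (push (a, \<not> b) (reduce v)) = reduce v"
    using push_flip_push[OF reduced_reduce, of "(a, \<not> b)" v] by (simp add: flip_def)
  then show ?case by (simp add: reduce_def)
qed auto

lemma reduce_equiv: "w \<in> words X \<Longrightarrow> (w, reduce w) \<in> pres_rel X {}"
proof (induction w)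
  case Nil
  then show ?case by (auto simp: reduce_def intro: pres_rel_refl)
next
  case (Cons p w)
  obtain a b where p: "p = (a, b)" by (cases p)
  have w: "w \<in> words X" "a \<in> X" using Cons.prems p by auto
  have eq: "(w, reduce w) \<in> pres_rel X {}" using Cons w by blast
  have "([p] @ w @ [], [p] @ reduce w @ []) \<in> pres_rel X {}"
    using eq w p by (intro pres_rel_context) auto
  moreover have "(p # reduce w, push p (reduce w)) \<in> pres_rel X {}"
  proof (cases "reduce w \<noteq> [] \<and> hd (reduce w) = flip p")
    case True
    then obtain v where v: "reduce w = (a, \<not> b) # v"
      by (cases "reduce w") (auto simp: flip_def p)
    have "v \<in> words X" using pres_rel_words[OF eq] v by auto
    then have "([] @ (a, b) # (a, \<not> b) # v, [] @ v) \<in> pres_rel X {}"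
      using w by (intro pres_rel_cancel) auto
    then show ?thesis using True v p by (simp add: push_def)
  next
    case False
    then show ?thesis using p w pres_rel_words[OF eq]
      by (auto simp: push_def intro!: pres_rel_refl)
  qed
  ultimately show ?case using pres_rel_trans by (fastforce simp: reduce_def)
qed

text \<open>Copies of \<open>w\<close> create new neighbours only where one copy ends and the next
  begins; the third assumption, cyclic reducedness, keeps these from cancelling.\<close>

lemma reduced_replicate:
  assumes "reduced w" "w \<noteq> []" "hd w \<noteq> flip (last w)"
  shows "reduced (concat (replicate k w))"
proof (induction k)
  case (Suc k)
  have "concat (replicate k w) \<noteq> [] \<Longrightarrow> hd (concat (replicate k w)) = hd w"
    using assms(2) by (cases k) auto
  then show ?case using Suc assms
    by (auto simp: reduced_def successively_append_iff)
qed (simp add: reduced_def)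

text \<open>A word that is not cyclically reduced is a conjugate of a shorter one.\<close>

lemma reduced_power_not_trivial:
  assumes "reduced w" "w \<noteq> []" "w \<in> words X" "k > 0"
  shows "(concat (replicate k w), []) \<notin> pres_rel X {}"
  using assms(1-3)
proof (induction "length w" arbitrary: w rule: less_induct)
  case less
  show ?case
  proof (cases "hd w = flip (last w)")
    case False
    then have "reduce (concat (replicate k w)) = concat (replicate k w)"
      using less.prems by (intro reduce_eq_if_reduced reduced_replicate) auto
    moreover have "concat (replicate k w) \<noteq> []"
      using less.prems \<open>k > 0\<close> by (cases k) auto
    moreover have "reduce [] = []" by (simp add: reduce_def)
    ultimately show ?thesis using reduce_invariant by metis
  next
    case True
    obtain p v where w: "w = p # v" using less.prems by (cases w) auto
    then have "v \<noteq> []" using True by auto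
    then obtain u q where v: "v = u @ [q]" by (cases v rule: rev_cases) auto
    have q: "q = flip p" using True w v by simp
    have u: "reduced u" "u \<noteq> []" "u \<in> words X"
      using less.prems w v q
      by (auto simp: reduced_def successively_Cons successively_append_iff) (cases p; cases u; auto)+
    obtain a b where p: "p = (a, b)" by (cases p)
    have a: "a \<in> X" using less.prems(3) w p by simp
    let ?uk = "\<lambda>k. concat (replicate k u)"
    have uk: "?uk k \<in> words X" for k by (induction k) (use u in auto)
    have conj: "(concat (replicate k w), [p] @ ?uk k @ [q]) \<in> pres_rel X {}" for k
    proof (induction k)
      case 0
      show ?case using pres_rel_sym[OF pres_rel_cancel[of a X "[]" "[]" b "{}"]] a p q
        by (simp add: flip_def)
    next
      case (Suc k)
      have 1: "(w @ concat (replicate k w), w @ [p] @ ?uk k @ [q]) \<in> pres_rel X {}"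
        by (rule pres_rel_append[OF pres_rel_refl Suc]) (rule less.prems)
      have "((p # u) @ (a, \<not> b) # (a, \<not> \<not> b) # (?uk k @ [q]), (p # u) @ (?uk k @ [q])) \<in> pres_rel X {}"
        using a uk u p q by (intro pres_rel_cancel) (auto simp: flip_def)
      then have "(w @ [p] @ ?uk k @ [q], [p] @ ?uk (Suc k) @ [q]) \<in> pres_rel X {}"
        using w v q p by (simp add: flip_def)
      with 1 show ?case using pres_rel_trans by fastforce
    qed
    show ?thesis
    proof
      assume "(concat (replicate k w), []) \<in> pres_rel X {}"
      then have "([p] @ ?uk k @ [q], []) \<in> pres_rel X {}"
        using conj pres_rel_sym pres_rel_trans by metis
      \<comment> \<open>Since q is the inverse letter of p, conjugating by q strips p and q from the
        ends, and a trivial power of w gives a trivial power of the shorter u.\<close>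
      then have "([q] @ ([p] @ ?uk k @ [q]) @ [p], [q] @ [] @ [p]) \<in> pres_rel X {}"
        using a p q by (intro pres_rel_context) (auto simp: flip_def)
      moreover have "([q] @ ([p] @ ?uk k @ [q]) @ [p], ?uk k @ [q, p]) \<in> pres_rel X {}"
        using pres_rel_cancel[of a X "[]" "?uk k @ [q, p]" "\<not> b" "{}"] a p q uk by (simp add: flip_def)
      moreover have "(?uk k @ [q, p], ?uk k) \<in> pres_rel X {}"
        using pres_rel_cancel[of a X "?uk k" "[]" "\<not> b" "{}"] a p q uk by (simp add: flip_def)
      moreover have "([q, p], []) \<in> pres_rel X {}"
        using pres_rel_cancel[of a X "[]" "[]" "\<not> b" "{}"] a p q by (simp add: flip_def)
      ultimately have "(?uk k, []) \<in> pres_rel X {}"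
        using pres_rel_sym pres_rel_trans by (metis append_Nil append_Cons)
      moreover have "length u < length w" using w v by simp
      ultimately show False using less.hyps u by blast
    qed
  qed
qed

text \<open>A nonempty reduced word has no trivial power, so the reduced representative of
  \<open>g\<close> is empty.\<close>

lemma free_group_torsion_free:
  assumes "g \<in> carrier (free_group X)" "k > 0" "g [^]\<^bsub>free_group X\<^esub> (k::nat) = \<one>\<^bsub>free_group X\<^esub>"
  shows "g = \<one>\<^bsub>free_group X\<^esub>"
proof -
  obtain w where w: "w \<in> words X" "g = pcls X {} w"
    using assms(1) by (auto simp: free_group_def carrier_presented_group)
  let ?r = "reduce w"
  have r: "(w, ?r) \<in> pres_rel X {}" using reduce_equiv[OF w(1)] .
  then have rw: "?r \<in> words X" using pres_rel_words by blast
  have g: "g = pcls X {} ?r" using r w rw by (simp add: pcls_eq_iff)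
  have rk: "concat (replicate k ?r) \<in> words X" by (induction k) (use rw in auto)
  have "pcls X {} (concat (replicate k ?r)) = pcls X {} []"
    using assms(3) g pcls_pow[OF rw, of "{}" k] by (simp add: free_group_def one_presented_group)
  then have "(concat (replicate k ?r), []) \<in> pres_rel X {}"
    using rk by (simp add: pcls_eq_iff)
  then have "?r = []"
    using reduced_power_not_trivial[OF reduced_reduce _ rw \<open>k > 0\<close>] by blast
  then show ?thesis using g by (simp add: free_group_def one_presented_group)
qed

lemma is_free_torsion_free:
  fixes G :: "('a, 'b) monoid_scheme"
  assumes "group G" "is_free G" "g \<in> carrier G" "k > 0" "g [^]\<^bsub>G\<^esub> (k::nat) = \<one>\<^bsub>G\<^esub>"
  shows "g = \<one>\<^bsub>G\<^esub>"
proof -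
  obtain B :: "'a set" and \<phi> where phi: "\<phi> \<in> iso G (free_group B)"
    using assms(2) unfolding is_free_def is_iso_def by blast
  interpret F: group "free_group B" unfolding free_group_def by (rule group_presented_group)
  interpret group_hom G "free_group B" \<phi>
    using assms(1) phi F.is_group by (auto simp: group_hom_def group_hom_axioms_def iso_def)
  have "\<phi> g [^]\<^bsub>free_group B\<^esub> k = \<one>\<^bsub>free_group B\<^esub>"
    using assms by (metis hom_nat_pow hom_one)
  then have "\<phi> g = \<one>\<^bsub>free_group B\<^esub>"
    using free_group_torsion_free assms(3,4) hom_closed by blast
  then show ?thesis
    using phi assms(3) by (metis hom_one iso_iff inj_on_def G.one_closed)
qed

subsection \<open>The universal property of free groups\<close>

definition free_gen :: "'a set \<Rightarrow> 'a \<Rightarrow> 'a word set" where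
  "free_gen B b = pcls B {} [(b, True)]"

lemma free_gen_closed: "b \<in> B \<Longrightarrow> free_gen B b \<in> carrier (free_group B)"
  by (auto simp: free_gen_def free_group_def carrier_presented_group)

text \<open>A word is evaluated letter by letter in G. There are no relations beside cancellation,
  so cancellation is all that the value must respect.\<close>

lemma free_group_extend:
  assumes "group G" "v \<in> B \<rightarrow> carrier G"
  shows "\<exists>\<psi>\<in>hom (free_group B) G. \<forall>b\<in>B. \<psi> (free_gen B b) = v b"
proof -
  interpret G: group G by fact
  define ev where "ev = (\<lambda>w. foldr (\<lambda>(a, b) g. (if b then v a else inv\<^bsub>G\<^esub> (v a)) \<otimes>\<^bsub>G\<^esub> g) w \<one>\<^bsub>G\<^esub>)"
  have closed: "ev w \<in> carrier G" if "w \<in> words B" for w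
    using that assms(2) by (induction w) (auto simp: ev_def Pi_iff)
  have app: "ev (u @ w) = ev u \<otimes>\<^bsub>G\<^esub> ev w" if "u \<in> words B" "w \<in> words B" for u w
    using that(1)
  proof (induction u)
    case Nil
    then show ?case using closed[OF that(2)] by (simp add: ev_def)
  next
    case (Cons p u)
    obtain a b where p: "p = (a, b)" by (cases p)
    then have "a \<in> B" "u \<in> words B" using Cons.prems by auto
    moreover have "v a \<in> carrier G" using \<open>a \<in> B\<close> assms(2) by auto
    moreover have "ev ((p # u) @ w) = (if b then v a else inv\<^bsub>G\<^esub> (v a)) \<otimes>\<^bsub>G\<^esub> ev (u @ w)"
      "ev (p # u) = (if b then v a else inv\<^bsub>G\<^esub> (v a)) \<otimes>\<^bsub>G\<^esub> ev u"
      by (simp_all add: ev_def p)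
    ultimately show ?case using Cons.IH closed that(2) by (simp add: G.m_assoc)
  qed
  have inv: "ev u = ev w" if "(u, w) \<in> pres_rel B {}" for u w
    using that
  proof (induction rule: pres_rel.induct)
    case (pres_rel_cancel a u w b)
    have va: "v a \<in> carrier G" using pres_rel_cancel assms(2) by auto
    have "ev [(a, b), (a, \<not> b)] = \<one>\<^bsub>G\<^esub>" using va by (auto simp: ev_def)
    moreover have "ev (u @ [(a, b), (a, \<not> b)] @ w) = ev u \<otimes>\<^bsub>G\<^esub> (ev [(a, b), (a, \<not> b)] \<otimes>\<^bsub>G\<^esub> ev w)"
      using pres_rel_cancel app[of u "[(a, b), (a, \<not> b)] @ w"] app[of "[(a, b), (a, \<not> b)]" w] by simp
    ultimately show ?case using pres_rel_cancel closed by (simp add: app)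
  qed auto
  define \<psi> where "\<psi> A = ev (SOME w. w \<in> A)" for A
  have psi: "\<psi> (pcls B {} w) = ev w" if "w \<in> words B" for w
  proof -
    have "w \<in> pcls B {} w" using that by (auto intro: pres_rel_refl)
    then have "(SOME u. u \<in> pcls B {} w) \<in> pcls B {} w" by (rule someI)
    then show ?thesis unfolding \<psi>_def using inv by auto
  qed
  have "\<psi> \<in> hom (free_group B) G"
  proof (rule homI)
    fix A assume "A \<in> carrier (free_group B)"
    then show "\<psi> A \<in> carrier G" using psi closed by (auto simp: free_group_def carrier_presented_group)
  next
    fix A C assume "A \<in> carrier (free_group B)" "C \<in> carrier (free_group B)"
    then obtain u w where "u \<in> words B" "w \<in> words B" "A = pcls B {} u" "C = pcls B {} w"
      by (auto simp: free_group_def carrier_presented_group)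
    then show "\<psi> (A \<otimes>\<^bsub>free_group B\<^esub> C) = \<psi> A \<otimes>\<^bsub>G\<^esub> \<psi> C"
      by (simp add: free_group_def presented_group_mult psi app)
  qed
  moreover have "\<psi> (free_gen B b) = v b" if "b \<in> B" for b
    using that assms(2) psi[of "[(b, True)]"] by (auto simp: free_gen_def ev_def Pi_iff)
  ultimately show ?thesis by blast
qed

text \<open>Serves to prove a homomorphism onto: its image is a subgroup, so it is enough to hit the
  generators.\<close>

lemma free_group_generated:
  assumes "subgroup K (free_group B)" "\<And>b. b \<in> B \<Longrightarrow> free_gen B b \<in> K"
  shows "carrier (free_group B) \<subseteq> K"
proof -
  interpret F: group "free_group B" unfolding free_group_def by (rule group_presented_group)
  interpret K: subgroup K "free_group B" by fact
  have letter: "pcls B {} [(b, e)] \<in> K" if b: "b \<in> B" for b e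
  proof (cases e)
    case True
    then show ?thesis using assms(2)[OF b] by (simp add: free_gen_def)
  next
    case False
    have "pcls B {} [(b, False)] \<otimes>\<^bsub>free_group B\<^esub> free_gen B b = pcls B {} [(b, False), (b, True)]"
      using b by (simp add: free_gen_def free_group_def presented_group_mult)
    also have "\<dots> = pcls B {} []"
      using pres_rel_cancel[of b B "[]" "[]" False "{}"] b by (simp add: pcls_eq_iff)
    finally have "pcls B {} [(b, False)] = inv\<^bsub>free_group B\<^esub> free_gen B b"
      using b free_gen_closed[OF b]
      by (intro F.inv_equality[symmetric]) (auto simp: free_group_def one_presented_group carrier_presented_group)
    then show ?thesis using False assms(2)[OF b] by simp
  qed
  have "pcls B {} w \<in> K" if "w \<in> words B" for w
    using that
  proof (induction w)
    case Nil
    then show ?case using K.one_closed by (simp add: free_group_def one_presented_group)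
  next
    case (Cons p w)
    obtain b e where p: "p = (b, e)" by (cases p)
    then have "b \<in> B" "w \<in> words B" using Cons.prems by auto
    then have "pcls B {} [(b, e)] \<otimes>\<^bsub>free_group B\<^esub> pcls B {} w \<in> K"
      using Cons.IH letter by (intro K.m_closed) auto
    then show ?case using \<open>b \<in> B\<close> \<open>w \<in> words B\<close> by (simp add: free_group_def presented_group_mult p)
  qed
  then show ?thesis by (auto simp: free_group_def carrier_presented_group)
qed

section \<open>Permutations all of whose cycles have the same length\<close>

text \<open>Every cycle on \<open>S\<close> has length exactly \<open>d\<close> (for
  \<open>d > 0\<close>). The condition on fixed points of powers is pointwise, which makes it stable
  under restriction to invariant subsets and under gluing along disjoint supports.\<close>

definition semireg :: "nat \<Rightarrow> 'a set \<Rightarrow> ('a \<Rightarrow> 'a) \<Rightarrow> bool" where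
  "semireg d S f \<longleftrightarrow> f permutes S \<and> (\<forall>s\<in>S. \<forall>i. (f ^^ i) s = s \<longleftrightarrow> d dvd i)"

definition cyc :: "('a \<Rightarrow> 'a) \<Rightarrow> 'a \<Rightarrow> 'a set" where
  "cyc f s = range (\<lambda>i. (f ^^ i) s)"

lemma semireg_permutes: "semireg d S f \<Longrightarrow> f permutes S"
  by (simp add: semireg_def)

lemma funpow_in_set: "(\<And>s. s \<in> S \<Longrightarrow> f s \<in> S) \<Longrightarrow> s \<in> S \<Longrightarrow> (f ^^ i) s \<in> S"
  by (induction i) auto

lemma permutes_funpow_in: "f permutes S \<Longrightarrow> s \<in> S \<Longrightarrow> (f ^^ i) s \<in> S"
  by (rule funpow_in_set) (simp_all add: permutes_in_image)

lemma semireg_funpow_eq_iff: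
  assumes "semireg d S f" "s \<in> S"
  shows "(f ^^ i) s = (f ^^ j) s \<longleftrightarrow> [i = j] (mod d)"
proof -
  have le: "(f ^^ i) s = (f ^^ j) s \<longleftrightarrow> [i = j] (mod d)" if "i \<le> j" for i j
  proof -
    have "inj (f ^^ i)"
      using assms by (auto simp: semireg_def intro: inj_fn permutes_inj)
    moreover have "(f ^^ j) s = (f ^^ i) ((f ^^ (j - i)) s)"
      using that by (metis comp_apply funpow_add le_add_diff_inverse)
    ultimately have "(f ^^ i) s = (f ^^ j) s \<longleftrightarrow> (f ^^ (j - i)) s = s"
      by (metis injD)
    also have "\<dots> \<longleftrightarrow> d dvd j - i" using assms by (simp add: semireg_def)
    also have "\<dots> \<longleftrightarrow> [i = j] (mod d)" using that by (metis cong_altdef_nat cong_sym)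
    finally show ?thesis .
  qed
  show ?thesis using le[of i j] le[of j i] by (metis cong_sym nat_le_linear)
qed

lemma semireg_funpow_id:
  assumes "semireg d S f"
  shows "f ^^ (d * k) = id"
proof
  fix s
  have "(f ^^ n) s = s" if "s \<notin> S" for n
    using that assms by (induction n) (auto simp: semireg_def permutes_not_in)
  then show "(f ^^ (d * k)) s = id s"
    using assms by (cases "s \<in> S") (auto simp: semireg_def)
qed

lemma in_cyc: "s \<in> cyc f s"
  unfolding cyc_def by (metis funpow_0 rangeI)

lemma cyc_eq_image:
  assumes "semireg d S f" "s \<in> S" "d > 0"
  shows "cyc f s = (\<lambda>i. (f ^^ i) s) ` {..<d}"
proof -
  have "(f ^^ i) s = (f ^^ (i mod d)) s" for i
    using semireg_funpow_eq_iff[OF assms(1,2)] by (simp add: cong_def)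
  then show ?thesis using assms(3) unfolding cyc_def
    by (auto simp: image_iff) (metis lessThan_iff mod_less_divisor)
qed

lemma card_cyc:
  assumes "semireg d S f" "s \<in> S" "d > 0"
  shows "card (cyc f s) = d"
proof -
  have "inj_on (\<lambda>i. (f ^^ i) s) {..<d}"
    using semireg_funpow_eq_iff[OF assms(1,2)] by (auto simp: inj_on_def cong_def)
  then show ?thesis using cyc_eq_image[OF assms] by (simp add: card_image)
qed

lemma cyc_subset: "f permutes S \<Longrightarrow> s \<in> S \<Longrightarrow> cyc f s \<subseteq> S"
  by (auto simp: cyc_def permutes_funpow_in)

lemma cyc_eqI:
  assumes "semireg d S f" "d > 0" "t \<in> cyc f s" "s \<in> S"
  shows "cyc f t = cyc f s"
proof -
  obtain i where t: "t = (f ^^ i) s" using assms(3) by (auto simp: cyc_def)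
  have "(f ^^ n) t = (f ^^ (n + i)) s" for n by (simp add: t funpow_add)
  \<comment> \<open>Going \<open>(d - 1) * i\<close> steps further undoes \<open>i\<close> steps,
    because \<open>d * i\<close> steps return to the start; so no inverse of \<open>f\<close> is
    needed.\<close>
  moreover have "(f ^^ n) s = (f ^^ (n + (d - 1) * i)) t" for n
  proof -
    have "n + (d - 1) * i + i = n + d * i"
      using assms(2) by (cases d) auto
    then have "[n + (d - 1) * i + i = n] (mod d)" by (simp only: cong_def mod_mult_self2)
    then have "(f ^^ (n + (d - 1) * i + i)) s = (f ^^ n) s"
      using semireg_funpow_eq_iff[OF assms(1,4)] by blast
    then show ?thesis by (simp add: t funpow_add)
  qed
  ultimately show ?thesis unfolding cyc_def by auto
qed

lemma semireg_dvd_card: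
  assumes "semireg d S f" "finite S" "d > 0"
  shows "d dvd card S"
proof -
  have U: "\<Union> (cyc f ` S) = S"
  proof
    show "\<Union> (cyc f ` S) \<subseteq> S" by (intro UN_least cyc_subset[OF semireg_permutes[OF assms(1)]])
    show "S \<subseteq> \<Union> (cyc f ` S)" using in_cyc by fast
  qed
  have "d * card (cyc f ` S) = card (\<Union> (cyc f ` S))"
  proof (rule card_partition)
    show "c1 \<inter> c2 = {}" if c: "c1 \<in> cyc f ` S" "c2 \<in> cyc f ` S" "c1 \<noteq> c2" for c1 c2
    proof -
      obtain s t where st: "s \<in> S" "c1 = cyc f s" "t \<in> S" "c2 = cyc f t" using c by blast
      have "cyc f s = cyc f t" if "u \<in> cyc f s" "u \<in> cyc f t" for u
        using cyc_eqI[OF assms(1,3)] that st by metis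
      then show ?thesis using st c(3) by blast
    qed
  qed (use U assms card_cyc[OF assms(1) _ assms(3)] in auto)
  then show ?thesis using U by (metis dvd_triv_left)
qed

lemma funpow_perm_restrict:
  assumes "f ` U \<subseteq> U" "s \<in> U"
  shows "(perm_restrict f U ^^ i) s = (f ^^ i) s"
proof -
  have "(f ^^ i) s \<in> U \<and> (perm_restrict f U ^^ i) s = (f ^^ i) s"
    using assms by (induction i) (auto simp: perm_restrict_def)
  then show ?thesis ..
qed

lemma funpow_perm_restrict_eq:
  assumes "f ` U \<subseteq> U"
  shows "perm_restrict f U ^^ i = perm_restrict (f ^^ i) U"
proof
  fix s
  show "(perm_restrict f U ^^ i) s = perm_restrict (f ^^ i) U s"
  proof (cases "s \<in> U")
    case True
    then show ?thesis using funpow_perm_restrict[OF assms] by (simp add: perm_restrict_def)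
  next
    case False
    then have "(perm_restrict f U ^^ i) s = s" by (induction i) (auto simp: perm_restrict_def)
    then show ?thesis using False by (simp add: perm_restrict_def)
  qed
qed

lemma semireg_perm_restrict:
  assumes "semireg d S f" "finite S" "U \<subseteq> S" "f ` U \<subseteq> U"
  shows "semireg d U (perm_restrict f U)"
proof -
  have "inj_on f U" using assms(1) by (auto simp: semireg_def intro: permutes_inj_on)
  then have "f ` U = U" using assms by (meson endo_inj_surj finite_subset)
  then have "bij_betw (perm_restrict f U) U U"
    using \<open>inj_on f U\<close> by (auto simp: bij_betw_def inj_on_def perm_restrict_def image_iff)
  then have "perm_restrict f U permutes U"
    by (rule bij_imp_permutes) (simp add: perm_restrict_def)
  then show ?thesis
    using assms by (auto simp: semireg_def funpow_perm_restrict)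
qed

lemma image_Diff_invariant:
  assumes "f permutes S" "finite S" "U \<subseteq> S" "f ` U \<subseteq> U"
  shows "f ` (S - U) \<subseteq> S - U"
proof -
  have inj: "inj f" using assms(1) by (rule permutes_inj)
  have "f ` U = U" using assms inj by (meson endo_inj_surj finite_subset inj_on_subset subset_UNIV)
  then show ?thesis using inj permutes_image[OF assms(1)] by (simp add: image_set_diff)
qed

lemma funpow_comp_disjoint:
  assumes "f permutes U" "g permutes V" "U \<inter> V = {}"
  shows "s \<notin> V \<Longrightarrow> ((f \<circ> g) ^^ i) s = (f ^^ i) s" "s \<notin> U \<Longrightarrow> ((f \<circ> g) ^^ i) s = (g ^^ i) s"
proof -
  assume s: "s \<notin> V"
  have "(f ^^ i) s \<notin> V \<and> ((f \<circ> g) ^^ i) s = (f ^^ i) s"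
  proof (induction i)
    case (Suc i)
    then have "f ((f ^^ i) s) \<notin> V" using assms
      by (cases "(f ^^ i) s \<in> U") (auto simp: permutes_not_in dest: permutes_in_image)
    then show ?case using assms Suc by (auto simp: permutes_not_in)
  qed (use s in auto)
  then show "((f \<circ> g) ^^ i) s = (f ^^ i) s" ..
next
  assume s: "s \<notin> U"
  have "(g ^^ i) s \<notin> U \<and> ((f \<circ> g) ^^ i) s = (g ^^ i) s"
  proof (induction i)
    case (Suc i)
    then have "g ((g ^^ i) s) \<notin> U" using assms
      by (cases "(g ^^ i) s \<in> V") (auto simp: permutes_not_in dest: permutes_in_image)
    then show ?case using assms Suc by (auto simp: permutes_not_in)
  qed (use s in auto)
  then show "((f \<circ> g) ^^ i) s = (g ^^ i) s" ..
qed

lemma semireg_comp: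
  assumes "semireg d U f" "semireg d V g" "U \<inter> V = {}"
  shows "semireg d (U \<union> V) (f \<circ> g)"
proof -
  have p: "f permutes U" "g permutes V" using assms by (auto simp: semireg_def)
  have "f \<circ> g permutes U \<union> V"
    using p by (intro permutes_compose) (auto intro: permutes_subset)
  moreover have "((f \<circ> g) ^^ i) s = s \<longleftrightarrow> d dvd i" if "s \<in> U \<union> V" for s i
  proof (cases "s \<in> U")
    case True
    then have "((f \<circ> g) ^^ i) s = (f ^^ i) s" using assms(3) by (intro funpow_comp_disjoint(1)[OF p]) auto
    then show ?thesis using True assms(1) by (simp add: semireg_def)
  next
    case False
    then have "((f \<circ> g) ^^ i) s = (g ^^ i) s" using assms(3) by (intro funpow_comp_disjoint(2)[OF p]) auto
    then show ?thesis using False that assms(2) by (simp add: semireg_def)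
  qed
  ultimately show ?thesis by (simp add: semireg_def)
qed

subsection \<open>Counting roots of permutations\<close>

text \<open>Both generators are counted through this notion: y is a q-th root of x^2, and x is a
  (2m)-th root of the identity, whose cycles have length 1.\<close>

definition roots :: "nat \<Rightarrow> nat \<Rightarrow> 'a set \<Rightarrow> ('a \<Rightarrow> 'a) \<Rightarrow> ('a \<Rightarrow> 'a) set" where
  "roots d m S z = {y. semireg (d * m) S y \<and> y ^^ d = z}"

lemma finite_roots: "finite S \<Longrightarrow> finite (roots d m S z)"
  by (rule finite_subset[OF _ finite_permutations[of S]]) (auto simp: roots_def semireg_def)

context
  fixes d m :: nat and S :: "'a set" and z :: "'a \<Rightarrow> 'a"
  assumes d: "d > 0" and m: "m > 0" and fin: "finite S" and z: "semireg m S z"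
begin

text \<open>The entries lie in pairwise different cycles of \<open>z\<close>. A cycle of a d-th root
  merges d cycles of \<open>z\<close>, and its points a, y a, ..., y^(d-1) a represent each of them
  once; such a list is an initial piece of that sequence.\<close>

definition indep :: "'a list \<Rightarrow> bool" where
  "indep L \<longleftrightarrow> L \<noteq> [] \<and> set L \<subseteq> S \<and>
     (\<forall>i<length L. \<forall>j<length L. \<forall>k l. (z ^^ k) (L ! i) = (z ^^ l) (L ! j) \<longrightarrow> i = j)"

definition span :: "'a list \<Rightarrow> 'a set" where
  "span L = (\<Union>a\<in>set L. cyc z a)"

text \<open>Prescribes the beginning of the y-cycle of \<open>hd L\<close>. A list of length d
  prescribes the whole cycle, because y^d = z.\<close>

definition roots_through :: "'a list \<Rightarrow> ('a \<Rightarrow> 'a) set" where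
  "roots_through L = {y \<in> roots d m S z. \<forall>i<length L. (y ^^ i) (hd L) = L ! i}"

lemma span_subset: "indep L \<Longrightarrow> span L \<subseteq> S"
  using cyc_subset[OF semireg_permutes[OF z]] by (fastforce simp: span_def indep_def)

lemma card_span:
  assumes "indep L"
  shows "card (span L) = m * length L"
proof -
  have "card (span L) = card (\<Union>i<length L. cyc z (L ! i))"
    unfolding span_def set_conv_nth by (rule arg_cong[of _ _ card]) auto
  also have "\<dots> = (\<Sum>i<length L. card (cyc z (L ! i)))"
  proof (rule card_UN_disjoint)
    have "cyc z (L ! i) \<subseteq> S" if "i < length L" for i
      using that assms nth_mem by (intro cyc_subset[OF semireg_permutes[OF z]]) (auto simp: indep_def)
    then show "\<forall>i\<in>{..<length L}. finite (cyc z (L ! i))"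
      using fin finite_subset by blast
    show "\<forall>i\<in>{..<length L}. \<forall>j\<in>{..<length L}. i \<noteq> j \<longrightarrow> cyc z (L ! i) \<inter> cyc z (L ! j) = {}"
      using assms unfolding indep_def cyc_def by (auto 0 3)
  qed simp
  also have "\<dots> = (\<Sum>i<length L. m)"
    using assms nth_mem by (intro sum.cong refl card_cyc[OF z _ m]) (auto simp: indep_def)
  finally show ?thesis by simp
qed

lemma indep_snoc:
  assumes "indep L" "b \<in> S - span L"
  shows "indep (L @ [b])"
proof -
  have nb: "(z ^^ k) b \<noteq> (z ^^ l) (L ! i)" if "i < length L" for i k l
  proof
    assume eq: "(z ^^ k) b = (z ^^ l) (L ! i)"
    have Li: "L ! i \<in> S" using assms that nth_mem by (auto simp: indep_def)
    have "cyc z b = cyc z ((z ^^ k) b)"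
      using cyc_eqI[OF z m, of "(z ^^ k) b" b] assms(2) by (simp add: cyc_def)
    also have "\<dots> = cyc z (L ! i)"
      unfolding eq using Li cyc_eqI[OF z m] by (simp add: cyc_def)
    finally have "b \<in> cyc z (L ! i)" using in_cyc by metis
    then show False using assms(2) that by (auto simp: span_def)
  qed
  have "i = j" if "i < Suc (length L)" "j < Suc (length L)"
    "(z ^^ k) ((L @ [b]) ! i) = (z ^^ l) ((L @ [b]) ! j)" for i j k l
  proof (cases "i = length L"; cases "j = length L")
    assume "i \<noteq> length L" "j \<noteq> length L"
    then have "i < length L" "j < length L" "(z ^^ k) (L ! i) = (z ^^ l) (L ! j)"
      using that by (auto simp: nth_append)
    then show ?thesis using assms(1) unfolding indep_def by blast
  next
    assume "i = length L" "j \<noteq> length L"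
    then show ?thesis using that nb[of j k l] by (simp add: nth_append)
  next
    assume "i \<noteq> length L" "j = length L"
    then show ?thesis using that nb[of i l k] by (simp add: nth_append)
  qed simp
  then show ?thesis using assms by (auto simp: indep_def)
qed

lemma roots_funpow: "y \<in> roots d m S z \<Longrightarrow> (z ^^ k) ((y ^^ i) a) = (y ^^ (d * k + i)) a"
proof -
  assume "y \<in> roots d m S z"
  then have z_eq: "y ^^ d = z" unfolding roots_def by blast
  have "z ^^ k = y ^^ (d * k)" unfolding z_eq[symmetric] by (rule funpow_mult)
  then show "(z ^^ k) ((y ^^ i) a) = (y ^^ (d * k + i)) a" by (simp only: funpow_add comp_apply)
qed

text \<open>Splits by the next point y^n a of the cycle, where n is the length of \<open>L\<close>.
  This point avoids the z-cycles already met: y^n a = z^k (y^i a) with i < n would give n = dk + i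
  modulo dm, hence n = i modulo d, which is impossible below d.\<close>

lemma card_roots_through_step:
  assumes "indep L" "length L < d"
  shows "card (roots_through L) = (\<Sum>b\<in>S - span L. card (roots_through (L @ [b])))"
proof -
  let ?n = "length L" and ?a = "hd L"
  have L: "L \<noteq> []" "?a \<in> S" using assms by (auto simp: indep_def)
  have out: "(y ^^ ?n) ?a \<in> S - span L" if y: "y \<in> roots_through L" for y
  proof -
    have sr: "semireg (d * m) S y" and yr: "y \<in> roots d m S z"
      using y by (auto simp: roots_through_def roots_def)
    have "(y ^^ ?n) ?a \<noteq> (z ^^ k) (L ! i)" if "i < ?n" for i k
    proof
      assume "(y ^^ ?n) ?a = (z ^^ k) (L ! i)"
      also have "\<dots> = (z ^^ k) ((y ^^ i) ?a)" using y that by (simp add: roots_through_def)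
      also have "\<dots> = (y ^^ (d * k + i)) ?a" using roots_funpow[OF yr] .
      finally have "[?n = d * k + i] (mod d * m)"
        using semireg_funpow_eq_iff[OF sr L(2)] by simp
      then have "[?n = d * k + i] (mod d)" by (rule cong_dvd_modulus_nat) simp
      then show False using assms(2) that by (simp add: cong_def)
    qed
    moreover have "\<exists>i<?n. \<exists>k. s = (z ^^ k) (L ! i)" if "s \<in> span L" for s
      using that unfolding span_def cyc_def set_conv_nth by blast
    ultimately have "(y ^^ ?n) ?a \<notin> span L" by blast
    then show ?thesis using L sr permutes_funpow_in semireg_permutes by fastforce
  qed
  have eq: "roots_through L = (\<Union>b\<in>S - span L. roots_through (L @ [b]))"
  proof (intro equalityI subsetI)
    fix y assume y: "y \<in> roots_through L"
    then have "y \<in> roots_through (L @ [(y ^^ ?n) ?a])"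
      using L by (auto simp: roots_through_def nth_append less_Suc_eq)
    then show "y \<in> (\<Union>b\<in>S - span L. roots_through (L @ [b]))" using out[OF y] by blast
  next
    fix y assume "y \<in> (\<Union>b\<in>S - span L. roots_through (L @ [b]))"
    then show "y \<in> roots_through L"
      using L by (auto simp: roots_through_def nth_append split: if_splits)
  qed
  show ?thesis unfolding eq
  proof (rule card_UN_disjoint)
    show "\<forall>b\<in>S - span L. finite (roots_through (L @ [b]))"
      using finite_roots[OF fin] by (auto simp: roots_through_def)
    have "b = (y ^^ ?n) ?a" if "y \<in> roots_through (L @ [b])" for y b
    proof -
      have "\<forall>i<Suc ?n. (y ^^ i) ?a = (L @ [b]) ! i"
        using that L by (simp add: roots_through_def)
      then show ?thesis by (metis lessI nth_append_length)
    qed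
    then show "\<forall>b\<in>S - span L. \<forall>c\<in>S - span L. b \<noteq> c \<longrightarrow>
        roots_through (L @ [b]) \<inter> roots_through (L @ [c]) = {}" by blast
  qed (use fin in simp)
qed

text \<open>The cycle through the d given points is forced; \<open>P\<close> lists it, running
  through \<open>L\<close> and applying z once per round. What remains free is a root on the
  complement of this cycle, and composing with the forced cycle \<open>y0\<close> puts the two
  together again.\<close>

lemma card_roots_through_full:
  assumes L: "indep L" "length L = d"
  shows "card (roots_through L) = card (roots d m (S - span L) (perm_restrict z (S - span L)))"
proof -
  let ?U = "span L" and ?a = "hd L"
  let ?V = "S - ?U"
  define P where "P n = (z ^^ (n div d)) (L ! (n mod d))" for n
  have LS: "L ! i \<in> S" if "i < d" for i using that L nth_mem by (auto simp: indep_def)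
  have P_eq: "P i = P j \<longleftrightarrow> [i = j] (mod d * m)" for i j
  proof -
    have "P i = P j \<longleftrightarrow> i mod d = j mod d \<and> [i div d = j div d] (mod m)"
    proof
      assume eq: "P i = P j"
      then have "i mod d = j mod d"
        using L d unfolding P_def indep_def by (metis mod_less_divisor)
      then show "i mod d = j mod d \<and> [i div d = j div d] (mod m)"
        using eq semireg_funpow_eq_iff[OF z LS[of "i mod d"]] d by (simp add: P_def)
    next
      assume "i mod d = j mod d \<and> [i div d = j div d] (mod m)"
      then show "P i = P j"
        using semireg_funpow_eq_iff[OF z LS[of "i mod d"]] d by (simp add: P_def)
    qed
    also have "\<dots> \<longleftrightarrow> [i = j] (mod d * m)"
    proof -
      have eq: "n mod (d * m) = d * (n div d mod m) + n mod d" for n by (simp add: mod_mult2_eq)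
      show ?thesis
      proof
        assume "i mod d = j mod d \<and> [i div d = j div d] (mod m)"
        then show "[i = j] (mod d * m)" unfolding cong_def eq by simp
      next
        assume a: "[i = j] (mod d * m)"
        then have "[i = j] (mod d)" by (rule cong_dvd_modulus_nat) simp
        then have b: "i mod d = j mod d" by (simp add: cong_def)
        with a show "i mod d = j mod d \<and> [i div d = j div d] (mod m)"
          using d unfolding cong_def eq by simp
      qed
    qed
    finally show ?thesis .
  qed
  have P_range: "range P = ?U"
  proof (intro equalityI subsetI)
    fix s assume "s \<in> range P"
    then obtain n where n: "s = P n" by blast
    have "L ! (n mod d) \<in> set L" using L d by simp
    moreover have "s \<in> cyc z (L ! (n mod d))" unfolding n P_def cyc_def by blast
    ultimately show "s \<in> ?U" unfolding span_def by blast
  next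
    fix s assume "s \<in> ?U"
    then obtain a where "a \<in> set L" "s \<in> cyc z a" unfolding span_def by blast
    then obtain i k where "i < d" "s = (z ^^ k) (L ! i)"
      using L(2) unfolding cyc_def in_set_conv_nth by blast
    moreover from \<open>i < d\<close> have "(d * k + i) div d = k" "(d * k + i) mod d = i" by simp_all
    ultimately have "s = P (d * k + i)" unfolding P_def by (simp only:)
    then show "s \<in> range P" by simp
  qed
  have zP: "z (P n) = P (n + d)" for n using d by (simp add: P_def div_add_self2)
  have US: "?U \<subseteq> S" using span_subset[OF L(1)] .
  have zU: "z ` ?U \<subseteq> ?U" unfolding P_range[symmetric] using zP by auto
  have zV: "z ` ?V \<subseteq> ?V" using image_Diff_invariant[OF semireg_permutes[OF z] fin US zU] .
  have P0: "P 0 = ?a" using L by (auto simp: P_def hd_conv_nth indep_def)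
  have yP: "(y ^^ n) ?a = P n" if y: "y \<in> roots_through L" for y n
  proof -
    have yr: "y \<in> roots d m S z" using y by (simp add: roots_through_def)
    have "(y ^^ n) ?a = (z ^^ (n div d)) ((y ^^ (n mod d)) ?a)"
      by (subst roots_funpow[OF yr]) simp
    then show ?thesis using y L d by (simp add: P_def roots_through_def)
  qed
  have yU: "y s = P (Suc n)" if "y \<in> roots_through L" "s = P n" for y s n
    using that yP[of y n] yP[of y "Suc n"] by simp
  \<comment> \<open>The choice picks some index of s in the listing. Such an index is determined
    modulo d * m, hence so is the next point.\<close>
  define y0 where "y0 s = (if s \<in> ?U then P (Suc (SOME n. P n = s)) else s)" for s
  have y0P: "y0 (P n) = P (Suc n)" for n
  proof -
    have "P (SOME k. P k = P n) = P n" by (rule someI[of "\<lambda>k. P k = P n"]) simp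
    then have "P (Suc (SOME k. P k = P n)) = P (Suc n)"
      unfolding P_eq using cong_add[of _ _ _ 1 1] by force
    then show ?thesis using P_range by (auto simp: y0_def)
  qed
  have y0P': "(y0 ^^ i) (P n) = P (n + i)" for i n by (induction i) (auto simp: y0P)
  have "inj_on y0 ?U"
  proof (rule inj_onI)
    fix s t assume "s \<in> ?U" "t \<in> ?U" "y0 s = y0 t"
    then obtain i j where ij: "s = P i" "t = P j" "P (Suc i) = P (Suc j)"
      unfolding P_range[symmetric] by (auto simp: y0P)
    then have "[i + 1 = j + 1] (mod d * m)" by (simp add: P_eq)
    then have "[i = j] (mod d * m)" by (simp only: cong_add_rcancel_nat)
    then show "s = t" using ij P_eq by simp
  qed
  moreover have "y0 ` ?U \<subseteq> ?U" unfolding P_range[symmetric] using y0P by auto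
  moreover have "finite ?U" using US fin finite_subset by blast
  ultimately have "bij_betw y0 ?U ?U" unfolding bij_betw_def by (metis endo_inj_surj)
  then have y0perm: "y0 permutes ?U" by (rule bij_imp_permutes) (simp add: y0_def)
  have y0sr: "semireg (d * m) ?U y0"
    unfolding semireg_def
  proof (intro conjI ballI allI)
    fix s i assume "s \<in> ?U"
    then obtain n where n: "s = P n" unfolding P_range[symmetric] by blast
    have "(y0 ^^ i) s = P (n + i)" "s = P (n + 0)" by (simp_all only: n y0P' add_0_right)
    then have "(y0 ^^ i) s = s \<longleftrightarrow> [n + i = n + 0] (mod d * m)" by (metis P_eq)
    also have "\<dots> \<longleftrightarrow> d * m dvd i" by (simp only: cong_add_lcancel_nat cong_0_iff)
    finally show "(y0 ^^ i) s = s \<longleftrightarrow> d * m dvd i" .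
  qed (rule y0perm)
  have y0z: "(y0 ^^ d) s = z s" if "s \<in> ?U" for s
    using that unfolding P_range[symmetric] by (auto simp: y0P' zP)
  let ?R = "roots d m ?V (perm_restrict z ?V)"
  have "bij_betw (\<lambda>y. perm_restrict y ?V) (roots_through L) ?R"
  proof (rule bij_betw_byWitness[where f' = "\<lambda>y. y0 \<circ> y"])
    have yUU: "y ` ?U \<subseteq> ?U" if "y \<in> roots_through L" for y
      unfolding P_range[symmetric] using yU[OF that] by auto
    show "\<forall>y\<in>roots_through L. y0 \<circ> perm_restrict y ?V = y"
    proof (intro ballI ext)
      fix y s assume y: "y \<in> roots_through L"
      have perm: "y permutes S" using y by (auto simp: roots_through_def roots_def semireg_def)
      consider "s \<in> ?U" | "s \<in> ?V" | "s \<notin> S" by blast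
      then show "(y0 \<circ> perm_restrict y ?V) s = y s"
      proof cases
        case 1
        then obtain n where "s = P n" unfolding P_range[symmetric] by blast
        then show ?thesis using 1 yU[OF y] by (simp add: perm_restrict_def y0P)
      next
        case 2
        then have "y s \<in> ?V" using image_Diff_invariant[OF perm fin US yUU[OF y]] by blast
        then show ?thesis using 2 by (simp add: perm_restrict_def y0_def)
      next
        case 3
        then show ?thesis using US perm by (auto simp: perm_restrict_def y0_def permutes_not_in)
      qed
    qed
    show "\<forall>y\<in>?R. perm_restrict (y0 \<circ> y) ?V = y"
    proof (intro ballI ext)
      fix y s assume y: "y \<in> ?R"
      then have perm: "y permutes ?V" by (auto simp: roots_def semireg_def)
      show "perm_restrict (y0 \<circ> y) ?V s = y s"
      proof (cases "s \<in> ?V")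
        case True
        then have "y s \<in> ?V" using permutes_in_image[OF perm] by blast
        then show ?thesis using True by (simp add: perm_restrict_def y0_def)
      qed (use perm in \<open>auto simp: perm_restrict_def permutes_not_in\<close>)
    qed
    show "(\<lambda>y. perm_restrict y ?V) ` roots_through L \<subseteq> ?R"
    proof (intro image_subsetI)
      fix y assume y: "y \<in> roots_through L"
      then have sr: "semireg (d * m) S y" and yd: "y ^^ d = z"
        unfolding roots_through_def roots_def by blast+
      have yV: "y ` ?V \<subseteq> ?V" using image_Diff_invariant[OF semireg_permutes[OF sr] fin US yUU[OF y]] .
      have "perm_restrict y ?V ^^ d = perm_restrict z ?V"
        unfolding funpow_perm_restrict_eq[OF yV] yd ..
      then show "perm_restrict y ?V \<in> ?R"
        using semireg_perm_restrict[OF sr fin _ yV] by (simp add: roots_def)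
    qed
    show "(\<lambda>y. y0 \<circ> y) ` ?R \<subseteq> roots_through L"
    proof (intro image_subsetI)
      fix y assume y: "y \<in> ?R"
      then have sr: "semireg (d * m) ?V y" and yd: "y ^^ d = perm_restrict z ?V"
        unfolding roots_def by blast+
      note fc = funpow_comp_disjoint[OF y0perm semireg_permutes[OF sr]]
      have "semireg (d * m) (?U \<union> ?V) (y0 \<circ> y)" by (rule semireg_comp[OF y0sr sr]) blast
      moreover have "?U \<union> ?V = S" using US by blast
      moreover have "((y0 \<circ> y) ^^ d) s = z s" for s
      proof (cases "s \<in> ?U")
        case True
        then have "((y0 \<circ> y) ^^ d) s = (y0 ^^ d) s" by (intro fc(1)) auto
        then show ?thesis using y0z[OF True] by simp
      next
        case False
        then have "((y0 \<circ> y) ^^ d) s = (y ^^ d) s" by (intro fc(2)) auto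
        then show ?thesis unfolding yd using False permutes_not_in[OF semireg_permutes[OF z]]
          by (auto simp: perm_restrict_def)
      qed
      moreover have "((y0 \<circ> y) ^^ i) ?a = L ! i" if "i < d" for i
      proof -
        have "?a \<in> ?U" using P0 P_range by (metis rangeI)
        then have "((y0 \<circ> y) ^^ i) ?a = (y0 ^^ i) (P 0)" unfolding P0 by (intro fc(1)) auto
        then have "((y0 \<circ> y) ^^ i) ?a = P i" unfolding y0P' by simp
        then show ?thesis using that by (simp add: P_def)
      qed
      ultimately show "y0 \<circ> y \<in> roots_through L"
        unfolding roots_through_def roots_def L(2) by (auto intro: ext)
    qed
  qed
  then show ?thesis by (rule bij_betw_same_card)
qed

text \<open>Induction on the number \<open>t\<close> of points still to be chosen. The point with
  index i must avoid i cycles of \<open>z\<close>, each of size m, which gives the factor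
  \<open>card S - m * i\<close>. The number of roots on the complement of a full cycle enters as r /
  c; carrying \<open>c\<close> along avoids division.\<close>

lemma card_roots_through:
  assumes r: "\<And>U. U \<subseteq> S \<Longrightarrow> z ` U \<subseteq> U \<Longrightarrow> card U = d * m \<Longrightarrow>
      card (roots d m (S - U) (perm_restrict z (S - U))) * c = r"
    and "t < d" "indep L" "length L = d - t"
  shows "card (roots_through L) * c = (\<Prod>i = d - t..<d. card S - m * i) * r"
  using assms(2-4)
proof (induction t arbitrary: L)
  case 0
  have "z ` cyc z a \<subseteq> cyc z a" for a
  proof (rule image_subsetI)
    fix s assume "s \<in> cyc z a"
    then obtain i where "s = (z ^^ i) a" unfolding cyc_def by blast
    then have "z s = (z ^^ Suc i) a" by simp
    then show "z s \<in> cyc z a" unfolding cyc_def by blast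
  qed
  then have "z ` span L \<subseteq> span L" unfolding span_def by blast
  moreover have "card (span L) = d * m" using card_span[of L] 0 by (simp only: minus_nat.diff_0 mult.commute)
  ultimately have "card (roots_through L) * c = r"
    using r[of "span L"] span_subset[of L] card_roots_through_full[of L] 0 by (simp only: minus_nat.diff_0)
  then show ?case by simp
next
  case (Suc t)
  have "card (roots_through (L @ [b])) * c = (\<Prod>i = d - t..<d. card S - m * i) * r"
    if "b \<in> S - span L" for b
  proof (rule Suc.IH)
    show "indep (L @ [b])" using indep_snoc[OF _ that] Suc.prems by blast
    show "t < d" "length (L @ [b]) = d - t" using Suc.prems by auto
  qed
  then have "(\<Sum>b\<in>S - span L. card (roots_through (L @ [b])) * c) =
      (\<Sum>b\<in>S - span L. (\<Prod>i = d - t..<d. card S - m * i) * r)"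
    by (rule sum.cong[OF refl])
  moreover have "card (roots_through L) = (\<Sum>b\<in>S - span L. card (roots_through (L @ [b])))"
    using Suc.prems by (intro card_roots_through_step) auto
  ultimately have "card (roots_through L) * c =
      card (S - span L) * ((\<Prod>i = d - t..<d. card S - m * i) * r)"
    by (simp only: sum_distrib_right sum_constant of_nat_id)
  also have "card (S - span L) = card S - m * (d - Suc t)"
    using Suc.prems span_subset[of L] card_span[of L]
    by (subst card_Diff_subset) (auto intro: finite_subset[OF _ fin])
  finally have "card (roots_through L) * c =
      (card S - m * (d - Suc t)) * (\<Prod>i = d - t..<d. card S - m * i) * r" by simp
  moreover have "{d - Suc t..<d} = insert (d - Suc t) {d - t..<d}" using Suc.prems by auto
  moreover have "d - Suc t \<notin> {d - t..<d}" using Suc.prems by auto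
  ultimately show ?case by simp
qed

text \<open>The cycle chosen is that of a fixed point a. As a is not a choice, the product starts at
  i = 1.\<close>

lemma card_roots_step:
  assumes r: "\<And>U. U \<subseteq> S \<Longrightarrow> z ` U \<subseteq> U \<Longrightarrow> card U = d * m \<Longrightarrow>
      card (roots d m (S - U) (perm_restrict z (S - U))) * c = r"
    and "S \<noteq> {}"
  shows "card (roots d m S z) * c = (\<Prod>i = 1..<d. card S - m * i) * r"
proof -
  obtain a where a: "a \<in> S" using assms(2) by blast
  have "roots_through [a] = roots d m S z" by (auto simp: roots_through_def)
  moreover have "indep [a]" using a by (simp add: indep_def)
  moreover have "d - 1 < d" "d - (d - 1) = 1" using d by auto
  ultimately show ?thesis using card_roots_through[OF r, of "d - 1" "[a]"]
    by (simp only: list.size add_0 One_nat_def)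
qed

end

lemma prod_diff_fact:
  fixes K d :: nat
  shows "d \<le> K \<Longrightarrow> (\<Prod>i<d. K - i) * fact (K - d) = fact K"
proof (induction d)
  case (Suc d)
  then have "fact (K - d) = (K - d) * fact (K - Suc d)"
    by (metis Suc_diff_Suc Suc_le_lessD fact_Suc of_nat_id)
  then show ?case using Suc by (simp add: mult.assoc)
qed simp

text \<open>The dj cycles of z are distributed into j cyclically ordered blocks of d, in (dj)! /
  (d^j j!) ways, and merging a block allows m^(d-1) relative shifts. The proof removes one cycle of
  the root at a time and keeps the denominators on the left.\<close>

theorem card_roots:
  assumes "d > 0" "m > 0" "finite S" "semireg m S z" "card S = d * m * j"
  shows "card (roots d m S z) * (d ^ j * fact j) = m ^ ((d - 1) * j) * fact (d * j)"
  using assms(3-5)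
proof (induction j arbitrary: S z)
  case 0
  then have "S = {}" by simp
  then have "roots d m S z = {id}" using 0 by (auto simp: roots_def semireg_def)
  then show ?case by simp
next
  case (Suc j)
  let ?K = "d * Suc j"
  have r: "card (roots d m (S - U) (perm_restrict z (S - U))) * (d ^ j * fact j) =
      m ^ ((d - 1) * j) * fact (d * j)"
    if U: "U \<subseteq> S" "z ` U \<subseteq> U" "card U = d * m" for U
  proof -
    have "semireg m (S - U) (perm_restrict z (S - U))"
      by (rule semireg_perm_restrict[OF Suc.prems(2,1) _
            image_Diff_invariant[OF semireg_permutes[OF Suc.prems(2)] Suc.prems(1) U(1,2)]]) simp
    moreover have "card (S - U) = d * m * j"
      using Suc.prems U by (subst card_Diff_subset) (auto intro: finite_subset)
    ultimately show ?thesis using Suc by simp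
  qed
  have "S \<noteq> {}" using Suc.prems assms by auto
  have step: "card (roots d m S z) * (d ^ j * fact j) =
      (\<Prod>i = 1..<d. card S - m * i) * (m ^ ((d - 1) * j) * fact (d * j))"
    using card_roots_step[OF assms(1,2) Suc.prems(1,2) r \<open>S \<noteq> {}\<close>] by blast
  have "(\<Prod>i = 1..<d. card S - m * i) = (\<Prod>i = 1..<d. m * (?K - i))"
  proof (intro prod.cong refl)
    have "card S = m * ?K" using Suc.prems by (simp only: mult_ac)
    then show "card S - m * i = m * (?K - i)" for i by (simp only: diff_mult_distrib2)
  qed
  also have "\<dots> = m ^ (d - 1) * (\<Prod>i = 1..<d. ?K - i)"
    by (simp add: prod.distrib)
  finally have prod: "(\<Prod>i = 1..<d. card S - m * i) = m ^ (d - 1) * (\<Prod>i = 1..<d. ?K - i)" .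
  have "{..<d} = insert 0 {1..<d}" using assms(1) by auto
  then have fact: "?K * (\<Prod>i = 1..<d. ?K - i) * fact (d * j) = fact ?K"
    using prod_diff_fact[of d ?K] by simp
  \<comment> \<open>The denominator grows by \<open>d * Suc j\<close>, which is exactly the factor i
    = 0 missing from the product.\<close>
  have "card (roots d m S z) * (d ^ Suc j * fact (Suc j)) =
      (card (roots d m S z) * (d ^ j * fact j)) * ?K"
    by (simp only: power_Suc fact_Suc of_nat_id mult_ac)
  also have "\<dots> = (m ^ (d - 1) * m ^ ((d - 1) * j)) * (?K * (\<Prod>i = 1..<d. ?K - i) * fact (d * j))"
    unfolding step prod by (simp only: mult_ac)
  also have "\<dots> = m ^ ((d - 1) * Suc j) * fact ?K"
    unfolding fact by (simp add: power_add)
  finally show ?case .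
qed

subsection \<open>Pairs of permutations\<close>

definition pairs :: "nat \<Rightarrow> nat \<Rightarrow> 'a set \<Rightarrow> (('a \<Rightarrow> 'a) \<times> ('a \<Rightarrow> 'a)) set" where
  "pairs m q S = {(x, y). semireg (2 * m) S x \<and> semireg (q * m) S y \<and> x ^^ 2 = y ^^ q}"

text \<open>Forward steps already sweep out the whole orbit, since both generators have finite order
  in the actions considered.\<close>

inductive_set reach :: "('a \<Rightarrow> 'a) \<Rightarrow> ('a \<Rightarrow> 'a) \<Rightarrow> 'a \<Rightarrow> 'a set"
  for x y :: "'a \<Rightarrow> 'a" and s0 :: 'a where
  reach_base: "s0 \<in> reach x y s0"
| reach_x: "s \<in> reach x y s0 \<Longrightarrow> x s \<in> reach x y s0"
| reach_y: "s \<in> reach x y s0 \<Longrightarrow> y s \<in> reach x y s0"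

definition trans_pairs :: "nat \<Rightarrow> nat \<Rightarrow> 'a set \<Rightarrow> 'a \<Rightarrow> (('a \<Rightarrow> 'a) \<times> ('a \<Rightarrow> 'a)) set" where
  "trans_pairs m q S s0 = {(x, y) \<in> pairs m q S. S \<subseteq> reach x y s0}"

lemma reach_subset:
  assumes "s0 \<in> S" "x ` S \<subseteq> S" "y ` S \<subseteq> S"
  shows "reach x y s0 \<subseteq> S"
proof
  fix s assume "s \<in> reach x y s0"
  then show "s \<in> S" by induction (use assms in auto)
qed

lemma finite_pairs:
  assumes "finite S"
  shows "finite (pairs m q S)"
proof (rule finite_subset)
  show "pairs m q S \<subseteq> {x. x permutes S} \<times> {y. y permutes S}"
    by (auto simp: pairs_def semireg_def)
qed (use assms finite_permutations in blast)

lemma semireg_square: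
  assumes "semireg (2 * m) S x"
  shows "semireg m S (x ^^ 2)"
proof -
  have "x ^^ 2 permutes S"
    using assms by (simp add: semireg_def numeral_2_eq_2 permutes_compose)
  moreover have "((x ^^ 2) ^^ i) s = s \<longleftrightarrow> m dvd i" if "s \<in> S" for s i
    using assms that by (simp add: semireg_def funpow_mult)
  ultimately show ?thesis by (simp add: semireg_def)
qed

text \<open>The number of q-th roots of x^2 is the same for every x, so the count is a product. The
  two brackets on the left are the denominators for x and for y.\<close>

lemma card_pairs:
  assumes "m > 0" "q > 0" "finite S" "card S = 2 * q * m * l"
  shows "card (pairs m q S) * (((2 * m) ^ (q * l) * fact (q * l)) * (q ^ (2 * l) * fact (2 * l))) =
    fact (2 * q * m * l) * (m ^ ((q - 1) * (2 * l)) * fact (q * (2 * l)))"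
proof -
  let ?X = "roots (2 * m) 1 S id" and ?c = "q ^ (2 * l) * fact (2 * l)"
    and ?d = "(2 * m) ^ (q * l) * fact (q * l)"
  have X: "?X = {x. semireg (2 * m) S x}"
    using semireg_funpow_id[of "2 * m" S _ 1] by (auto simp: roots_def)
  have "pairs m q S = Sigma ?X (\<lambda>x. roots q m S (x ^^ 2))"
    unfolding X by (auto simp: pairs_def roots_def)
  then have "card (pairs m q S) * ?c = (\<Sum>x\<in>?X. card (roots q m S (x ^^ 2)) * ?c)"
    using finite_roots[OF assms(3)] by (simp add: sum_distrib_right)
  also have "\<dots> = (\<Sum>x\<in>?X. m ^ ((q - 1) * (2 * l)) * fact (q * (2 * l)))"
  proof (rule sum.cong[OF refl])
    fix x assume "x \<in> ?X"
    then have "semireg m S (x ^^ 2)" unfolding X by (simp add: semireg_square)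
    then show "card (roots q m S (x ^^ 2)) * ?c = m ^ ((q - 1) * (2 * l)) * fact (q * (2 * l))"
      using assms by (intro card_roots) auto
  qed
  also have "\<dots> = card ?X * (m ^ ((q - 1) * (2 * l)) * fact (q * (2 * l)))"
    by (simp only: sum_constant of_nat_id)
  finally have 1: "card (pairs m q S) * ?c = card ?X * (m ^ ((q - 1) * (2 * l)) * fact (q * (2 * l)))" .
  have "card ?X * ?d = 1 ^ ((2 * m - 1) * (q * l)) * fact (2 * m * (q * l))"
    using assms by (intro card_roots) (auto simp: semireg_def)
  then have 2: "card ?X * ?d = fact (2 * q * m * l)" by (simp add: mult_ac)
  have "card (pairs m q S) * (?d * ?c) = (card (pairs m q S) * ?c) * ?d" by (simp only: mult_ac)
  also have "\<dots> = (card ?X * ?d) * (m ^ ((q - 1) * (2 * l)) * fact (q * (2 * l)))"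
    unfolding 1 by (simp only: mult_ac)
  finally show ?thesis unfolding 2 .
qed

text \<open>Both 2m and qm divide the number of points; after cancelling m, oddness of q makes 2 and
  q coprime.\<close>

lemma pairs_dvd_card:
  assumes "m > 0" "odd q" "finite S" "pairs m q S \<noteq> {}"
  shows "2 * q * m dvd card S"
proof -
  obtain x y where "semireg (2 * m) S x" "semireg (q * m) S y"
    using assms(4) by (auto simp: pairs_def)
  then have d: "2 * m dvd card S" "q * m dvd card S"
    using assms semireg_dvd_card odd_pos by (metis mult_pos_pos zero_less_numeral)+
  then obtain c where c: "card S = m * c" by (metis dvd_mult_right dvdE)
  have "2 dvd c" "q dvd c" using d assms(1) unfolding c by (simp_all add: mult.commute)
  then have "2 * q dvd c" using assms(2) by (simp add: divides_mult)
  then show ?thesis unfolding c using mult_dvd_mono[OF dvd_refl[of m]] by (simp add: mult_ac)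
qed

lemma pairs_permutes:
  assumes "(x, y) \<in> pairs m q S"
  shows "x permutes S" "y permutes S"
  using assms by (simp_all add: pairs_def semireg_def)

lemma pairs_perm_restrict:
  assumes "(x, y) \<in> pairs m q S" "finite S" "U \<subseteq> S" "x ` U \<subseteq> U" "y ` U \<subseteq> U"
  shows "(perm_restrict x U, perm_restrict y U) \<in> pairs m q U"
  using assms semireg_perm_restrict[of _ S _ U]
  by (simp add: pairs_def funpow_perm_restrict_eq)

lemma pairs_comp:
  assumes "(x, y) \<in> pairs m q U" "(x', y') \<in> pairs m q V" "U \<inter> V = {}"
  shows "(x \<circ> x', y \<circ> y') \<in> pairs m q (U \<union> V)"
proof -
  note p = pairs_permutes[OF assms(1)] pairs_permutes[OF assms(2)]
  have "((x \<circ> x') ^^ 2) s = ((y \<circ> y') ^^ q) s" for s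
  proof (cases "s \<in> V")
    case True
    then have "s \<notin> U" using assms(3) by blast
    then have "((x \<circ> x') ^^ 2) s = (x' ^^ 2) s" "((y \<circ> y') ^^ q) s = (y' ^^ q) s"
      using funpow_comp_disjoint(2)[OF p(1,3) assms(3)] funpow_comp_disjoint(2)[OF p(2,4) assms(3)]
      by blast+
    moreover have "x' ^^ 2 = y' ^^ q" using assms(2) unfolding pairs_def by blast
    ultimately show ?thesis by metis
  next
    case False
    then have "((x \<circ> x') ^^ 2) s = (x ^^ 2) s" "((y \<circ> y') ^^ q) s = (y ^^ q) s"
      using funpow_comp_disjoint(1)[OF p(1,3) assms(3)] funpow_comp_disjoint(1)[OF p(2,4) assms(3)]
      by blast+
    moreover have "x ^^ 2 = y ^^ q" using assms(1) unfolding pairs_def by blast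
    ultimately show ?thesis by metis
  qed
  then have "(x \<circ> x') ^^ 2 = (y \<circ> y') ^^ q" by (rule ext)
  then show ?thesis
    using assms semireg_comp[OF _ _ assms(3)] unfolding pairs_def by blast
qed

lemma perm_restrict_comp_disjoint:
  assumes "f permutes U" "g permutes V" "U \<inter> V = {}"
  shows "perm_restrict (f \<circ> g) U = f" "perm_restrict (f \<circ> g) V = g"
proof -
  show "perm_restrict (f \<circ> g) U = f"
  proof
    fix s show "perm_restrict (f \<circ> g) U s = f s"
      using funpow_comp_disjoint(1)[OF assms, of s 1] assms permutes_not_in[OF assms(1)]
      by (cases "s \<in> U") (auto simp: perm_restrict_def)
  qed
  show "perm_restrict (f \<circ> g) V = g"
  proof
    fix s show "perm_restrict (f \<circ> g) V s = g s"
      using funpow_comp_disjoint(2)[OF assms, of s 1] assms permutes_not_in[OF assms(2)]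
      by (cases "s \<in> V") (auto simp: perm_restrict_def)
  qed
qed

lemma perm_restrict_comp_complement:
  assumes "f permutes S" "U \<subseteq> S" "f ` (S - U) \<subseteq> S - U"
  shows "perm_restrict f U \<circ> perm_restrict f (S - U) = f"
proof
  fix s
  show "(perm_restrict f U \<circ> perm_restrict f (S - U)) s = f s"
    using assms permutes_not_in[OF assms(1), of s] by (auto simp: perm_restrict_def)
qed

text \<open>\<open>U\<close> is the orbit of \<open>s0\<close>. A pair is cut into its restrictions
  to \<open>U\<close> and to the complement, and composing pieces with disjoint supports reverses
  this.\<close>

lemma card_pairs_decompose:
  assumes fin: "finite S" and s0: "s0 \<in> S"
  shows "card (pairs m q S) =
    (\<Sum>U | s0 \<in> U \<and> U \<subseteq> S. card (trans_pairs m q U s0) * card (pairs m q (S - U)))"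
proof -
  let ?I = "{U. s0 \<in> U \<and> U \<subseteq> S}"
  let ?D = "Sigma ?I (\<lambda>U. trans_pairs m q U s0 \<times> pairs m q (S - U))"
  let ?F = "\<lambda>(x, y). let U = reach x y s0 in
      (U, (perm_restrict x U, perm_restrict y U), (perm_restrict x (S - U), perm_restrict y (S - U)))"
  let ?G = "\<lambda>(U :: 'a set, (x :: 'a \<Rightarrow> 'a, y :: 'a \<Rightarrow> 'a), (x' :: 'a \<Rightarrow> 'a, y' :: 'a \<Rightarrow> 'a)). (x \<circ> x', y \<circ> y')"
  have F: "?F (x, y) \<in> ?D \<and> ?G (?F (x, y)) = (x, y)" if xy: "(x, y) \<in> pairs m q S" for x y
  proof -
    let ?U = "reach x y s0"
    note p = pairs_permutes[OF xy]
    have US: "?U \<subseteq> S" using s0 p by (intro reach_subset) (simp_all add: permutes_image)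
    have inv: "x ` ?U \<subseteq> ?U" "y ` ?U \<subseteq> ?U" by (auto intro: reach.intros)
    have inv': "x ` (S - ?U) \<subseteq> S - ?U" "y ` (S - ?U) \<subseteq> S - ?U"
      using image_Diff_invariant[OF p(1) fin US inv(1)] image_Diff_invariant[OF p(2) fin US inv(2)] .
    have "s \<in> reach (perm_restrict x ?U) (perm_restrict y ?U) s0" if "s \<in> ?U" for s
      using that
    proof induction
      case (reach_x s)
      then show ?case
        using reach.reach_x[of s "perm_restrict x ?U"] by (metis perm_restrict_simps(1))
    next
      case (reach_y s)
      then show ?case
        using reach.reach_y[of s _ "perm_restrict y ?U"] by (metis perm_restrict_simps(1))
    qed (rule reach.reach_base)
    then have "(perm_restrict x ?U, perm_restrict y ?U) \<in> trans_pairs m q ?U s0"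
      using pairs_perm_restrict[OF xy fin US inv] by (auto simp: trans_pairs_def)
    moreover have "(perm_restrict x (S - ?U), perm_restrict y (S - ?U)) \<in> pairs m q (S - ?U)"
      using pairs_perm_restrict[OF xy fin _ inv'] by blast
    moreover have "s0 \<in> ?U" by (rule reach.reach_base)
    ultimately show ?thesis
      using US perm_restrict_comp_complement[OF p(1) US inv'(1)]
        perm_restrict_comp_complement[OF p(2) US inv'(2)] by (simp add: Let_def)
  qed
  have G: "?G (U, (x, y), (x', y')) \<in> pairs m q S \<and>
      ?F (?G (U, (x, y), (x', y'))) = (U, (x, y), (x', y'))"
    if U: "s0 \<in> U" "U \<subseteq> S" and xy: "(x, y) \<in> trans_pairs m q U s0"
      and xy': "(x', y') \<in> pairs m q (S - U)" for U x y x' y'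
  proof -
    have xy0: "(x, y) \<in> pairs m q U" using xy by (simp add: trans_pairs_def)
    note p = pairs_permutes[OF xy0] pairs_permutes[OF xy']
    have dis: "U \<inter> (S - U) = {}" by blast
    have "(x \<circ> x', y \<circ> y') \<in> pairs m q (U \<union> (S - U))" by (rule pairs_comp[OF xy0 xy' dis])
    then have 1: "(x \<circ> x', y \<circ> y') \<in> pairs m q S" using U by (simp add: Un_absorb1)
    have onU: "(x \<circ> x') s = x s" "(y \<circ> y') s = y s" if "s \<in> U" for s
      using that permutes_not_in[OF p(3), of s] permutes_not_in[OF p(4), of s] by auto
    have "reach (x \<circ> x') (y \<circ> y') s0 = U"
    proof
      show "reach (x \<circ> x') (y \<circ> y') s0 \<subseteq> U"
        using U onU p(1,2) by (intro reach_subset) (auto simp: permutes_in_image)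
      have "s \<in> U \<and> s \<in> reach (x \<circ> x') (y \<circ> y') s0" if "s \<in> reach x y s0" for s
        using that
      proof induction
        case (reach_x s)
        then show ?case
          using reach.reach_x[of s "x \<circ> x'" "y \<circ> y'" s0] onU(1)[of s] permutes_in_image[OF p(1), of s]
          by (simp del: comp_apply)
      next
        case (reach_y s)
        then show ?case
          using reach.reach_y[of s "x \<circ> x'" "y \<circ> y'" s0] onU(2)[of s] permutes_in_image[OF p(2), of s]
          by (simp del: comp_apply)
      qed (use U in \<open>auto intro: reach.reach_base\<close>)
      then show "U \<subseteq> reach (x \<circ> x') (y \<circ> y') s0" using xy unfolding trans_pairs_def by blast
    qed
    then show ?thesis
      using 1 perm_restrict_comp_disjoint[OF p(1,3) dis] perm_restrict_comp_disjoint[OF p(2,4) dis]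
      by (simp add: Let_def)
  qed
  have "bij_betw ?F (pairs m q S) ?D"
  proof (rule bij_betw_byWitness[where f' = ?G])
    show "\<forall>p\<in>pairs m q S. ?G (?F p) = p"
    proof
      fix p assume "p \<in> pairs m q S"
      then show "?G (?F p) = p" using F[of "fst p" "snd p"] unfolding prod.collapse by blast
    qed
    have "?G d \<in> pairs m q S \<and> ?F (?G d) = d" if "d \<in> ?D" for d
    proof -
      obtain U x y x' y' where d: "d = (U, (x, y), (x', y'))" by (metis prod.exhaust_sel)
      show ?thesis using that unfolding d by (intro G) auto
    qed
    then show "\<forall>d\<in>?D. ?F (?G d) = d" "?G ` ?D \<subseteq> pairs m q S" by auto
    show "?F ` pairs m q S \<subseteq> ?D"
    proof (rule image_subsetI)
      fix p assume "p \<in> pairs m q S"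
      then show "?F p \<in> ?D" using F[of "fst p" "snd p"] unfolding prod.collapse by blast
    qed
  qed
  then have "card (pairs m q S) = card ?D" by (rule bij_betw_same_card)
  also have "\<dots> = (\<Sum>U\<in>?I. card (trans_pairs m q U s0 \<times> pairs m q (S - U)))"
  proof (rule card_SigmaI)
    show "finite ?I" using fin by simp
    have "finite (trans_pairs m q U s0)" if "U \<in> ?I" for U
      using that fin finite_pairs[of U m q]
      by (auto simp: trans_pairs_def intro: finite_subset[of _ "pairs m q U"] dest: finite_subset)
    then show "\<forall>U\<in>?I. finite (trans_pairs m q U s0 \<times> pairs m q (S - U))"
      using fin by (auto intro: finite_pairs)
  qed
  finally show ?thesis by (simp add: card_cartesian_product)
qed

lemma sum_pointed_subsets:
  fixes g :: "nat \<Rightarrow> 'b :: comm_semiring_1"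
  assumes "finite S" "s0 \<in> S"
  shows "(\<Sum>U | s0 \<in> U \<and> U \<subseteq> S. g (card U)) =
    (\<Sum>n = 1..card S. of_nat ((card S - 1) choose (n - 1)) * g n)"
proof -
  let ?I = "{U. s0 \<in> U \<and> U \<subseteq> S}"
  have "(\<Sum>U\<in>?I. g (card U)) = (\<Sum>n\<in>{1..card S}. \<Sum>U\<in>{U \<in> ?I. card U = n}. g (card U))"
  proof (rule sum.group[symmetric])
    show "card ` ?I \<subseteq> {1..card S}"
    proof (rule image_subsetI)
      fix U assume "U \<in> ?I"
      then have "U \<subseteq> S" "U \<noteq> {}" by auto
      then show "card U \<in> {1..card S}"
        using assms(1) card_mono[of S U] card_gt_0_iff[of U] finite_subset[of U S] by auto
    qed
  qed (use assms in auto)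
  also have "\<dots> = (\<Sum>n\<in>{1..card S}. of_nat ((card S - 1) choose (n - 1)) * g n)"
  proof (rule sum.cong[OF refl])
    fix n assume n: "n \<in> {1..card S}"
    have "bij_betw (insert s0) {W. W \<subseteq> S - {s0} \<and> card W = n - 1} {U \<in> ?I. card U = n}"
    proof (rule bij_betw_byWitness[where f' = "\<lambda>U. U - {s0}"])
      show "insert s0 ` {W. W \<subseteq> S - {s0} \<and> card W = n - 1} \<subseteq> {U \<in> ?I. card U = n}"
      proof (rule image_subsetI)
        fix W assume W: "W \<in> {W. W \<subseteq> S - {s0} \<and> card W = n - 1}"
        then have "finite W" "s0 \<notin> W" using assms(1) finite_subset[of W S] by auto
        then show "insert s0 W \<in> {U \<in> ?I. card U = n}" using W n assms by auto
      qed
      show "(\<lambda>U. U - {s0}) ` {U \<in> ?I. card U = n} \<subseteq> {W. W \<subseteq> S - {s0} \<and> card W = n - 1}"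
        using assms(1) finite_subset[of _ S] by auto
    qed auto
    then have "card {U \<in> ?I. card U = n} = (card S - 1) choose (n - 1)"
      using n_subsets[of "S - {s0}" "n - 1"] assms by (simp add: bij_betw_same_card[symmetric])
    then show "(\<Sum>U\<in>{U \<in> ?I. card U = n}. g (card U)) = of_nat ((card S - 1) choose (n - 1)) * g n"
      by simp
  qed
  finally show ?thesis .
qed

lemma bij_if_funpow_id:
  assumes "f ^^ n = id" "n > 0"
  shows "bij f"
proof -
  obtain k where k: "n = Suc k" using assms(2) by (cases n) auto
  show ?thesis
  proof (rule o_bij)
    show "(f ^^ k) \<circ> f = id" using assms(1) unfolding k funpow_Suc_right .
    show "f \<circ> (f ^^ k) = id" using assms(1) unfolding k by simp
  qed
qed

subsection \<open>Actions of the amalgam\<close>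

text \<open>Words act from the right, so that the action on points matches the action on right cosets.\<close>

definition act_letter :: "('s \<Rightarrow> 's) \<Rightarrow> ('s \<Rightarrow> 's) \<Rightarrow> gen \<times> bool \<Rightarrow> 's \<Rightarrow> 's" where
  "act_letter x y p = (let f = (case fst p of GenX \<Rightarrow> x | GenY \<Rightarrow> y) in if snd p then f else inv_into UNIV f)"

definition act_word :: "('s \<Rightarrow> 's) \<Rightarrow> ('s \<Rightarrow> 's) \<Rightarrow> gen word \<Rightarrow> 's \<Rightarrow> 's" where
  "act_word x y w = fold (act_letter x y) w"

definition act :: "('s \<Rightarrow> 's) \<Rightarrow> ('s \<Rightarrow> 's) \<Rightarrow> gen word set \<Rightarrow> 's \<Rightarrow> 's" where
  "act x y g = act_word x y (SOME w. w \<in> g)"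

locale amalgam =
  fixes m q :: nat
  assumes m_pos: "m > 0" and q_pos: "q > 0"
begin

abbreviation rels :: "(gen word \<times> gen word) set" where
  "rels \<equiv> {(gen_pow GenX (2 * m), []), (gen_pow GenY (q * m), []), (gen_pow GenX 2, gen_pow GenY q)}"

abbreviation cls :: "gen word \<Rightarrow> gen word set" where
  "cls \<equiv> pcls UNIV rels"

definition G :: "gen word set monoid" where
  "G = presented_group UNIV rels"

lemma G_eq: "G = Gamma m q"
  by (simp add: G_def Gamma_def)

sublocale group G
  unfolding G_def by (rule group_presented_group)

definition X :: "gen word set" where "X = cls [(GenX, True)]"
definition Y :: "gen word set" where "Y = cls [(GenY, True)]"

lemma words_UNIV [simp]: "w \<in> words UNIV"
  by (simp add: words_def)

lemma cls_closed [simp]: "cls w \<in> carrier G"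
  unfolding G_def carrier_presented_group by simp

lemma carrier_G: "carrier G = range cls"
  unfolding G_def carrier_presented_group by (auto simp: image_iff)

lemma cls_append: "cls (u @ v) = cls u \<otimes>\<^bsub>G\<^esub> cls v"
  unfolding G_def by (simp add: presented_group_mult)

lemma cls_Nil: "cls [] = \<one>\<^bsub>G\<^esub>"
  unfolding G_def by (simp add: one_presented_group)

lemma X_closed [simp]: "X \<in> carrier G" and Y_closed [simp]: "Y \<in> carrier G"
  by (simp_all add: X_def Y_def)

lemma cls_gen_pow: "cls (gen_pow a n) = cls [(a, True)] [^]\<^bsub>G\<^esub> n"
proof -
  have "concat (replicate n [(a, True)]) = gen_pow a n" for a :: gen
    by (induction n) (auto simp: gen_pow_def)
  then show ?thesis using pcls_pow[of "[(a, True)]" UNIV rels n] by (simp add: G_def)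
qed

lemma cls_relation: "(l, r) \<in> rels \<Longrightarrow> cls l = cls r"
  using pres_rel_rel[of l r rels UNIV "[]" "[]"] by (subst pcls_eq_iff) simp_all

lemma X_pow: "X [^]\<^bsub>G\<^esub> (2 * m) = \<one>\<^bsub>G\<^esub>"
  using cls_relation[of "gen_pow GenX (2 * m)" "[]"] by (simp add: cls_gen_pow cls_Nil X_def)

lemma Y_pow: "Y [^]\<^bsub>G\<^esub> (q * m) = \<one>\<^bsub>G\<^esub>"
  using cls_relation[of "gen_pow GenY (q * m)" "[]"] by (simp add: cls_gen_pow cls_Nil Y_def)

lemma X_Y_pow: "X [^]\<^bsub>G\<^esub> (2::nat) = Y [^]\<^bsub>G\<^esub> q"
  using cls_relation[of "gen_pow GenX 2" "gen_pow GenY q"] by (simp add: cls_gen_pow X_def Y_def)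

lemma inv_eq_pow:
  assumes "g \<in> carrier G" "g [^]\<^bsub>G\<^esub> (n::nat) = \<one>\<^bsub>G\<^esub>" "n > 0"
  shows "inv\<^bsub>G\<^esub> g = g [^]\<^bsub>G\<^esub> (n - 1)"
proof -
  obtain k where "n = Suc k" using assms(3) by (cases n) auto
  then show ?thesis using assms by (intro inv_equality) auto
qed

lemma cls_inverse_letter: "cls [(a, False)] = inv\<^bsub>G\<^esub> (cls [(a, True)])"
proof -
  have "cls [(a, False), (a, True)] = cls []"
    using pres_rel_cancel[of a UNIV "[]" "[]" False rels] by (subst pcls_eq_iff) simp_all
  then have "cls [(a, False)] \<otimes>\<^bsub>G\<^esub> cls [(a, True)] = \<one>\<^bsub>G\<^esub>"
    by (simp add: cls_Nil flip: cls_append)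
  then show ?thesis by (intro inv_equality[symmetric]) simp_all
qed

text \<open>The generators have finite order, so their inverses need no separate cases.\<close>

lemma G_induct [consumes 1, case_names one mult_X mult_Y]:
  assumes "g \<in> carrier G" and P1: "P \<one>\<^bsub>G\<^esub>"
    and PX: "\<And>g. g \<in> carrier G \<Longrightarrow> P g \<Longrightarrow> P (g \<otimes>\<^bsub>G\<^esub> X)"
    and PY: "\<And>g. g \<in> carrier G \<Longrightarrow> P g \<Longrightarrow> P (g \<otimes>\<^bsub>G\<^esub> Y)"
  shows "P g"
proof -
  have pow: "P (g \<otimes>\<^bsub>G\<^esub> z [^]\<^bsub>G\<^esub> (k::nat))"
    if "g \<in> carrier G" "P g" "z \<in> carrier G" "\<And>g. g \<in> carrier G \<Longrightarrow> P g \<Longrightarrow> P (g \<otimes>\<^bsub>G\<^esub> z)" for g z k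
    using that by (induction k) (auto simp flip: m_assoc)
  have letter: "P (g \<otimes>\<^bsub>G\<^esub> cls [p])" if g: "g \<in> carrier G" "P g" for g p
  proof -
    obtain a b where p: "p = (a, b)" by (cases p)
    show ?thesis
    proof (cases a)
      case GenX
      have "cls [p] = (if b then X else X [^]\<^bsub>G\<^esub> (2 * m - 1))"
        using inv_eq_pow[OF X_closed X_pow] m_pos cls_inverse_letter[of GenX] by (simp add: p GenX X_def)
      then show ?thesis using PX[OF g] pow[OF g X_closed PX] by simp
    next
      case GenY
      have "cls [p] = (if b then Y else Y [^]\<^bsub>G\<^esub> (q * m - 1))"
        using inv_eq_pow[OF Y_closed Y_pow] m_pos q_pos cls_inverse_letter[of GenY] by (simp add: p GenY Y_def)
      then show ?thesis using PY[OF g] pow[OF g Y_closed PY] by simp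
    qed
  qed
  have "P (cls w)" for w
  proof (induction w rule: rev_induct)
    case Nil
    then show ?case using P1 by (simp add: cls_Nil)
  next
    case (snoc p w)
    then show ?case using letter by (simp add: cls_append)
  qed
  then show ?thesis using assms(1) unfolding carrier_G by blast
qed

text \<open>Asks for the defining relations only, and on the whole type. This also covers the skew
  product below, which may move infinitely many points and fixes everything outside its
  carrier.\<close>

definition acts :: "('s \<Rightarrow> 's) \<Rightarrow> ('s \<Rightarrow> 's) \<Rightarrow> bool" where
  "acts x y \<longleftrightarrow> x ^^ (2 * m) = id \<and> y ^^ (q * m) = id \<and> x ^^ 2 = y ^^ q"

lemma pairs_acts: "(x, y) \<in> pairs m q S \<Longrightarrow> acts x y"
  unfolding pairs_def acts_def
  using semireg_funpow_id[of "2 * m" S x 1] semireg_funpow_id[of "q * m" S y 1] by simp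

lemma act_word_gen_pow:
  "act_word x y (gen_pow GenX n) = x ^^ n" "act_word x y (gen_pow GenY n) = y ^^ n"
  unfolding act_word_def gen_pow_def
  by (induction n) (auto simp: act_letter_def fun_eq_iff funpow_swap1)

lemma act_word_invariant:
  assumes "acts x y" "(u, v) \<in> pres_rel UNIV rels"
  shows "act_word x y u = act_word x y v"
  using assms(2)
proof (induction rule: pres_rel.induct)
  case (pres_rel_cancel a u v b)
  have "bij x" "bij y"
    using assms(1) m_pos q_pos
    by (auto simp: acts_def intro: bij_if_funpow_id[of "2 * m" x] bij_if_funpow_id[of "q * m" y])
  then have "act_letter x y (a, \<not> b) (act_letter x y (a, b) s) = s" for s
    by (cases a) (auto simp: act_letter_def bij_is_surj bij_is_inj surj_f_inv_f)
  then show ?case by (simp add: act_word_def fun_eq_iff)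
next
  case (pres_rel_rel l r u v)
  then have "act_word x y l = act_word x y r"
    using assms(1) act_word_gen_pow[of x y] by (auto simp: acts_def) (simp_all add: act_word_def id_def)
  then show ?case by (simp add: act_word_def)
qed auto

lemma act_cls:
  assumes "acts x y"
  shows "act x y (cls w) = act_word x y w"
proof -
  have "w \<in> cls w" by (simp add: pres_rel_refl)
  then have "(SOME u. u \<in> cls w) \<in> cls w" by (rule someI)
  then show ?thesis unfolding act_def using act_word_invariant[OF assms] by auto
qed

lemma act_one: "acts x y \<Longrightarrow> act x y \<one>\<^bsub>G\<^esub> s = s"
  using act_cls[of x y "[]"] by (simp add: cls_Nil act_word_def)

lemma act_mult:
  assumes "acts x y" "g \<in> carrier G" "h \<in> carrier G"
  shows "act x y (g \<otimes>\<^bsub>G\<^esub> h) s = act x y h (act x y g s)"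
proof -
  obtain u v where "g = cls u" "h = cls v" using assms(2,3) unfolding carrier_G by blast
  then show ?thesis using assms(1) by (simp add: act_cls act_word_def flip: cls_append)
qed

lemma act_X: "acts x y \<Longrightarrow> act x y X s = x s"
  unfolding X_def act_cls by (simp add: act_word_def act_letter_def)

lemma act_Y: "acts x y \<Longrightarrow> act x y Y s = y s"
  unfolding Y_def act_cls by (simp add: act_word_def act_letter_def)

lemma act_inv:
  assumes "acts x y" "g \<in> carrier G"
  shows "act x y (inv\<^bsub>G\<^esub> g) (act x y g s) = s" "act x y g (act x y (inv\<^bsub>G\<^esub> g) s) = s"
  using assms act_mult[of x y g "inv\<^bsub>G\<^esub> g" s] act_mult[of x y "inv\<^bsub>G\<^esub> g" g s]
  by (simp_all add: act_one)

lemma act_pow_X: "acts x y \<Longrightarrow> act x y (X [^]\<^bsub>G\<^esub> (i::nat)) s = (x ^^ i) s"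
  by (induction i) (auto simp: act_one act_mult act_X)

lemma act_pow_Y: "acts x y \<Longrightarrow> act x y (Y [^]\<^bsub>G\<^esub> (i::nat)) s = (y ^^ i) s"
  by (induction i) (auto simp: act_one act_mult act_Y)

lemma reach_eq:
  assumes "acts x y"
  shows "reach x y s0 = (\<lambda>g. act x y g s0) ` carrier G"
proof (intro equalityI subsetI)
  fix s assume "s \<in> reach x y s0"
  then show "s \<in> (\<lambda>g. act x y g s0) ` carrier G"
  proof induction
    case reach_base
    then show ?case using act_one[OF assms, of s0] by (metis image_eqI one_closed)
  next
    case (reach_x s)
    then obtain g where "g \<in> carrier G" "s = act x y g s0" by blast
    then have "x s = act x y (g \<otimes>\<^bsub>G\<^esub> X) s0" "g \<otimes>\<^bsub>G\<^esub> X \<in> carrier G"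
      using assms by (simp_all add: act_mult act_X)
    then show ?case by blast
  next
    case (reach_y s)
    then obtain g where "g \<in> carrier G" "s = act x y g s0" by blast
    then have "y s = act x y (g \<otimes>\<^bsub>G\<^esub> Y) s0" "g \<otimes>\<^bsub>G\<^esub> Y \<in> carrier G"
      using assms by (simp_all add: act_mult act_Y)
    then show ?case by blast
  qed
next
  fix s assume "s \<in> (\<lambda>g. act x y g s0) ` carrier G"
  then obtain g where g: "g \<in> carrier G" "s = act x y g s0" by blast
  have "act x y g s0 \<in> reach x y s0"
    using g(1) by (induction rule: G_induct) (auto simp: assms act_one act_mult act_X act_Y intro: reach.intros)
  then show "s \<in> reach x y s0" using g(2) by simp
qed

definition stab :: "('s \<Rightarrow> 's) \<Rightarrow> ('s \<Rightarrow> 's) \<Rightarrow> 's \<Rightarrow> gen word set set" where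
  "stab x y s0 = {g \<in> carrier G. act x y g s0 = s0}"

lemma stab_subgroup:
  assumes "acts x y"
  shows "subgroup (stab x y s0) G"
proof (rule subgroupI)
  show "stab x y s0 \<noteq> {}" using assms act_one by (auto simp: stab_def intro!: exI[of _ "\<one>\<^bsub>G\<^esub>"])
  show "inv\<^bsub>G\<^esub> g \<in> stab x y s0" if "g \<in> stab x y s0" for g
    using that act_inv(1)[OF assms, of g s0] by (simp add: stab_def)
qed (auto simp: stab_def act_mult assms)

text \<open>A power of a generator is shown to be nontrivial by an action in which it moves a point.
  The formula of \<open>card_pairs\<close> with l = 1 has a positive right-hand side, so there is an
  action on 2qm points with full cycles.\<close>

lemma X_order: "X [^]\<^bsub>G\<^esub> (i::nat) = \<one>\<^bsub>G\<^esub> \<Longrightarrow> 2 * m dvd i"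
  and Y_order: "Y [^]\<^bsub>G\<^esub> (i::nat) = \<one>\<^bsub>G\<^esub> \<Longrightarrow> q * m dvd i"
proof -
  let ?S = "{..<2 * q * m}"
  have "pairs m q ?S \<noteq> {}"
  proof
    assume "pairs m q ?S = {}"
    then show False
      using card_pairs[of m q ?S 1] m_pos q_pos by simp
  qed
  then obtain x y where xy: "(x, y) \<in> pairs m q ?S" by auto
  have "acts x y" using xy by (rule pairs_acts)
  have s: "0 \<in> ?S" using m_pos q_pos by simp
  show "2 * m dvd i" if "X [^]\<^bsub>G\<^esub> i = \<one>\<^bsub>G\<^esub>"
  proof -
    have "(x ^^ i) 0 = 0" using act_pow_X[OF \<open>acts x y\<close>, of i 0] act_one[OF \<open>acts x y\<close>] that by simp
    then show ?thesis using xy s by (simp add: pairs_def semireg_def)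
  qed
  show "q * m dvd i" if "Y [^]\<^bsub>G\<^esub> i = \<one>\<^bsub>G\<^esub>"
  proof -
    have "(y ^^ i) 0 = 0" using act_pow_Y[OF \<open>acts x y\<close>, of i 0] act_one[OF \<open>acts x y\<close>] that by simp
    then show ?thesis using xy s by (simp add: pairs_def semireg_def)
  qed
qed

end

section \<open>Freeness of stabilizers: potentials and the skew product\<close>

context amalgam
begin

text \<open>The value \<open>a\<close> at \<open>s\<close> is carried along the cycle by powers of
  \<open>g\<close>; going round once multiplies by g^d = 1, so the values are consistent.\<close>

lemma equivariant_extension:
  assumes "semireg d S f" "d > 0" "s \<in> S" "a \<in> carrier G" "g \<in> carrier G" "g [^]\<^bsub>G\<^esub> d = \<one>\<^bsub>G\<^esub>"
  shows "\<exists>p. p s = a \<and> (\<forall>t\<in>cyc f s. p t \<in> carrier G \<and> p (f t) = p t \<otimes>\<^bsub>G\<^esub> g)"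
proof -
  define p where "p t = a \<otimes>\<^bsub>G\<^esub> g [^]\<^bsub>G\<^esub> (SOME i. (f ^^ i) s = t)" for t
  have pow: "g [^]\<^bsub>G\<^esub> i = g [^]\<^bsub>G\<^esub> (i mod d)" for i
  proof -
    have "g [^]\<^bsub>G\<^esub> i = (g [^]\<^bsub>G\<^esub> d) [^]\<^bsub>G\<^esub> (i div d) \<otimes>\<^bsub>G\<^esub> g [^]\<^bsub>G\<^esub> (i mod d)"
      using assms(5) by (simp add: nat_pow_pow nat_pow_mult)
    then show ?thesis using assms(5,6) by simp
  qed
  have p: "p ((f ^^ i) s) = a \<otimes>\<^bsub>G\<^esub> g [^]\<^bsub>G\<^esub> i" for i
  proof -
    define j where "j = (SOME j. (f ^^ j) s = (f ^^ i) s)"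
    have "(f ^^ j) s = (f ^^ i) s" unfolding j_def by (rule someI[of _ i]) simp
    then have "j mod d = i mod d" using semireg_funpow_eq_iff[OF assms(1,3)] by (simp add: cong_def)
    then show ?thesis unfolding p_def j_def[symmetric] by (metis pow)
  qed
  have "p t \<in> carrier G \<and> p (f t) = p t \<otimes>\<^bsub>G\<^esub> g" if t: "t \<in> cyc f s" for t
  proof -
    obtain i where i: "t = (f ^^ i) s" using t by (auto simp: cyc_def)
    have "p (f t) = a \<otimes>\<^bsub>G\<^esub> g [^]\<^bsub>G\<^esub> (Suc i)" using p[of "Suc i"] i by simp
    then show ?thesis using p[of i] assms i by (simp add: m_assoc)
  qed
  moreover have "p s = a" using p[of 0] assms by simp
  ultimately show ?thesis by blast
qed

text \<open>\<open>link x y s0 T b s\<close>: the point \<open>s\<close> is joined to \<open>s0\<close> by a path that ends with an \<open>x\<close>-cycle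
  (for \<open>b\<close>) or a \<open>y\<close>-cycle, and changes between the two kinds only at points of \<open>T\<close>.\<close>

inductive link :: "('s \<Rightarrow> 's) \<Rightarrow> ('s \<Rightarrow> 's) \<Rightarrow> 's \<Rightarrow> 's set \<Rightarrow> bool \<Rightarrow> 's \<Rightarrow> bool"
  for x y :: "'s \<Rightarrow> 's" and s0 :: 's and T :: "'s set" where
  link_base: "link x y s0 T True s0"
| link_x: "link x y s0 T True s \<Longrightarrow> link x y s0 T True (x s)"
| link_y: "link x y s0 T False s \<Longrightarrow> link x y s0 T False (y s)"
| link_switch: "link x y s0 T b s \<Longrightarrow> s \<in> T \<Longrightarrow> link x y s0 T (\<not> b) s"

lemma link_mono: "link x y s0 T b s \<Longrightarrow> T \<subseteq> T' \<Longrightarrow> link x y s0 T' b s"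
  by (induction rule: link.induct) (auto intro: link.intros)

lemma link_funpow:
  "link x y s0 T True s \<Longrightarrow> link x y s0 T True ((x ^^ i) s)"
  "link x y s0 T False s \<Longrightarrow> link x y s0 T False ((y ^^ i) s)"
  by (induction i) (auto intro: link.intros)

text \<open>The potentials \<open>p s\<close> and \<open>r s\<close> carry \<open>s0\<close> to \<open>s\<close> and are equivariant along \<open>x\<close>-cycles and
  \<open>y\<close>-cycles, respectively. Where they differ, \<open>p s\<close> and \<open>r s\<close> give an element of the stabilizer; the
  points of \<open>T\<close>, at which they agree, play the role of a spanning tree.\<close>

definition partial_potentials where
  "partial_potentials x y S s0 P Q T p r \<longleftrightarrow>
     s0 \<in> P \<and> P \<subseteq> S \<and> Q \<subseteq> S \<and> x ` P \<subseteq> P \<and> y ` Q \<subseteq> Q \<and> p s0 = \<one>\<^bsub>G\<^esub> \<and>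
     (\<forall>s\<in>P. p s \<in> carrier G \<and> p (x s) = p s \<otimes>\<^bsub>G\<^esub> X \<and> link x y s0 T True s) \<and>
     (\<forall>s\<in>Q. r s \<in> carrier G \<and> r (y s) = r s \<otimes>\<^bsub>G\<^esub> Y \<and> link x y s0 T False s) \<and>
     T \<subseteq> P \<inter> Q \<and> (\<forall>s\<in>T. p s = r s)"

text \<open>One step in growing a spanning tree: the new vertex is the y-cycle of \<open>s\<close>,
  the new edge is recorded by putting \<open>s\<close> into \<open>T\<close>, and requiring
  agreement of the potentials at \<open>s\<close> determines the potential on the whole
  cycle.\<close>

lemma partial_potentials_extend_y:
  assumes xy: "(x, y) \<in> pairs m q S"
    and pp: "partial_potentials x y S s0 P Q T p r" and s: "s \<in> P" "s \<notin> Q"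
  shows "\<exists>Q' T' r'. partial_potentials x y S s0 P Q' T' p r' \<and> Q \<subset> Q'"
proof -
  have sr: "semireg (q * m) S y" using xy by (simp add: pairs_def)
  have sS: "s \<in> S" and ps: "p s \<in> carrier G" using pp s by (auto simp: partial_potentials_def)
  obtain e where e: "e s = p s" "\<And>t. t \<in> cyc y s \<Longrightarrow> e t \<in> carrier G \<and> e (y t) = e t \<otimes>\<^bsub>G\<^esub> Y"
    using equivariant_extension[OF sr _ sS ps Y_closed Y_pow] m_pos q_pos by auto
  let ?Q' = "Q \<union> cyc y s" and ?T' = "insert s T"
  define r' where "r' t = (if t \<in> Q then r t else e t)" for t
  have QS: "Q \<subseteq> S" "y ` Q \<subseteq> Q" using pp by (auto simp: partial_potentials_def)
  have cyc_y: "y t \<in> cyc y s" if "t \<in> cyc y s" for t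
  proof -
    obtain i where "t = (y ^^ i) s" using \<open>t \<in> cyc y s\<close> by (auto simp: cyc_def)
    then have "y t = (y ^^ Suc i) s" by simp
    then show ?thesis unfolding cyc_def by blast
  qed
  have "cyc y s \<subseteq> S" by (rule cyc_subset[OF semireg_permutes[OF sr] sS])
  \<comment> \<open>Q is closed under y, so a y-cycle containing a point outside Q avoids Q
    altogether.\<close>
  have disj: "t \<notin> Q" if "t \<in> cyc y s" for t
  proof
    assume "t \<in> Q"
    have "s \<in> cyc y t" using cyc_eqI[OF sr _ that sS] in_cyc m_pos q_pos by force
    then obtain i where "s = (y ^^ i) t" by (auto simp: cyc_def)
    moreover have "(y ^^ i) t \<in> Q" by (rule funpow_in_set) (use QS \<open>t \<in> Q\<close> in auto)
    ultimately show False using s(2) by simp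
  qed
  have mono: "link x y s0 ?T' b t" if "link x y s0 T b t" for b t
    using link_mono[OF that, of ?T'] by blast
  have "link x y s0 ?T' True s" using pp s(1) mono by (auto simp: partial_potentials_def)
  then have "link x y s0 ?T' False s" using link_switch[of x y s0 ?T' True s] by simp
  then have link_cyc: "link x y s0 ?T' False t" if "t \<in> cyc y s" for t
    using that link_funpow(2) by (auto simp: cyc_def)
  have rQ': "r' t \<in> carrier G \<and> r' (y t) = r' t \<otimes>\<^bsub>G\<^esub> Y \<and> link x y s0 ?T' False t" if "t \<in> ?Q'" for t
  proof (cases "t \<in> Q")
    case True
    then have "y t \<in> Q" using QS by blast
    then show ?thesis using True pp mono by (auto simp: r'_def partial_potentials_def)
  next
    case False
    then have "t \<in> cyc y s" using that by blast
    then show ?thesis using False e(2) disj cyc_y link_cyc by (auto simp: r'_def)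
  qed
  have rT': "p t = r' t" if "t \<in> ?T'" for t
    using that pp s e(1) by (auto simp: r'_def partial_potentials_def)
  have rP: "p t \<in> carrier G \<and> p (x t) = p t \<otimes>\<^bsub>G\<^esub> X \<and> link x y s0 ?T' True t" if "t \<in> P" for t
    using that pp mono by (auto simp: partial_potentials_def)
  have "y ` ?Q' \<subseteq> ?Q'" using QS cyc_y by auto
  moreover have "?T' \<subseteq> P \<inter> ?Q'" using pp s in_cyc[of s y] by (auto simp: partial_potentials_def)
  ultimately have "partial_potentials x y S s0 P ?Q' ?T' p r'"
    using pp rQ' rT' rP \<open>cyc y s \<subseteq> S\<close> unfolding partial_potentials_def by (intro conjI) auto
  moreover have "Q \<subset> ?Q'" using s(2) in_cyc[of s y] by blast
  ultimately show ?thesis by blast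
qed

text \<open>The same step with the roles of the two kinds of cycles exchanged. The normalization at
  \<open>s0\<close> survives because \<open>s0\<close> lies in the old \<open>P\<close>, where the
  potential is kept.\<close>

lemma partial_potentials_extend_x:
  assumes xy: "(x, y) \<in> pairs m q S"
    and pp: "partial_potentials x y S s0 P Q T p r" and s: "s \<in> Q" "s \<notin> P"
  shows "\<exists>P' T' p'. partial_potentials x y S s0 P' Q T' p' r \<and> P \<subset> P'"
proof -
  have sr: "semireg (2 * m) S x" using xy by (simp add: pairs_def)
  have sS: "s \<in> S" and ps: "r s \<in> carrier G" using pp s by (auto simp: partial_potentials_def)
  obtain e where e: "e s = r s" "\<And>t. t \<in> cyc x s \<Longrightarrow> e t \<in> carrier G \<and> e (x t) = e t \<otimes>\<^bsub>G\<^esub> X"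
    using equivariant_extension[OF sr _ sS ps X_closed X_pow] m_pos by auto
  let ?P' = "P \<union> cyc x s" and ?T' = "insert s T"
  define p' where "p' t = (if t \<in> P then p t else e t)" for t
  have PS: "P \<subseteq> S" "x ` P \<subseteq> P" "s0 \<in> P" using pp by (auto simp: partial_potentials_def)
  have cyc_x: "x t \<in> cyc x s" if "t \<in> cyc x s" for t
  proof -
    obtain i where "t = (x ^^ i) s" using \<open>t \<in> cyc x s\<close> by (auto simp: cyc_def)
    then have "x t = (x ^^ Suc i) s" by simp
    then show ?thesis unfolding cyc_def by blast
  qed
  have "cyc x s \<subseteq> S" by (rule cyc_subset[OF semireg_permutes[OF sr] sS])
  have disj: "t \<notin> P" if "t \<in> cyc x s" for t
  proof
    assume "t \<in> P"
    have "s \<in> cyc x t" using cyc_eqI[OF sr _ that sS] in_cyc m_pos by force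
    then obtain i where "s = (x ^^ i) t" by (auto simp: cyc_def)
    moreover have "(x ^^ i) t \<in> P" by (rule funpow_in_set) (use PS \<open>t \<in> P\<close> in auto)
    ultimately show False using s(2) by simp
  qed
  have mono: "link x y s0 ?T' b t" if "link x y s0 T b t" for b t
    using link_mono[OF that, of ?T'] by blast
  have "link x y s0 ?T' False s" using pp s(1) mono by (auto simp: partial_potentials_def)
  then have "link x y s0 ?T' True s" using link_switch[of x y s0 ?T' False s] by simp
  then have link_cyc: "link x y s0 ?T' True t" if "t \<in> cyc x s" for t
    using that link_funpow(1) by (auto simp: cyc_def)
  have rP': "p' t \<in> carrier G \<and> p' (x t) = p' t \<otimes>\<^bsub>G\<^esub> X \<and> link x y s0 ?T' True t" if "t \<in> ?P'" for t
  proof (cases "t \<in> P")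
    case True
    then have "x t \<in> P" using PS by blast
    then show ?thesis using True pp mono by (auto simp: p'_def partial_potentials_def)
  next
    case False
    then have "t \<in> cyc x s" using that by blast
    then show ?thesis using False e(2) disj cyc_x link_cyc by (auto simp: p'_def)
  qed
  have rT': "p' t = r t" if "t \<in> ?T'" for t
    using that pp s e(1) by (auto simp: p'_def partial_potentials_def)
  have rQ: "r t \<in> carrier G \<and> r (y t) = r t \<otimes>\<^bsub>G\<^esub> Y \<and> link x y s0 ?T' False t" if "t \<in> Q" for t
    using that pp mono by (auto simp: partial_potentials_def)
  have "x ` ?P' \<subseteq> ?P'" using PS cyc_x by auto
  moreover have "?T' \<subseteq> ?P' \<inter> Q" using pp s in_cyc[of s x] by (auto simp: partial_potentials_def)
  moreover have "p' s0 = \<one>\<^bsub>G\<^esub>" using pp by (simp add: p'_def partial_potentials_def)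
  ultimately have "partial_potentials x y S s0 ?P' Q ?T' p' r"
    using pp rP' rT' rQ \<open>cyc x s \<subseteq> S\<close> unfolding partial_potentials_def by (intro conjI) auto
  moreover have "P \<subset> ?P'" using s(2) in_cyc[of s x] by blast
  ultimately show ?thesis by blast
qed

text \<open>If neither extension applies, then P = Q is closed under both x and y, and by
  transitivity it is all of S.\<close>

lemma partial_potentials_complete:
  assumes xy: "(x, y) \<in> trans_pairs m q S s0" and fin: "finite S"
    and "partial_potentials x y S s0 P Q T p r"
  shows "\<exists>T p r. partial_potentials x y S s0 S S T p r"
  using assms(3)
proof (induction "card (S - P) + card (S - Q)" arbitrary: P Q T p r rule: less_induct)
  case less
  have pairs: "(x, y) \<in> pairs m q S" and reach: "S \<subseteq> reach x y s0"
    using xy by (auto simp: trans_pairs_def)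
  have PQ: "P \<subseteq> S" "Q \<subseteq> S" "s0 \<in> P" "x ` P \<subseteq> P" "y ` Q \<subseteq> Q"
    using less.prems by (auto simp: partial_potentials_def)
  have smaller: "card (S - B) < card (S - A)" if "A \<subset> B" "B \<subseteq> S" for A B
    using that fin by (intro psubset_card_mono) auto
  consider s where "s \<in> P" "s \<notin> Q" | s where "s \<in> Q" "s \<notin> P" | "P = Q" by blast
  then show ?case
  proof cases
    case 1
    then obtain Q' T' r' where *: "partial_potentials x y S s0 P Q' T' p r'" "Q \<subset> Q'"
      using partial_potentials_extend_y[OF pairs less.prems 1] by (elim exE conjE) (rule that)
    then have "Q' \<subseteq> S" by (simp add: partial_potentials_def)
    then show ?thesis using smaller[OF *(2)] by (intro less.hyps[OF _ *(1)]) simp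
  next
    case 2
    then obtain P' T' p' where *: "partial_potentials x y S s0 P' Q T' p' r" "P \<subset> P'"
      using partial_potentials_extend_x[OF pairs less.prems 2] by (elim exE conjE) (rule that)
    then have "P' \<subseteq> S" by (simp add: partial_potentials_def)
    then show ?thesis using smaller[OF *(2)] by (intro less.hyps[OF _ *(1)]) simp
  next
    case 3
    then have "reach x y s0 \<subseteq> P" using PQ by (intro reach_subset) auto
    then have "P = S" using reach PQ by blast
    then show ?thesis using less.prems 3 by blast
  qed
qed

lemma potentials_exist:
  assumes xy: "(x, y) \<in> trans_pairs m q S s0" and fin: "finite S" and s0: "s0 \<in> S"
  shows "\<exists>T p r. partial_potentials x y S s0 S S T p r"
proof -
  have sr: "semireg (2 * m) S x" using xy by (simp add: pairs_def trans_pairs_def)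
  obtain p where p: "p s0 = \<one>\<^bsub>G\<^esub>" "\<And>t. t \<in> cyc x s0 \<Longrightarrow> p t \<in> carrier G \<and> p (x t) = p t \<otimes>\<^bsub>G\<^esub> X"
    using equivariant_extension[OF sr _ s0 one_closed X_closed X_pow] m_pos by auto
  have "x t \<in> cyc x s0" if "t \<in> cyc x s0" for t
  proof -
    obtain i where "t = (x ^^ i) s0" using \<open>t \<in> cyc x s0\<close> by (auto simp: cyc_def)
    then have "x t = (x ^^ Suc i) s0" by simp
    then show ?thesis unfolding cyc_def by blast
  qed
  moreover have "link x y s0 {} True t" if "t \<in> cyc x s0" for t
    using that link_funpow(1)[OF link_base] by (auto simp: cyc_def)
  \<comment> \<open>The initial tree is a single vertex, the x-cycle of the base point. With Q empty
    the y-potential has an empty domain, and \<open>p\<close> fills its place.\<close>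
  ultimately have "partial_potentials x y S s0 (cyc x s0) {} {} p p"
    using p cyc_subset[OF semireg_permutes[OF sr] s0] in_cyc[of s0 x]
    by (auto simp: partial_potentials_def)
  then show ?thesis by (rule partial_potentials_complete[OF xy fin])
qed

text \<open>The skew product in coordinates that are constant along \<open>x\<close>-cycles; the factors \<open>E\<close> change to
  coordinates that are constant along \<open>y\<close>-cycles and back.\<close>

definition skew_x where
  "skew_x F S x = (\<lambda>(f, s). if f \<in> carrier F \<and> s \<in> S then (f, x s) else (f, s))"

definition skew_y where
  "skew_y F S E y = (\<lambda>(f, s). if f \<in> carrier F \<and> s \<in> S
     then (f \<otimes>\<^bsub>F\<^esub> E s \<otimes>\<^bsub>F\<^esub> inv\<^bsub>F\<^esub> (E (y s)), y s) else (f, s))"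

context
  fixes F :: "('f, 'c) monoid_scheme" and S :: "'s set" and E :: "'s \<Rightarrow> 'f" and x y :: "'s \<Rightarrow> 's"
  assumes F: "group F" and xy: "(x, y) \<in> pairs m q S"
    and E_in: "\<forall>s\<in>S. E s \<in> carrier F" and E_square: "\<forall>s\<in>S. E ((x ^^ 2) s) = E s"
begin

lemmas E_closed = E_in[rule_format] and E_inv = E_square[rule_format]

interpretation F: group F by (rule F)

abbreviation (input) "sx \<equiv> skew_x F S x"
abbreviation (input) "sy \<equiv> skew_y F S E y"

lemma skew_closed: "s \<in> S \<Longrightarrow> x s \<in> S" "s \<in> S \<Longrightarrow> y s \<in> S"
  using pairs_permutes[OF xy] by (simp_all add: permutes_in_image)

lemma skew_x_apply: "f \<in> carrier F \<Longrightarrow> s \<in> S \<Longrightarrow> sx (f, s) = (f, x s)"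
  by (simp add: skew_x_def)

lemma skew_y_apply: "f \<in> carrier F \<Longrightarrow> s \<in> S \<Longrightarrow>
    sy (f, s) = (f \<otimes>\<^bsub>F\<^esub> E s \<otimes>\<^bsub>F\<^esub> inv\<^bsub>F\<^esub> (E (y s)), y s)"
  by (simp add: skew_y_def)

lemma skew_x_funpow:
  assumes "f \<in> carrier F" "s \<in> S"
  shows "(sx ^^ i) (f, s) = (f, (x ^^ i) s)"
proof (induction i)
  case (Suc i)
  have "(x ^^ i) s \<in> S" using assms(2) pairs_permutes[OF xy] by (simp add: permutes_funpow_in)
  then show ?case using Suc assms by (simp add: skew_x_def)
qed simp

text \<open>The inner factors telescope, so only the two end points of the path along the y-cycle
  matter.\<close>

lemma skew_y_funpow:
  assumes "f \<in> carrier F" "s \<in> S"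
  shows "(sy ^^ i) (f, s) = (f \<otimes>\<^bsub>F\<^esub> E s \<otimes>\<^bsub>F\<^esub> inv\<^bsub>F\<^esub> (E ((y ^^ i) s)), (y ^^ i) s)"
proof (induction i)
  case 0
  then show ?case using assms E_closed by (simp add: F.m_assoc)
next
  case (Suc i)
  have "(y ^^ i) s \<in> S" "y ((y ^^ i) s) \<in> S"
    using assms(2) pairs_permutes[OF xy] by (simp_all add: permutes_funpow_in permutes_in_image)
  then show ?case using Suc assms E_closed
    by (simp add: skew_y_def F.m_assoc)
qed

lemma skew_funpow_outside:
  assumes "\<not> (f \<in> carrier F \<and> s \<in> S)"
  shows "(sx ^^ i) (f, s) = (f, s)" "(sy ^^ i) (f, s) = (f, s)"
  by (induction i) (use assms in \<open>auto simp: skew_x_def skew_y_def\<close>)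

text \<open>The relation x^2 = y^q survives because \<open>E\<close> takes the same value at s and
  at y^q s = x^2 s: the labels belong to the edges, which are the cycles of x^2.\<close>

lemma skew_acts: "acts sx sy"
proof -
  have a: "x ^^ (2 * m) = id" "y ^^ (q * m) = id" "x ^^ 2 = y ^^ q"
    using pairs_acts[OF xy] by (auto simp: acts_def)
  have "(sx ^^ (2 * m)) p = p \<and> (sy ^^ (q * m)) p = p \<and> (sx ^^ 2) p = (sy ^^ q) p" for p
  proof -
    obtain f s where p: "p = (f, s)" by (cases p)
    show ?thesis
    proof (cases "f \<in> carrier F \<and> s \<in> S")
      case True
      then have fs: "f \<in> carrier F" "s \<in> S" by auto
      have "E ((y ^^ q) s) = E s" using E_inv[OF fs(2)] unfolding a(3) .
      then show ?thesis
        unfolding p skew_x_funpow[OF fs] skew_y_funpow[OF fs] a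
        using fs E_closed by (simp add: F.m_assoc)
    next
      case False
      then show ?thesis unfolding p using skew_funpow_outside[OF False] by metis
    qed
  qed
  then show ?thesis unfolding acts_def by (auto simp: fun_eq_iff)
qed

text \<open>The action commutes with left multiplication by F on the first coordinate, so the
  displacement \<open>h\<close> does not depend on \<open>f\<close>. On the stabilizer this makes
  the displacement multiplicative.\<close>

lemma skew_act:
  assumes "g \<in> carrier G" "f \<in> carrier F" "s \<in> S"
  shows "\<exists>h. h \<in> carrier F \<and> act x y g s \<in> S \<and> act sx sy g (\<one>\<^bsub>F\<^esub>, s) = (h, act x y g s) \<and>
    act sx sy g (f, s) = (f \<otimes>\<^bsub>F\<^esub> h, act x y g s)"
  using assms(1)
proof (induction rule: G_induct)
  case one
  then show ?case using assms by (intro exI[of _ "\<one>\<^bsub>F\<^esub>"]) (simp add: act_one skew_acts pairs_acts[OF xy])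
next
  case (mult_X g)
  then obtain h where h: "h \<in> carrier F" "act x y g s \<in> S"
    "act sx sy g (\<one>\<^bsub>F\<^esub>, s) = (h, act x y g s)" "act sx sy g (f, s) = (f \<otimes>\<^bsub>F\<^esub> h, act x y g s)"
    by blast
  then show ?case
    using assms mult_X.hyps skew_closed
    by (intro exI[of _ h]) (simp add: act_mult act_X skew_acts pairs_acts[OF xy] skew_x_apply)
next
  case (mult_Y g)
  then obtain h where h: "h \<in> carrier F" "act x y g s \<in> S"
    "act sx sy g (\<one>\<^bsub>F\<^esub>, s) = (h, act x y g s)" "act sx sy g (f, s) = (f \<otimes>\<^bsub>F\<^esub> h, act x y g s)"
    by blast
  let ?t = "act x y g s"
  show ?case
    using assms mult_Y.hyps skew_closed h E_closed[of ?t] E_closed[of "y ?t"]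
    by (intro exI[of _ "h \<otimes>\<^bsub>F\<^esub> E ?t \<otimes>\<^bsub>F\<^esub> inv\<^bsub>F\<^esub> (E (y ?t))"])
      (simp add: act_mult act_Y skew_acts pairs_acts[OF xy] skew_y_apply F.m_assoc)
qed

end

text \<open>Two maps are played against each other: \<phi> reads off the free part from the skew
  action, and \<psi> evaluates the basis in G. By \<open>decomp\<close>, \<psi> is a left inverse of
  \<phi> on the stabilizer, which gives injectivity; \<phi> maps e s to E s, which gives
  surjectivity.\<close>

lemma stab_free:
  assumes xy: "(x, y) \<in> trans_pairs m q S s0" and fin: "finite S" and s0: "s0 \<in> S"
  shows "is_free (G\<lparr>carrier := stab x y s0\<rparr>)"
proof -
  obtain T p r where "partial_potentials x y S s0 S S T p r"
    using potentials_exist[OF assms] by blast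
  then have p: "\<And>s. s \<in> S \<Longrightarrow> p s \<in> carrier G" "\<And>s. s \<in> S \<Longrightarrow> p (x s) = p s \<otimes>\<^bsub>G\<^esub> X" "p s0 = \<one>\<^bsub>G\<^esub>"
    and r: "\<And>s. s \<in> S \<Longrightarrow> r s \<in> carrier G" "\<And>s. s \<in> S \<Longrightarrow> r (y s) = r s \<otimes>\<^bsub>G\<^esub> Y"
    and T: "T \<subseteq> S" "\<And>s. s \<in> T \<Longrightarrow> p s = r s"
    and links: "\<And>s. s \<in> S \<Longrightarrow> link x y s0 T True s" "\<And>s. s \<in> S \<Longrightarrow> link x y s0 T False s"
    by (auto simp: partial_potentials_def)
  have pairs: "(x, y) \<in> pairs m q S" using xy by (simp add: trans_pairs_def)
  note acts = pairs_acts[OF pairs] and perm = pairs_permutes[OF pairs]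
  \<comment> \<open>The loop that goes from the base point to s along the x-potential and returns
    along the y-potential; it is trivial for s in T.\<close>
  define e where "e s = p s \<otimes>\<^bsub>G\<^esub> inv\<^bsub>G\<^esub> (r s)" for s
  have e_closed: "e s \<in> carrier G" if "s \<in> S" for s using p r that by (simp add: e_def)
  \<comment> \<open>The basis consists of elements of G, not of edges: edges with equal loops share
    a generator and trivial loops get none, so nothing about independence has to be known in
    advance.\<close>
  define B where "B = e ` S - {\<one>\<^bsub>G\<^esub>}"
  define F where "F = free_group B"
  define E where "E s = (if e s = \<one>\<^bsub>G\<^esub> then \<one>\<^bsub>F\<^esub> else free_gen B (e s))" for s
  interpret F: group F unfolding F_def free_group_def by (rule group_presented_group)
  have E_closed: "E s \<in> carrier F" if "s \<in> S" for s
  proof (cases "e s = \<one>\<^bsub>G\<^esub>")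
    case False
    then have "e s \<in> B" using that unfolding B_def by blast
    then show ?thesis using False free_gen_closed[of "e s" B] by (simp add: E_def F_def)
  qed (simp add: E_def)
  have E_one: "E s = \<one>\<^bsub>F\<^esub>" if "s \<in> T" for s
    using that T p(1)[of s] by (simp add: E_def e_def subset_iff)
  \<comment> \<open>Along x^2 = y^q both potentials gain the same factor X^2 = Y^q, which cancels in
    e; so e depends only on the edge.\<close>
  have e_inv: "e ((x ^^ 2) s) = e s" if s: "s \<in> S" for s
  proof -
    have "r ((y ^^ i) s) = r s \<otimes>\<^bsub>G\<^esub> Y [^]\<^bsub>G\<^esub> i" for i
      by (induction i) (use r s perm in \<open>auto simp: permutes_funpow_in m_assoc\<close>)
    then have "r ((x ^^ 2) s) = r s \<otimes>\<^bsub>G\<^esub> X [^]\<^bsub>G\<^esub> (2::nat)"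
      using acts X_Y_pow by (simp add: acts_def)
    moreover have "p ((x ^^ 2) s) = p s \<otimes>\<^bsub>G\<^esub> X [^]\<^bsub>G\<^esub> (2::nat)"
      using p s perm by (simp add: numeral_2_eq_2 permutes_in_image m_assoc)
    ultimately show ?thesis
      using p r s by (simp add: e_def inv_mult_group m_assoc) (simp add: m_assoc[symmetric])
  qed
  then have E_inv: "E ((x ^^ 2) s) = E s" if "s \<in> S" for s
    using that by (simp only: E_def)
  have "\<forall>s\<in>S. E s \<in> carrier F" "\<forall>s\<in>S. E ((x ^^ 2) s) = E s"
    using E_closed E_inv by blast+
  note skew = F.group_axioms pairs this
  let ?sx = "skew_x F S x" and ?sy = "skew_y F S E y"
  note skew_inst = skew_acts[where F = F and S = S and E = E and x = x and y = y, OF skew]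
    skew_x_apply[where F = F and S = S and E = E and x = x and y = y, OF skew]
    skew_y_apply[where F = F and S = S and E = E and x = x and y = y, OF skew]
    skew_act[where F = F and S = S and E = E and x = x and y = y, OF skew]
  note sacts = skew_inst(1)
  define \<phi> where "\<phi> g = fst (act ?sx ?sy g (\<one>\<^bsub>F\<^esub>, s0))" for g
  have skew_at: "act ?sx ?sy g (f, s) = (f \<otimes>\<^bsub>F\<^esub> fst (act ?sx ?sy g (\<one>\<^bsub>F\<^esub>, s)), act x y g s)"
    "fst (act ?sx ?sy g (\<one>\<^bsub>F\<^esub>, s)) \<in> carrier F"
    if "g \<in> carrier G" "f \<in> carrier F" "s \<in> S" for g f s
    using skew_inst(4)[OF that] by auto
  have vB: "(\<lambda>b. b) \<in> B \<rightarrow> carrier G" using e_closed by (auto simp: B_def)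
  have "\<exists>\<psi>. \<psi> \<in> hom F G \<and> (\<forall>b\<in>B. \<psi> (free_gen B b) = b)"
    using free_group_extend[OF group_axioms vB] unfolding F_def Bex_def .
  then obtain \<psi> where "\<psi> \<in> hom F G \<and> (\<forall>b\<in>B. \<psi> (free_gen B b) = b)"
    by (elim exE) (rule that)
  then have psi: "\<psi> \<in> hom F G" "\<And>b. b \<in> B \<Longrightarrow> \<psi> (free_gen B b) = b" by blast+
  interpret psi: group_hom F G \<psi>
    using psi(1) by unfold_locales
  have psi_E: "\<psi> (E s) = e s" if "s \<in> S" for s
  proof (cases "e s = \<one>\<^bsub>G\<^esub>")
    case False
    then have "e s \<in> B" using that unfolding B_def by blast
    then show ?thesis using False psi(2) by (simp add: E_def)
  qed (simp add: E_def)
  \<comment> \<open>The skew action records \<open>g\<close> as its free part times the potential of the end point.\<close>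
  have decomp: "\<exists>f\<in>carrier F. \<exists>s\<in>S. act ?sx ?sy g (\<one>\<^bsub>F\<^esub>, s0) = (f, s) \<and> g = \<psi> f \<otimes>\<^bsub>G\<^esub> p s"
    if "g \<in> carrier G" for g
    using that
  proof (induction rule: G_induct)
    case one
    have "\<one>\<^bsub>G\<^esub> = \<psi> \<one>\<^bsub>F\<^esub> \<otimes>\<^bsub>G\<^esub> p s0" by (simp add: p(3))
    then show ?case using s0 act_one[OF sacts] F.one_closed by blast
  next
    case (mult_X g)
    then obtain f s where fs: "f \<in> carrier F" "s \<in> S"
      "act ?sx ?sy g (\<one>\<^bsub>F\<^esub>, s0) = (f, s)" "g = \<psi> f \<otimes>\<^bsub>G\<^esub> p s" by blast
    have "act ?sx ?sy (g \<otimes>\<^bsub>G\<^esub> X) (\<one>\<^bsub>F\<^esub>, s0) = (f, x s)"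
      using fs mult_X.hyps by (simp add: act_mult act_X sacts skew_inst(2))
    moreover have "g \<otimes>\<^bsub>G\<^esub> X = \<psi> f \<otimes>\<^bsub>G\<^esub> p (x s)"
      using fs(1,2) p unfolding fs(4) by (simp add: m_assoc)
    moreover have "x s \<in> S" using fs(2) perm by (simp add: permutes_in_image)
    ultimately show ?case using fs(1) by blast
  next
    case (mult_Y g)
    then obtain f s where fs: "f \<in> carrier F" "s \<in> S"
      "act ?sx ?sy g (\<one>\<^bsub>F\<^esub>, s0) = (f, s)" "g = \<psi> f \<otimes>\<^bsub>G\<^esub> p s" by blast
    let ?f = "f \<otimes>\<^bsub>F\<^esub> E s \<otimes>\<^bsub>F\<^esub> inv\<^bsub>F\<^esub> (E (y s))"
    have ys: "y s \<in> S" using fs(2) perm by (simp add: permutes_in_image)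
    have "act ?sx ?sy (g \<otimes>\<^bsub>G\<^esub> Y) (\<one>\<^bsub>F\<^esub>, s0) = (?f, y s)"
      using fs mult_Y.hyps by (simp add: act_mult act_Y sacts skew_inst(3))
    moreover have "g \<otimes>\<^bsub>G\<^esub> Y = \<psi> ?f \<otimes>\<^bsub>G\<^esub> p (y s)"
    proof -
      have "\<psi> ?f = \<psi> f \<otimes>\<^bsub>G\<^esub> e s \<otimes>\<^bsub>G\<^esub> inv\<^bsub>G\<^esub> (e (y s))"
        using fs(1,2) ys E_closed by (simp add: psi_E)
      also have "\<dots> \<otimes>\<^bsub>G\<^esub> p (y s) = \<psi> f \<otimes>\<^bsub>G\<^esub> (p s \<otimes>\<^bsub>G\<^esub> Y)"
        using fs(1,2) ys p(1)[OF fs(2)] p(1)[OF ys] r(1)[OF fs(2)]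
        by (simp add: e_def r(2) inv_mult_group m_assoc) (simp add: m_assoc[symmetric])
      finally show ?thesis using fs(1,2) p(1) unfolding fs(4) by (simp add: m_assoc)
    qed
    ultimately show ?case using fs(1) ys E_closed[OF fs(2)] E_closed[OF ys] by blast
  qed
  have snd_act: "act ?sx ?sy g (\<one>\<^bsub>F\<^esub>, s0) = (\<phi> g, act x y g s0)" "\<phi> g \<in> carrier F"
    if "g \<in> carrier G" for g
    using skew_at[OF that F.one_closed s0] by (simp_all add: \<phi>_def)
  \<comment> \<open>Travelling along the tree collects no free generators. The factor inv (E s) only
    expresses the second kind of coordinates in the first, and it is trivial where the path changes
    sides, at points of T.\<close>
  have link_act: "s \<in> S \<and> (if b then act ?sx ?sy (p s) (\<one>\<^bsub>F\<^esub>, s0) = (\<one>\<^bsub>F\<^esub>, s)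
      else act ?sx ?sy (r s) (\<one>\<^bsub>F\<^esub>, s0) = (inv\<^bsub>F\<^esub> (E s), s))" if "link x y s0 T b s" for b s
    using that
  proof induction
    case link_base
    then show ?case using s0 p(3) by (simp add: act_one sacts)
  next
    case (link_x s)
    then show ?case using p perm
      by (simp add: act_mult act_X sacts skew_inst(2) permutes_in_image)
  next
    case (link_y s)
    then have ys: "y s \<in> S" using perm by (simp add: permutes_in_image)
    then show ?case using link_y r E_closed[of s] E_closed[of "y s"]
      by (simp add: act_mult act_Y sacts skew_inst(3))
  next
    case (link_switch b s)
    then show ?case using T(2)[of s] E_one[of s] by (cases b) auto
  qed
  \<comment> \<open>The x-potential brings (1, s0) to (1, s), and the y-potential brings (E s, s0)
    to the same point; returning along the latter ends at (E s, s0).\<close>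
  have phi_e: "act ?sx ?sy (e s) (\<one>\<^bsub>F\<^esub>, s0) = (E s, s0)" if s: "s \<in> S" for s
  proof -
    have "act ?sx ?sy (p s) (\<one>\<^bsub>F\<^esub>, s0) = (\<one>\<^bsub>F\<^esub>, s)" using link_act[OF links(1)[OF s]] by simp
    also have "\<dots> = act ?sx ?sy (r s) (E s, s0)"
      using link_act[OF links(2)[OF s]] skew_at(1)[OF r(1)[OF s] E_closed[OF s] s0]
        snd_act(1)[OF r(1)[OF s]] E_closed[OF s] by simp
    finally show ?thesis
      using p(1)[OF s] r(1)[OF s] act_inv(1)[OF sacts] by (simp add: e_def act_mult sacts)
  qed
  let ?K = "G\<lparr>carrier := stab x y s0\<rparr>"
  have sub: "subgroup (stab x y s0) G" by (rule stab_subgroup[OF acts])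
  interpret K: group ?K by (rule subgroup.subgroup_is_group[OF sub group_axioms])
  have "\<phi> \<in> hom ?K F"
  proof (rule homI)
    show "\<phi> g \<in> carrier F" if "g \<in> carrier ?K" for g
      using that snd_act(2) by (simp add: stab_def)
    fix g h assume gh: "g \<in> carrier ?K" "h \<in> carrier ?K"
    then have g: "g \<in> carrier G" "act x y g s0 = s0" and h: "h \<in> carrier G" by (auto simp: stab_def)
    have "act ?sx ?sy (g \<otimes>\<^bsub>G\<^esub> h) (\<one>\<^bsub>F\<^esub>, s0) = act ?sx ?sy h (\<phi> g, s0)"
      using g h snd_act(1)[OF g(1)] by (simp add: act_mult sacts)
    then show "\<phi> (g \<otimes>\<^bsub>?K\<^esub> h) = \<phi> g \<otimes>\<^bsub>F\<^esub> \<phi> h"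
      using skew_at(1)[OF h snd_act(2)[OF g(1)] s0] by (simp add: \<phi>_def)
  qed
  then interpret phi: group_hom ?K F \<phi> by unfold_locales
  have "inj_on \<phi> (carrier ?K)"
  proof (rule inj_on_inverseI[of _ \<psi>])
    fix g assume "g \<in> carrier ?K"
    then have g: "g \<in> carrier G" "act x y g s0 = s0" by (auto simp: stab_def)
    then obtain f s where "act ?sx ?sy g (\<one>\<^bsub>F\<^esub>, s0) = (f, s)" "f \<in> carrier F" "g = \<psi> f \<otimes>\<^bsub>G\<^esub> p s"
      using decomp by blast
    then show "\<psi> (\<phi> g) = g" using snd_act(1)[OF g(1)] g(2) p(3) by simp
  qed
  moreover have "carrier F \<subseteq> \<phi> ` carrier ?K"
    unfolding F_def
  proof (rule free_group_generated)
    show "subgroup (\<phi> ` carrier ?K) (free_group B)"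
      using phi.img_is_subgroup by (simp add: F_def)
    fix b assume "b \<in> B"
    then obtain s where s: "s \<in> S" "b = e s" "e s \<noteq> \<one>\<^bsub>G\<^esub>" by (auto simp: B_def)
    have "(\<phi> (e s), act x y (e s) s0) = (E s, s0)"
      using phi_e[OF s(1)] snd_act(1)[OF e_closed[OF s(1)]] by (rule trans[OF sym, rotated])
    then have phi_es: "\<phi> (e s) = E s" "act x y (e s) s0 = s0" by (simp_all only: prod.inject)
    have "E s = free_gen B b" unfolding E_def s(2) using s(3) by (rule if_not_P)
    moreover have "e s \<in> carrier ?K" using phi_es(2) e_closed[OF s(1)] by (simp add: stab_def)
    ultimately show "free_gen B b \<in> \<phi> ` carrier ?K" using phi_es(1) by (metis imageI)
  qed
  then have "\<phi> ` carrier ?K = carrier F" by auto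
  ultimately have "\<phi> \<in> iso ?K F" using phi.homh unfolding iso_def bij_betw_def by blast
  then show ?thesis unfolding is_free_def is_iso_def F_def by blast
qed

end

section \<open>Free subgroups with labelled cosets, and transitive pairs\<close>

lemma permutes_if_funpow_id:
  assumes "f ^^ n = id" "n > 0" "\<And>s. s \<notin> S \<Longrightarrow> f s = s"
  shows "f permutes S"
proof -
  have "bij f" using assms(1,2) by (rule bij_if_funpow_id)
  then show ?thesis using assms(3) unfolding permutes_def by (metis bij_pointE)
qed

lemma card_pointed_bijections:
  assumes "finite A" "finite C" "card A = card C" "a \<in> A" "c \<in> C"
  shows "card {\<beta> \<in> A \<rightarrow>\<^sub>E C. inj_on \<beta> A \<and> \<beta> a = c} = fact (card A - 1)"
proof -
  let ?A = "A - {a}" and ?C = "C - {c}"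
  have "bij_betw (\<lambda>\<beta>. restrict \<beta> ?A) {\<beta> \<in> A \<rightarrow>\<^sub>E C. inj_on \<beta> A \<and> \<beta> a = c} {\<gamma> \<in> ?A \<rightarrow>\<^sub>E ?C. inj_on \<gamma> ?A}"
  proof (rule bij_betw_byWitness[where f' = "\<lambda>\<gamma>. \<gamma>(a := c)"])
    show "\<forall>\<beta>\<in>{\<beta> \<in> A \<rightarrow>\<^sub>E C. inj_on \<beta> A \<and> \<beta> a = c}. (restrict \<beta> ?A)(a := c) = \<beta>"
      by (auto simp: fun_eq_iff restrict_def PiE_def extensional_def)
    show "\<forall>\<gamma>\<in>{\<gamma> \<in> ?A \<rightarrow>\<^sub>E ?C. inj_on \<gamma> ?A}. restrict (\<gamma>(a := c)) ?A = \<gamma>"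
      by (auto simp: fun_eq_iff restrict_def PiE_def extensional_def)
    show "(\<lambda>\<beta>. restrict \<beta> ?A) ` {\<beta> \<in> A \<rightarrow>\<^sub>E C. inj_on \<beta> A \<and> \<beta> a = c} \<subseteq> {\<gamma> \<in> ?A \<rightarrow>\<^sub>E ?C. inj_on \<gamma> ?A}"
      using assms(4) by (auto simp: inj_on_def PiE_def Pi_iff)
    show "(\<lambda>\<gamma>. \<gamma>(a := c)) ` {\<gamma> \<in> ?A \<rightarrow>\<^sub>E ?C. inj_on \<gamma> ?A} \<subseteq> {\<beta> \<in> A \<rightarrow>\<^sub>E C. inj_on \<beta> A \<and> \<beta> a = c}"
    proof (rule image_subsetI)
      fix \<gamma> assume "\<gamma> \<in> {\<gamma> \<in> ?A \<rightarrow>\<^sub>E ?C. inj_on \<gamma> ?A}"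
      then have \<gamma>: "\<gamma> \<in> ?A \<rightarrow>\<^sub>E ?C" "inj_on \<gamma> ?A" by auto
      then have "inj_on (\<gamma>(a := c)) (insert a ?A)"
        by (intro inj_on_fun_updI[THEN inj_on_insert[THEN iffD2, OF conjI]]) auto
      then show "\<gamma>(a := c) \<in> {\<beta> \<in> A \<rightarrow>\<^sub>E C. inj_on \<beta> A \<and> \<beta> a = c}"
        using \<gamma>(1) assms(4,5) by (auto simp: PiE_def Pi_iff extensional_def insert_absorb)
    qed
  qed
  then have "card {\<beta> \<in> A \<rightarrow>\<^sub>E C. inj_on \<beta> A \<and> \<beta> a = c} = card {\<gamma> \<in> ?A \<rightarrow>\<^sub>E ?C. inj_on \<gamma> ?A}"
    by (rule bij_betw_same_card)
  also have "\<dots> = (\<Prod>i = 0..<card ?A. card ?A - i)"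
    using assms card_inj_on_subset_funcset[of ?A ?C ?A] by simp
  also have "\<dots> = fact (card ?A)"
    using prod_diff_fact[of "card ?A" "card ?A"] by (simp add: atLeast0LessThan)
  finally show ?thesis using assms by simp
qed

context amalgam
begin

definition free_subs :: "nat \<Rightarrow> gen word set set set" where
  "free_subs n = {H. subgroup H G \<and> card (rcosets\<^bsub>G\<^esub> H) = n \<and> is_free (G\<lparr>carrier := H\<rparr>)}"

text \<open>The conjugate has trivial d-th power, and H is torsion-free. With g a coset
  representative, membership of this conjugate in H says that z^i fixes the coset H g.\<close>

lemma free_subgroup_conj_pow:
  assumes H: "H \<in> free_subs n" and g: "g \<in> carrier G" and z: "z \<in> carrier G"
    and d: "d > 0" "z [^]\<^bsub>G\<^esub> (d::nat) = \<one>\<^bsub>G\<^esub>"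
    and mem: "g \<otimes>\<^bsub>G\<^esub> z [^]\<^bsub>G\<^esub> (i::nat) \<otimes>\<^bsub>G\<^esub> inv\<^bsub>G\<^esub> g \<in> H"
  shows "z [^]\<^bsub>G\<^esub> i = \<one>\<^bsub>G\<^esub>"
proof -
  let ?z = "z [^]\<^bsub>G\<^esub> i" and ?K = "G\<lparr>carrier := H\<rparr>"
  have sub: "subgroup H G" and free: "is_free ?K" using H by (auto simp: free_subs_def)
  interpret K: group ?K by (rule subgroup.subgroup_is_group[OF sub group_axioms])
  have zi: "?z \<in> carrier G" using z by simp
  have conj: "(g \<otimes>\<^bsub>G\<^esub> ?z \<otimes>\<^bsub>G\<^esub> inv\<^bsub>G\<^esub> g) [^]\<^bsub>G\<^esub> k = g \<otimes>\<^bsub>G\<^esub> ?z [^]\<^bsub>G\<^esub> k \<otimes>\<^bsub>G\<^esub> inv\<^bsub>G\<^esub> g" for k :: nat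
  proof (induction k)
    case (Suc k)
    have "g \<otimes>\<^bsub>G\<^esub> ?z [^]\<^bsub>G\<^esub> k \<otimes>\<^bsub>G\<^esub> inv\<^bsub>G\<^esub> g \<otimes>\<^bsub>G\<^esub> (g \<otimes>\<^bsub>G\<^esub> ?z \<otimes>\<^bsub>G\<^esub> inv\<^bsub>G\<^esub> g) =
        g \<otimes>\<^bsub>G\<^esub> ?z [^]\<^bsub>G\<^esub> k \<otimes>\<^bsub>G\<^esub> (inv\<^bsub>G\<^esub> g \<otimes>\<^bsub>G\<^esub> g) \<otimes>\<^bsub>G\<^esub> ?z \<otimes>\<^bsub>G\<^esub> inv\<^bsub>G\<^esub> g"
      using g zi by (simp only: m_assoc m_closed inv_closed nat_pow_closed)
    then show ?case using Suc g zi by (simp add: m_assoc)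
  qed (use g in simp)
  have "?z [^]\<^bsub>G\<^esub> d = (z [^]\<^bsub>G\<^esub> d) [^]\<^bsub>G\<^esub> i" using z by (simp add: nat_pow_pow mult.commute)
  then have "(g \<otimes>\<^bsub>G\<^esub> ?z \<otimes>\<^bsub>G\<^esub> inv\<^bsub>G\<^esub> g) [^]\<^bsub>G\<^esub> d = \<one>\<^bsub>G\<^esub>" using conj d g by simp
  then have "(g \<otimes>\<^bsub>G\<^esub> ?z \<otimes>\<^bsub>G\<^esub> inv\<^bsub>G\<^esub> g) [^]\<^bsub>?K\<^esub> d = \<one>\<^bsub>?K\<^esub>"
    by (simp add: nat_pow_consistent[symmetric])
  then have "g \<otimes>\<^bsub>G\<^esub> ?z \<otimes>\<^bsub>G\<^esub> inv\<^bsub>G\<^esub> g = \<one>\<^bsub>G\<^esub>"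
    using is_free_torsion_free[OF K.is_group free _ d(1)] mem by simp
  then have "inv\<^bsub>G\<^esub> (inv\<^bsub>G\<^esub> g) = g \<otimes>\<^bsub>G\<^esub> ?z" using g zi by (intro inv_equality) simp_all
  then have "g \<otimes>\<^bsub>G\<^esub> ?z = g \<otimes>\<^bsub>G\<^esub> \<one>\<^bsub>G\<^esub>" using g by simp
  then show ?thesis using g zi by (simp only: l_cancel_one one_closed r_one)
qed

lemma rcosetsE:
  assumes "C \<in> rcosets\<^bsub>G\<^esub> H"
  obtains a where "a \<in> carrier G" "C = H #>\<^bsub>G\<^esub> a"
  using assms by (auto simp: RCOSETS_def)

lemma rcosets_mult:
  assumes "subgroup H G" "C \<in> rcosets\<^bsub>G\<^esub> H" "g \<in> carrier G"
  shows "C #>\<^bsub>G\<^esub> g \<in> rcosets\<^bsub>G\<^esub> H"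
proof -
  obtain a where a: "a \<in> carrier G" "C = H #>\<^bsub>G\<^esub> a" using assms(2) by (rule rcosetsE)
  then have "C #>\<^bsub>G\<^esub> g = H #>\<^bsub>G\<^esub> (a \<otimes>\<^bsub>G\<^esub> g)"
    using assms by (simp add: coset_mult_assoc[OF subgroup.subset[OF assms(1)]])
  then show ?thesis using a assms(3) by (auto simp: RCOSETS_def)
qed

lemma rcoset_eq_iff:
  assumes "subgroup H G" "a \<in> carrier G" "b \<in> carrier G"
  shows "H #>\<^bsub>G\<^esub> a = H #>\<^bsub>G\<^esub> b \<longleftrightarrow> a \<otimes>\<^bsub>G\<^esub> inv\<^bsub>G\<^esub> b \<in> H"
proof
  assume "H #>\<^bsub>G\<^esub> a = H #>\<^bsub>G\<^esub> b"
  then have "a \<in> H #>\<^bsub>G\<^esub> b" using rcos_self[OF assms(2,1)] by simp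
  then show "a \<otimes>\<^bsub>G\<^esub> inv\<^bsub>G\<^esub> b \<in> H"
    using assms subgroup.rcos_module_imp[OF assms(1) is_group, of b a] by blast
next
  assume "a \<otimes>\<^bsub>G\<^esub> inv\<^bsub>G\<^esub> b \<in> H"
  then have "a \<in> H #>\<^bsub>G\<^esub> b"
    using assms subgroup.rcos_module_rev[OF assms(1) is_group, of b a] by blast
  then show "H #>\<^bsub>G\<^esub> a = H #>\<^bsub>G\<^esub> b" using repr_independence assms by metis
qed

text \<open>Right multiplication on cosets, transported to \<open>S\<close> along the labelling
  \<beta>. It is the identity outside \<open>S\<close>, as \<open>permutes\<close> demands.\<close>

definition coset_pullback :: "'s set \<Rightarrow> ('s \<Rightarrow> gen word set set) \<Rightarrow> gen word set \<Rightarrow> 's \<Rightarrow> 's" where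
  "coset_pullback S \<beta> g s = (if s \<in> S then inv_into S \<beta> (\<beta> s #>\<^bsub>G\<^esub> g) else s)"

lemma
  assumes H: "subgroup H G" and \<beta>: "bij_betw \<beta> S (rcosets\<^bsub>G\<^esub> H)"
    and s: "s \<in> S" and g: "g \<in> carrier G"
  shows coset_pullback_in: "coset_pullback S \<beta> g s \<in> S"
    and coset_pullback_coset: "\<beta> (coset_pullback S \<beta> g s) = \<beta> s #>\<^bsub>G\<^esub> g"
proof -
  have "\<beta> s \<in> rcosets\<^bsub>G\<^esub> H" using \<beta> s by (auto simp: bij_betw_def)
  then have "\<beta> s #>\<^bsub>G\<^esub> g \<in> \<beta> ` S" using rcosets_mult[OF H _ g] \<beta> by (simp add: bij_betw_def)
  then show "coset_pullback S \<beta> g s \<in> S" "\<beta> (coset_pullback S \<beta> g s) = \<beta> s #>\<^bsub>G\<^esub> g"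
    using s by (simp_all add: coset_pullback_def inv_into_into f_inv_into_f)
qed

lemma coset_pullback_funpow:
  assumes H: "subgroup H G" and \<beta>: "bij_betw \<beta> S (rcosets\<^bsub>G\<^esub> H)"
    and s: "s \<in> S" and g: "g \<in> carrier G"
  shows "(coset_pullback S \<beta> g ^^ i) s \<in> S \<and>
    \<beta> ((coset_pullback S \<beta> g ^^ i) s) = \<beta> s #>\<^bsub>G\<^esub> (g [^]\<^bsub>G\<^esub> i)"
proof (induction i)
  case 0
  have "\<beta> s \<subseteq> carrier G"
    using \<beta> s subgroup.rcosets_carrier[OF H is_group] by (auto simp: bij_betw_def)
  then show ?case using s by (simp add: coset_mult_one)
next
  case (Suc i)
  have "\<beta> s \<subseteq> carrier G"
    using \<beta> s subgroup.rcosets_carrier[OF H is_group] by (auto simp: bij_betw_def)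
  then show ?case
    using Suc coset_pullback_in[OF H \<beta> _ g] coset_pullback_coset[OF H \<beta> _ g] g
    by (simp add: coset_mult_assoc)
qed

text \<open>z^i fixes H a iff the conjugate of z^i by a lies in H, iff z^i = 1 by torsion-freeness,
  iff d divides i by the exact order of z.\<close>

lemma semireg_coset_pullback:
  assumes H: "H \<in> free_subs n" and \<beta>: "bij_betw \<beta> S (rcosets\<^bsub>G\<^esub> H)"
    and z: "z \<in> carrier G" and d: "d > 0" "z [^]\<^bsub>G\<^esub> (d::nat) = \<one>\<^bsub>G\<^esub>"
    and order: "\<And>i. z [^]\<^bsub>G\<^esub> (i::nat) = \<one>\<^bsub>G\<^esub> \<Longrightarrow> d dvd i"
  shows "semireg d S (coset_pullback S \<beta> z)"
proof -
  let ?f = "coset_pullback S \<beta> z"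
  have sub: "subgroup H G" using H by (simp add: free_subs_def)
  have inj: "inj_on \<beta> S" using \<beta> by (simp add: bij_betw_def)
  have fix_iff: "(?f ^^ i) s = s \<longleftrightarrow> d dvd i" if s: "s \<in> S" for s i
  proof -
    note fp = coset_pullback_funpow[OF sub \<beta> s z, of i]
    obtain a where a: "a \<in> carrier G" "\<beta> s = H #>\<^bsub>G\<^esub> a"
      using bij_betwE[OF \<beta>] s rcosetsE by metis
    have "(?f ^^ i) s = s \<longleftrightarrow> \<beta> ((?f ^^ i) s) = \<beta> s" using fp s inj by (auto simp: inj_on_def)
    also have "\<dots> \<longleftrightarrow> H #>\<^bsub>G\<^esub> (a \<otimes>\<^bsub>G\<^esub> z [^]\<^bsub>G\<^esub> i) = H #>\<^bsub>G\<^esub> a"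
      using fp a z by (simp add: coset_mult_assoc[OF subgroup.subset[OF sub]])
    also have "\<dots> \<longleftrightarrow> a \<otimes>\<^bsub>G\<^esub> z [^]\<^bsub>G\<^esub> i \<otimes>\<^bsub>G\<^esub> inv\<^bsub>G\<^esub> a \<in> H"
      using a z by (simp add: rcoset_eq_iff[OF sub])
    also have "\<dots> \<longleftrightarrow> d dvd i"
    proof
      assume "a \<otimes>\<^bsub>G\<^esub> z [^]\<^bsub>G\<^esub> i \<otimes>\<^bsub>G\<^esub> inv\<^bsub>G\<^esub> a \<in> H"
      then show "d dvd i" using free_subgroup_conj_pow[OF H a(1) z d] order by blast
    next
      assume "d dvd i"
      then obtain k where "i = d * k" by blast
      then have "z [^]\<^bsub>G\<^esub> i = \<one>\<^bsub>G\<^esub>" using z d by (simp flip: nat_pow_pow)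
      then show "a \<otimes>\<^bsub>G\<^esub> z [^]\<^bsub>G\<^esub> i \<otimes>\<^bsub>G\<^esub> inv\<^bsub>G\<^esub> a \<in> H"
        using a sub by (simp add: subgroup.one_closed)
    qed
    finally show ?thesis .
  qed
  have out: "?f s = s" if "s \<notin> S" for s using that by (simp add: coset_pullback_def)
  have "?f ^^ d = id"
  proof
    fix s
    have "(?f ^^ i) s = s" if "s \<notin> S" for i using out[OF that] by (induction i) auto
    then show "(?f ^^ d) s = id s" using fix_iff[of s d] by (cases "s \<in> S") auto
  qed
  then have "?f permutes S" using d(1) out by (rule permutes_if_funpow_id)
  then show ?thesis using fix_iff by (simp add: semireg_def)
qed

text \<open>From a labelled free subgroup to a transitive pair. The last two claims recover the
  subgroup and the labelling: the elements that carry \<open>s0\<close> to s form the coset with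
  label s.\<close>

lemma coset_pullback_pair:
  fixes S :: "'s set"
  assumes H: "H \<in> free_subs n" and \<beta>: "bij_betw \<beta> S (rcosets\<^bsub>G\<^esub> H)" and s0: "s0 \<in> S" "\<beta> s0 = H"
  defines "x \<equiv> coset_pullback S \<beta> X" and "y \<equiv> coset_pullback S \<beta> Y"
  shows "(x, y) \<in> trans_pairs m q S s0" "stab x y s0 = H"
    "s \<in> S \<Longrightarrow> {g \<in> carrier G. act x y g s0 = s} = \<beta> s"
proof -
  have sub: "subgroup H G" using H by (simp add: free_subs_def)
  have inj: "inj_on \<beta> S" using \<beta> by (simp add: bij_betw_def)
  have sr: "semireg (2 * m) S x" "semireg (q * m) S y"
    unfolding x_def y_def
    using semireg_coset_pullback[OF H \<beta> X_closed _ X_pow X_order]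
      semireg_coset_pullback[OF H \<beta> Y_closed _ Y_pow Y_order] m_pos q_pos by simp_all
  have "(x ^^ 2) s = (y ^^ q) s" for s
  proof (cases "s \<in> S")
    case True
    note fx = coset_pullback_funpow[OF sub \<beta> True X_closed, of 2, folded x_def]
      and fy = coset_pullback_funpow[OF sub \<beta> True Y_closed, of q, folded y_def]
    then have "\<beta> ((x ^^ 2) s) = \<beta> ((y ^^ q) s)" using X_Y_pow by simp
    then show ?thesis using fx fy inj by (auto simp: inj_on_def)
  next
    case False
    then have "(x ^^ i) s = s" "(y ^^ i) s = s" for i
      by (induction i) (auto simp: x_def y_def coset_pullback_def)
    then show ?thesis by simp
  qed
  then have pairs: "(x, y) \<in> pairs m q S" using sr by (auto simp: pairs_def)
  note acts = pairs_acts[OF pairs]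
  have act_coset: "act x y g s0 \<in> S \<and> \<beta> (act x y g s0) = H #>\<^bsub>G\<^esub> g" if "g \<in> carrier G" for g
    using that
  proof (induction rule: G_induct)
    case one
    then show ?case using s0 acts sub by (simp add: act_one coset_mult_one subgroup.subset)
  next
    case (mult_X g)
    then show ?case
      using coset_pullback_in[OF sub \<beta> _ X_closed] coset_pullback_coset[OF sub \<beta> _ X_closed] sub
      by (simp add: act_mult act_X acts x_def[symmetric] coset_mult_assoc subgroup.subset)
  next
    case (mult_Y g)
    then show ?case
      using coset_pullback_in[OF sub \<beta> _ Y_closed] coset_pullback_coset[OF sub \<beta> _ Y_closed] sub
      by (simp add: act_mult act_Y acts y_def[symmetric] coset_mult_assoc subgroup.subset)
  qed
  have act_eq: "act x y g s0 = s \<longleftrightarrow> H #>\<^bsub>G\<^esub> g = \<beta> s" if "g \<in> carrier G" "s \<in> S" for g s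
    using act_coset[OF that(1)] that(2) inj by (metis inj_onD)
  have "s \<in> reach x y s0" if s: "s \<in> S" for s
  proof -
    have "\<beta> s \<in> rcosets\<^bsub>G\<^esub> H" using \<beta> s by (auto simp: bij_betw_def)
    then obtain g where "g \<in> carrier G" "\<beta> s = H #>\<^bsub>G\<^esub> g" by (auto simp: RCOSETS_def)
    then have "act x y g s0 = s" using act_eq s by simp
    then show ?thesis using \<open>g \<in> carrier G\<close> unfolding reach_eq[OF acts] by blast
  qed
  then show "(x, y) \<in> trans_pairs m q S s0" using pairs by (auto simp: trans_pairs_def)
  show fib: "{g \<in> carrier G. act x y g s0 = s} = \<beta> s" if s: "s \<in> S" for s
  proof -
    have "\<beta> s \<in> rcosets\<^bsub>G\<^esub> H" using \<beta> s by (auto simp: bij_betw_def)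
    then obtain a where a: "a \<in> carrier G" "\<beta> s = H #>\<^bsub>G\<^esub> a" by (auto simp: RCOSETS_def)
    have "g \<in> \<beta> s \<longleftrightarrow> g \<in> carrier G \<and> H #>\<^bsub>G\<^esub> g = \<beta> s" for g
    proof
      assume "g \<in> \<beta> s"
      then show "g \<in> carrier G \<and> H #>\<^bsub>G\<^esub> g = \<beta> s"
        using a repr_independence[OF _ a(1) sub] r_coset_subset_G[OF subgroup.subset[OF sub] a(1)] by auto
    next
      assume "g \<in> carrier G \<and> H #>\<^bsub>G\<^esub> g = \<beta> s"
      then show "g \<in> \<beta> s" using rcos_self sub by blast
    qed
    then show ?thesis using act_eq s by blast
  qed
  show "stab x y s0 = H" using fib[OF s0(1)] s0(2) by (simp add: stab_def)
qed

text \<open>From a transitive pair back to a labelled free subgroup. The last claim lets x and y be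
  read off from \<beta> alone, which makes the passage injective.\<close>

lemma trans_pair_cosets:
  assumes xy: "(x, y) \<in> trans_pairs m q S s0" and fin: "finite S" and s0: "s0 \<in> S"
  defines "H \<equiv> stab x y s0" and "\<beta> \<equiv> (\<lambda>s\<in>S. {g \<in> carrier G. act x y g s0 = s})"
  shows "H \<in> free_subs (card S)" "\<beta> \<in> S \<rightarrow>\<^sub>E rcosets\<^bsub>G\<^esub> H" "inj_on \<beta> S" "\<beta> s0 = H"
    "s \<in> S \<Longrightarrow> \<exists>g\<in>\<beta> s. g \<otimes>\<^bsub>G\<^esub> X \<in> \<beta> (x s) \<and> g \<otimes>\<^bsub>G\<^esub> Y \<in> \<beta> (y s)"
proof -
  have pairs: "(x, y) \<in> pairs m q S" and reach: "S \<subseteq> reach x y s0"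
    using xy by (auto simp: trans_pairs_def)
  note acts = pairs_acts[OF pairs] and perm = pairs_permutes[OF pairs]
  have sub: "subgroup H G" unfolding H_def by (rule stab_subgroup[OF acts])
  have reachS: "reach x y s0 \<subseteq> S" using s0 perm by (intro reach_subset) (simp_all add: permutes_image)
  have actS: "act x y g s0 \<in> S" if "g \<in> carrier G" for g
    using that reachS unfolding reach_eq[OF acts] by blast
  have ex: "\<exists>g\<in>carrier G. act x y g s0 = s" if "s \<in> S" for s
    using that reach unfolding reach_eq[OF acts] by blast
  have coset: "{h \<in> carrier G. act x y h s0 = act x y g s0} = H #>\<^bsub>G\<^esub> g" if g: "g \<in> carrier G" for g
  proof (intro equalityI subsetI)
    fix h assume "h \<in> {h \<in> carrier G. act x y h s0 = act x y g s0}"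
    then have h: "h \<in> carrier G" "act x y h s0 = act x y g s0" by auto
    then have "h \<otimes>\<^bsub>G\<^esub> inv\<^bsub>G\<^esub> g \<in> H"
      using g act_inv(1)[OF acts g, of s0] by (simp add: H_def stab_def act_mult acts)
    then show "h \<in> H #>\<^bsub>G\<^esub> g" using h(1) g sub subgroup.rcos_module_rev[OF sub is_group] by blast
  next
    fix h assume "h \<in> H #>\<^bsub>G\<^esub> g"
    then obtain k where k: "k \<in> H" "h = k \<otimes>\<^bsub>G\<^esub> g" by (auto simp: r_coset_def)
    then show "h \<in> {h \<in> carrier G. act x y h s0 = act x y g s0}"
      using g by (simp add: H_def stab_def act_mult acts)
  qed
  have \<beta>_act: "\<beta> (act x y g s0) = H #>\<^bsub>G\<^esub> g" if "g \<in> carrier G" for g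
    using coset[OF that] actS[OF that] by (simp add: \<beta>_def)
  have img: "\<beta> ` S = rcosets\<^bsub>G\<^esub> H"
  proof (intro equalityI subsetI)
    fix C assume "C \<in> \<beta> ` S"
    then obtain s where "s \<in> S" "C = \<beta> s" by blast
    then obtain g where "g \<in> carrier G" "C = \<beta> (act x y g s0)" using ex by blast
    then show "C \<in> rcosets\<^bsub>G\<^esub> H" using \<beta>_act by (auto simp: RCOSETS_def)
  next
    fix C assume "C \<in> rcosets\<^bsub>G\<^esub> H"
    then obtain g where "g \<in> carrier G" "C = H #>\<^bsub>G\<^esub> g" by (auto simp: RCOSETS_def)
    then show "C \<in> \<beta> ` S" using \<beta>_act actS by (metis imageI)
  qed
  show inj: "inj_on \<beta> S"
  proof (rule inj_onI)
    fix s t assume st: "s \<in> S" "t \<in> S" "\<beta> s = \<beta> t"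
    obtain g where "g \<in> carrier G" "act x y g s0 = s" using ex[OF st(1)] by blast
    then have "g \<in> \<beta> t" using st by (auto simp: \<beta>_def)
    then show "s = t" using \<open>act x y g s0 = s\<close> st(2) by (simp add: \<beta>_def)
  qed
  show "\<beta> \<in> S \<rightarrow>\<^sub>E rcosets\<^bsub>G\<^esub> H" using img by (auto simp: \<beta>_def)
  have "card (rcosets\<^bsub>G\<^esub> H) = card S" using card_image[OF inj] img by simp
  then show "H \<in> free_subs (card S)"
    using sub stab_free[OF xy fin s0] by (simp add: free_subs_def H_def)
  show "\<beta> s0 = H" using s0 by (simp add: \<beta>_def H_def stab_def)
  show "\<exists>g\<in>\<beta> s. g \<otimes>\<^bsub>G\<^esub> X \<in> \<beta> (x s) \<and> g \<otimes>\<^bsub>G\<^esub> Y \<in> \<beta> (y s)" if s: "s \<in> S" for s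
  proof -
    obtain g where g: "g \<in> carrier G" "act x y g s0 = s" using ex[OF s] by blast
    have "x s \<in> S" "y s \<in> S" using s perm by (simp_all add: permutes_in_image)
    then show ?thesis using g s
      by (intro bexI[of _ g]) (simp_all add: \<beta>_def act_mult act_X act_Y acts)
  qed
qed

theorem card_trans_pairs:
  fixes S :: "'s set"
  assumes fin: "finite S" and s0: "s0 \<in> S"
  shows "card (trans_pairs m q S s0) = fact (card S - 1) * card (free_subs (card S))"
proof -
  let ?T = "trans_pairs m q S s0"
  let ?B = "\<lambda>H. {\<beta> \<in> S \<rightarrow>\<^sub>E rcosets\<^bsub>G\<^esub> H. inj_on \<beta> S \<and> \<beta> s0 = H}"
  let ?D = "Sigma (free_subs (card S)) ?B"
  let ?\<beta> = "\<lambda>x y. \<lambda>s\<in>S. {g \<in> carrier G. act x y g s0 = s}"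
  let ?F = "\<lambda>(x, y). (stab x y s0, ?\<beta> x y)"
  have n_pos: "card S > 0" using fin s0 card_gt_0_iff by blast
  have fin_cosets: "finite (rcosets\<^bsub>G\<^esub> H)" "card (rcosets\<^bsub>G\<^esub> H) = card S" "H \<in> rcosets\<^bsub>G\<^esub> H"
    if "H \<in> free_subs (card S)" for H
  proof -
    show "card (rcosets\<^bsub>G\<^esub> H) = card S" using that by (simp add: free_subs_def)
    then show "finite (rcosets\<^bsub>G\<^esub> H)" using n_pos card_gt_0_iff by metis
    show "H \<in> rcosets\<^bsub>G\<^esub> H" using that subgroup.subgroup_in_rcosets[OF _ is_group] by (simp add: free_subs_def)
  qed
  have bij: "bij_betw ?F ?T ?D"
    unfolding bij_betw_def
  proof
    show "inj_on ?F ?T"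
    proof (rule inj_onI)
      fix a b assume ab: "a \<in> ?T" "b \<in> ?T" "?F a = ?F b"
      obtain x y x' y' where p: "a = (x, y)" "b = (x', y')" by (cases a; cases b) auto
      have \<beta>: "?\<beta> x y = ?\<beta> x' y'" using ab(3) unfolding p by simp
      note tp = ab(1)[unfolded p] and tp' = ab(2)[unfolded p]
      have acts: "acts x y" "acts x' y'" and perm: "x permutes S" "y permutes S" "x' permutes S" "y' permutes S"
        using tp tp' pairs_acts pairs_permutes by (auto simp: trans_pairs_def)
      have eq: "x s = x' s \<and> y s = y' s" if s: "s \<in> S" for s
      proof -
        have in_S: "x s \<in> S" "y s \<in> S" "x' s \<in> S" "y' s \<in> S"
          using s perm by (simp_all add: permutes_in_image)
        obtain g where g: "g \<in> ?\<beta> x y s" "g \<otimes>\<^bsub>G\<^esub> X \<in> ?\<beta> x y (x s)" "g \<otimes>\<^bsub>G\<^esub> Y \<in> ?\<beta> x y (y s)"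
          using trans_pair_cosets(5)[OF tp fin s0 s] by blast
        have "g \<in> ?\<beta> x' y' s" "g \<otimes>\<^bsub>G\<^esub> X \<in> ?\<beta> x' y' (x s)" "g \<otimes>\<^bsub>G\<^esub> Y \<in> ?\<beta> x' y' (y s)"
          using g unfolding \<beta> .
        then show ?thesis using s in_S acts by (simp add: act_mult act_X act_Y)
      qed
      have "x = x'" "y = y'"
        using eq perm by (metis ext permutes_not_in)+
      then show "a = b" unfolding p by simp
    qed
    show "?F ` ?T = ?D"
    proof (intro equalityI subsetI)
      fix d assume "d \<in> ?F ` ?T"
      then obtain x y where xy: "(x, y) \<in> ?T" "d = (stab x y s0, ?\<beta> x y)" by auto
      show "d \<in> ?D" unfolding xy(2) using trans_pair_cosets(1-4)[OF xy(1) fin s0] by blast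
    next
      fix d assume "d \<in> ?D"
      then obtain H \<beta> where d: "d = (H, \<beta>)" "H \<in> free_subs (card S)" "\<beta> \<in> S \<rightarrow>\<^sub>E rcosets\<^bsub>G\<^esub> H"
        "inj_on \<beta> S" "\<beta> s0 = H" by blast
      have "card (\<beta> ` S) = card (rcosets\<^bsub>G\<^esub> H)"
        using card_image[OF d(4)] fin_cosets(2)[OF d(2)] by simp
      then have "\<beta> ` S = rcosets\<^bsub>G\<^esub> H"
        using d(3) fin_cosets(1)[OF d(2)] by (intro card_subset_eq) auto
      then have bij: "bij_betw \<beta> S (rcosets\<^bsub>G\<^esub> H)" using d(4) by (simp add: bij_betw_def)
      let ?x = "coset_pullback S \<beta> X" and ?y = "coset_pullback S \<beta> Y"
      note cp = coset_pullback_pair[OF d(2) bij s0 d(5)]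
      have "?\<beta> ?x ?y = \<beta>"
      proof
        fix s show "?\<beta> ?x ?y s = \<beta> s"
          using cp(3)[of s] d(3) by (cases "s \<in> S") (auto simp: PiE_def extensional_def)
      qed
      then have "d = ?F (?x, ?y)" using cp(2) d(1) by simp
      then show "d \<in> ?F ` ?T" using cp(1) by (rule image_eqI)
    qed
  qed
  have card_B: "card (?B H) = fact (card S - 1)" if "H \<in> free_subs (card S)" for H
    using fin_cosets[OF that] fin s0 by (intro card_pointed_bijections) auto
  have "finite ?T"
    using finite_pairs[OF fin, of m q] by (rule finite_subset[rotated]) (auto simp: trans_pairs_def)
  then have "finite ?D" using bij bij_betw_finite by blast
  \<comment> \<open>Every free subgroup of this index carries a labelling, so finiteness passes from
    the labelled subgroups to the subgroups. Otherwise \<open>card\<close> would give the default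
    value 0.\<close>
  moreover have "free_subs (card S) \<subseteq> fst ` ?D"
  proof
    fix H assume H: "H \<in> free_subs (card S)"
    then have "card (?B H) \<noteq> 0" using card_B by simp
    then have "?B H \<noteq> {}" by (metis card.empty)
    then obtain \<beta> where "(H, \<beta>) \<in> ?D" using H by blast
    then show "H \<in> fst ` ?D" by (rule image_eqI[rotated]) simp
  qed
  ultimately have fin_subs: "finite (free_subs (card S))" by (rule finite_surj)
  have "card ?T = card ?D" using bij by (rule bij_betw_same_card)
  also have "\<dots> = (\<Sum>H\<in>free_subs (card S). card (?B H))"
  proof (rule card_SigmaI[OF fin_subs])
    have "card (?B H) > 0" if "H \<in> free_subs (card S)" for H
      using card_B[OF that] by simp
    then show "\<forall>H\<in>free_subs (card S). finite (?B H)" using card_ge_0_finite by blast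
  qed
  also have "\<dots> = (\<Sum>H\<in>free_subs (card S). fact (card S - 1))"
    using card_B by (rule sum.cong[OF refl])
  also have "\<dots> = fact (card S - 1) * card (free_subs (card S))"
    by (simp only: sum_constant of_nat_id mult.commute)
  finally show ?thesis .
qed

end

subsection \<open>Arithmetic of the recurrence\<close>

text \<open>\<open>hom_coeff q l\<close> is the number of actions on \<open>2ql\<close> points for \<open>m = 1\<close>, divided by \<open>(2ql)!\<close>.\<close>

definition hom_coeff :: "nat \<Rightarrow> nat \<Rightarrow> real" where
  "hom_coeff q l = fact (2 * q * l) / (2 ^ (q * l) * fact (q * l) * real q ^ (2 * l) * fact (2 * l))"

lemma hom_coeff_0 [simp]: "hom_coeff q 0 = 1"
  by (simp add: hom_coeff_def)

lemma fact_double: "(fact (2 * n) :: real) = 2 ^ n * fact n * (\<Prod>i<n. 2 * real i + 1)"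
proof (induction n)
  case (Suc n)
  have "(fact (2 * Suc n) :: real) = (2 * real n + 2) * (2 * real n + 1) * fact (2 * n)"
    by (simp add: algebra_simps)
  also have "\<dots> = 2 ^ Suc n * fact (Suc n) * (\<Prod>i<Suc n. 2 * real i + 1)"
    unfolding Suc by (simp add: algebra_simps)
  finally show ?case .
qed simp

text \<open>The powers of 2 and (ql)! remove the even factors of (2ql)!, so passing from l to l + 1
  multiplies the numerator by q consecutive odd numbers.\<close>

lemma hom_coeff_alt:
  "hom_coeff q l = (\<Prod>i<q * l. 2 * real i + 1) / (real q ^ (2 * l) * fact (2 * l))"
  using fact_double[of "q * l"] by (simp add: hom_coeff_def mult.assoc)

definition coeff_ratio :: "nat \<Rightarrow> nat \<Rightarrow> real" where
  "coeff_ratio q l = (\<Prod>i<q. 2 * real q * l + 2 * real i + 1) /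
    (real q ^ 2 * (2 * real l + 1) * (2 * real l + 2))"

lemma hom_coeff_Suc: "hom_coeff q (Suc l) = coeff_ratio q l * hom_coeff q l"
proof -
  have "(\<Prod>i<q * Suc l. 2 * real i + 1) =
      (\<Prod>i<q * l. 2 * real i + 1) * (\<Prod>i<q. 2 * (real (q * l + i)) + 1)"
  proof -
    have "{..<q * Suc l} = {..<q * l} \<union> (\<lambda>i. q * l + i) ` {..<q}"
    proof (intro equalityI subsetI)
      fix j assume j: "j \<in> {..<q * Suc l}"
      show "j \<in> {..<q * l} \<union> (\<lambda>i. q * l + i) ` {..<q}"
      proof (cases "j < q * l")
        case False
        then have "j = q * l + (j - q * l)" "j - q * l < q" using j by auto
        then show ?thesis by blast
      qed simp
    qed auto
    then have "(\<Prod>i<q * Suc l. 2 * real i + 1) =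
        (\<Prod>i<q * l. 2 * real i + 1) * (\<Prod>i\<in>(\<lambda>i. q * l + i) ` {..<q}. 2 * real i + 1)"
      by (simp only:) (rule prod.union_disjoint; auto)
    then show ?thesis by (simp add: prod.reindex inj_on_def)
  qed
  also have "(\<Prod>i<q. 2 * (real (q * l + i)) + 1) = (\<Prod>i<q. 2 * real q * l + 2 * real i + 1)"
    by (intro prod.cong) (auto simp: algebra_simps)
  finally have P: "(\<Prod>i<q * Suc l. 2 * real i + 1) =
      (\<Prod>i<q * l. 2 * real i + 1) * (\<Prod>i<q. 2 * real q * l + 2 * real i + 1)" .
  have F: "(fact (2 * Suc l) :: real) = (2 * real l + 1) * (2 * real l + 2) * fact (2 * l)"
    by (simp add: algebra_simps)
  show ?thesis
    unfolding hom_coeff_alt coeff_ratio_def P F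
    by (simp add: power_add power2_eq_square mult_ac)
qed

text \<open>This is log-convexity of c. The middle factor, i = (q - 1) / 2, equals q(2l + 1) and
  cancels; the last one, divided by q(2l + 2), is 1 - 1 / (q(2l + 2)) and increases with l; the
  other factors visibly increase.\<close>

lemma coeff_ratio_mono:
  assumes "odd q" "q \<ge> 3"
  shows "mono (coeff_ratio q)"
proof (rule monoI)
  fix k l :: nat assume "k \<le> l"
  obtain j where q: "q = 2 * j + 1" and j: "j \<ge> 1" using assms by (auto elim!: oddE)
  let ?I = "{..<q} - {j, q - 1}"
  define A where "A l = (\<Prod>i\<in>?I. 2 * real q * l + 2 * real i + 1)" for l :: nat
  define B where "B l = (2 * real q * l + 2 * real q - 1) / (real q * (2 * real l + 2))" for l :: nat
  have eq: "coeff_ratio q l = A l * B l" for l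
  proof -
    have q_pos: "real q \<noteq> 0" "2 * real l + 1 \<noteq> 0" using q by auto
    have fin: "finite ?I" "finite (insert (q - 1) ?I)" and nin: "q - 1 \<notin> ?I" "j \<notin> insert (q - 1) ?I"
      using q j by auto
    have "{..<q} = insert j (insert (q - 1) ?I)" using q j by auto
    then have "(\<Prod>i<q. 2 * real q * l + 2 * real i + 1) =
        (2 * real q * l + 2 * real j + 1) * ((2 * real q * l + 2 * real (q - 1) + 1) * A l)"
      unfolding A_def using q j by (metis (no_types, lifting) fin prod.insert nin)
    also have "2 * real q * l + 2 * real j + 1 = real q * (2 * real l + 1)"
      by (simp add: q algebra_simps)
    also have "2 * real q * l + 2 * real (q - 1) + 1 = 2 * real q * l + 2 * real q - 1"
      using q by simp
    finally have P: "(\<Prod>i<q. 2 * real q * l + 2 * real i + 1) =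
        real q * (2 * real l + 1) * ((2 * real q * l + 2 * real q - 1) * A l)" .
    have cancel: "a * u * (w * x) / (a ^ 2 * u * v) = x * (w / (a * v))"
      if "a \<noteq> 0" "u \<noteq> 0" for a u v w x :: real
      using that by (simp add: power2_eq_square)
    show ?thesis unfolding coeff_ratio_def B_def P by (rule cancel[OF q_pos])
  qed
  have "A k \<le> A l" unfolding A_def
    using \<open>k \<le> l\<close> by (intro prod_mono) (auto intro!: mult_left_mono)
  moreover have "B k \<le> B l"
  proof -
    have B: "B l = 1 - 1 / (real q * (2 * real l + 2))" for l
    proof -
      have "real q * (2 * real l + 2) \<noteq> 0" using q by auto
      moreover have "2 * real q * l + 2 * real q - 1 = real q * (2 * real l + 2) - 1"
        by (simp add: algebra_simps)
      ultimately show ?thesis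
        unfolding B_def diff_divide_distrib[of _ 1 "real q * (2 * real l + 2)", symmetric]
        by (metis diff_divide_distrib divide_self)
    qed
    have "1 / (real q * (2 * real l + 2)) \<le> 1 / (real q * (2 * real k + 2))"
      using \<open>k \<le> l\<close> q by (intro divide_left_mono mult_left_mono mult_pos_pos) auto
    then show ?thesis unfolding B by simp
  qed
  moreover have "A l \<ge> 0" "B k \<ge> 0"
    using q by (auto simp: A_def B_def intro!: prod_nonneg divide_nonneg_nonneg)
  ultimately show "coeff_ratio q k \<le> coeff_ratio q l" unfolding eq by (intro mult_mono) auto
qed

text \<open>Kaluza's argument: by log-convexity \<open>c (n - i) \<le> r (n - 1) * c (n - 1 - i)\<close>, so the summands before
  the last one add up to at most \<open>(n - 1) * c n\<close>.\<close>

lemma log_derivative_pos: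
  fixes b c :: "nat \<Rightarrow> real"
  assumes rec: "\<And>n. n \<ge> 1 \<Longrightarrow> real n * c n = (\<Sum>k = 1..n. b k * c (n - k))"
    and c0: "c 0 = 1" and c: "\<And>n. c (Suc n) = r n * c n" and r: "mono r" "\<And>n. r n > 0"
    and "n \<ge> 1"
  shows "b n > 0"
  using \<open>n \<ge> 1\<close>
proof (induction n rule: less_induct)
  case (less n)
  then obtain k where n: "n = Suc k" by (cases n) auto
  have c_pos: "c j > 0" for j by (induction j) (use c0 c r in auto)
  have "(\<Sum>i = 1..k. b i * c (n - i)) \<le> (\<Sum>i = 1..k. r k * (b i * c (k - i)))"
  proof (rule sum_mono)
    fix i assume i: "i \<in> {1..k}"
    then have "c (n - i) = r (k - i) * c (k - i)" using c[of "k - i"] by (simp add: n Suc_diff_le)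
    also have "\<dots> \<le> r k * c (k - i)"
      using r(1) c_pos by (intro mult_right_mono) (auto simp: mono_def less_imp_le)
    finally have "b i * c (n - i) \<le> b i * (r k * c (k - i))"
      using less.IH[of i] i n by (intro mult_left_mono) auto
    then show "b i * c (n - i) \<le> r k * (b i * c (k - i))" by (simp add: mult_ac)
  qed
  also have "\<dots> = r k * (\<Sum>i = 1..k. b i * c (k - i))" by (simp add: sum_distrib_left)
  also have "(\<Sum>i = 1..k. b i * c (k - i)) = k * c k"
    using rec[of k] by (cases "k = 0") auto
  also have "r k * (k * c k) = k * c n" using c[of k] n by simp
  finally have "(\<Sum>i = 1..k. b i * c (n - i)) \<le> k * c n" .
  moreover have "real n * c n = (\<Sum>i = 1..k. b i * c (n - i)) + b n"
    using rec[of n] n c0 by simp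
  moreover have "real n * c n = k * c n + c n" by (simp add: n algebra_simps)
  ultimately show ?case using c_pos[of n] by linarith
qed

lemma recurrence_pos:
  fixes f :: "nat \<Rightarrow> real"
  assumes "odd q" "q \<ge> 3" "l \<ge> 1"
    and rec: "\<And>l. l \<ge> 1 \<Longrightarrow> 2 * real q * l * hom_coeff q l = (\<Sum>k = 1..l. f k * hom_coeff q (l - k))"
  shows "f l > 0"
proof -
  have "f l / (2 * real q) > 0"
  proof (rule log_derivative_pos[of "hom_coeff q" "\<lambda>l. f l / (2 * real q)" "coeff_ratio q"])
    show "real n * hom_coeff q n = (\<Sum>k = 1..n. f k / (2 * real q) * hom_coeff q (n - k))"
      if "n \<ge> 1" for n
    proof -
      have "(\<Sum>k = 1..n. f k / (2 * real q) * hom_coeff q (n - k)) =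
          (\<Sum>k = 1..n. f k * hom_coeff q (n - k)) / (2 * real q)"
        by (simp add: sum_divide_distrib)
      also have "\<dots> = real n * hom_coeff q n" using assms(2) unfolding rec[OF that, symmetric] by simp
      finally show ?thesis ..
    qed
    show "coeff_ratio q n > 0" for n
      using assms(2) unfolding coeff_ratio_def
      by (intro divide_pos_pos prod_pos mult_pos_pos) (simp_all add: add_nonneg_pos)
  qed (use assms coeff_ratio_mono hom_coeff_Suc in auto)
  then show ?thesis using assms(2) by (simp add: zero_less_divide_iff)
qed

text \<open>Replacing H(z) by H(dz) substitutes dz for z in z H'(z) / H(z), so the coefficient of
  z^l gains d^l; \<open>b\<close> accounts for the changed prefactor.\<close>

lemma recurrence_scale:
  fixes f g :: "nat \<Rightarrow> real"
  assumes f: "\<And>l. l \<ge> 1 \<Longrightarrow> a * l * c l = (\<Sum>k = 1..l. f k * c (l - k))"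
    and g: "\<And>l. l \<ge> 1 \<Longrightarrow> a * b * l * (d ^ l * c l) = (\<Sum>k = 1..l. g k * (d ^ (l - k) * c (l - k)))"
    and c0: "c 0 = 1" and "l \<ge> 1"
  shows "g l = b * d ^ l * f l"
  using \<open>l \<ge> 1\<close>
proof (induction l rule: less_induct)
  case (less l)
  then obtain n where n: "l = Suc n" by (cases l) auto
  have "(\<Sum>k = 1..n. g k * (d ^ (l - k) * c (l - k))) = (\<Sum>k = 1..n. b * d ^ l * (f k * c (l - k)))"
  proof (rule sum.cong[OF refl])
    fix k assume k: "k \<in> {1..n}"
    then have "d ^ l = d ^ k * d ^ (l - k)" using n by (simp flip: power_add)
    then show "g k * (d ^ (l - k) * c (l - k)) = b * d ^ l * (f k * c (l - k))"
      using less.IH[of k] k n by (simp add: mult_ac)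
  qed
  then have "g l + b * d ^ l * (\<Sum>k = 1..n. f k * c (l - k)) = a * b * l * (d ^ l * c l)"
    using g[of l] c0 n by (simp add: sum_distrib_left)
  moreover have "f l + (\<Sum>k = 1..n. f k * c (l - k)) = a * l * c l"
    using f[of l] c0 n by simp
  ultimately have "g l + b * d ^ l * (a * l * c l - f l) = a * b * l * (d ^ l * c l)"
    by (metis add_diff_cancel_left')
  then show ?case by (simp add: algebra_simps)
qed

text \<open>The generating function of the \<open>f k\<close> is six times a logarithmic derivative of a
  hypergeometric series, and so satisfies a Riccati equation.\<close>

lemma riccati_recurrence:
  fixes f :: "nat \<Rightarrow> real"
  assumes rec: "\<And>l. l \<ge> 1 \<Longrightarrow> 6 * real l * hom_coeff 3 l = (\<Sum>k = 1..l. f k * hom_coeff 3 (l - k))"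
  shows "f 1 = 5" "l \<ge> 1 \<Longrightarrow> f (Suc l) = (6 * real l + 6) * f l + (\<Sum>k = 1..<l. f k * f (l - k))"
proof -
  define H where "H = Abs_fps (hom_coeff 3)"
  define F where "F = Abs_fps (\<lambda>n. if n = 0 then 0 else f n)"
  have ratio: "coeff_ratio 3 l = (6 * real l + 1) * (6 * real l + 5) / (6 * (real l + 1))" for l
  proof -
    have "coeff_ratio 3 l = (6 * real l + 1) * (6 * real l + 3) * (6 * real l + 5) /
        (9 * (2 * real l + 1) * (2 * real l + 2))"
      unfolding coeff_ratio_def by (simp add: eval_nat_numeral lessThan_Suc algebra_simps)
    also have "\<dots> = (6 * real l + 1) * (6 * real l + 5) * (3 * (2 * real l + 1)) /
        (6 * (real l + 1) * (3 * (2 * real l + 1)))"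
      by (simp add: algebra_simps)
    also have "\<dots> = (6 * real l + 1) * (6 * real l + 5) / (6 * (real l + 1))"
      by (rule mult_divide_mult_cancel_right) (simp add: add_nonneg_eq_0_iff)
    finally show ?thesis .
  qed
  \<comment> \<open>\<open>fps_XD\<close> multiplies the coefficient of z^l by l, so this is the
    ratio formula 6 (l + 1) c (l + 1) = (36 l^2 + 36 l + 5) c l, the hypergeometric equation of
    H.\<close>
  have H_eq: "6 * fps_XD H = fps_X * (36 * fps_XD (fps_XD H) + 36 * fps_XD H + 5 * H)"
  proof (rule fps_ext)
    fix n show "fps_nth (6 * fps_XD H) n =
        fps_nth (fps_X * (36 * fps_XD (fps_XD H) + 36 * fps_XD H + 5 * H)) n"
    proof (cases n)
      case (Suc l)
      have "6 * (real l + 1) * hom_coeff 3 (Suc l) = (6 * real l + 1) * (6 * real l + 5) * hom_coeff 3 l"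
        unfolding hom_coeff_Suc ratio by (simp add: field_simps)
      then show ?thesis by (simp add: Suc H_def numeral_fps_const algebra_simps)
    qed (simp add: numeral_fps_const)
  qed
  have FH: "6 * fps_XD H = F * H"
  proof (rule fps_ext)
    fix n
    have "fps_nth (F * H) n = (\<Sum>k = 0..n. (if k = 0 then 0 else f k) * hom_coeff 3 (n - k))"
      by (simp add: fps_mult_nth F_def H_def)
    also have "\<dots> = (\<Sum>k = 1..n. f k * hom_coeff 3 (n - k))"
      by (subst sum.atLeast_Suc_atMost) auto
    also have "\<dots> = 6 * real n * hom_coeff 3 n" using rec[of n] by (cases "n = 0") auto
    finally show "fps_nth (6 * fps_XD H) n = fps_nth (F * H) n" by (simp add: numeral_fps_const H_def)
  qed
  \<comment> \<open>Differentiating 6 z H' = F H again expresses the second-order term through F.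
    The linear second-order equation for H thus becomes a quadratic first-order one for F once H is
    cancelled.\<close>
  have "6 * (6 * fps_XD (fps_XD H)) = 6 * fps_XD (F * H)"
  proof -
    have "fps_XD (6 * fps_XD H) = 6 * fps_XD (fps_XD H)"
      using fps_XD_mult_const[of 6 "fps_XD H"] by (simp only: numeral_fps_const)
    then show ?thesis using FH by simp
  qed
  also have "\<dots> = 6 * fps_XD F * H + F * (6 * fps_XD H)"
    by (simp add: fps_XD_def algebra_simps)
  finally have XDXD: "36 * fps_XD (fps_XD H) = 6 * fps_XD F * H + F * F * H"
    by (simp add: FH mult.assoc)
  have "F * H = fps_X * (36 * fps_XD (fps_XD H) + 6 * (6 * fps_XD H) + 5 * H)"
  proof -
    have "36 * fps_XD H = 6 * (6 * fps_XD H)" by simp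
    then show ?thesis using H_eq unfolding FH by (simp only:)
  qed
  also have "\<dots> = fps_X * (6 * fps_XD F + F * F + 6 * F + 5) * H"
    unfolding XDXD FH by (simp add: algebra_simps)
  finally have "F * H = fps_X * (6 * fps_XD F + F * F + 6 * F + 5) * H" .
  moreover have "H \<noteq> 0"
  proof
    assume "H = 0"
    then have "fps_nth H 0 = 0" by simp
    then show False by (simp add: H_def)
  qed
  ultimately have F_eq: "F = fps_X * (6 * fps_XD F + F * F + 6 * F + 5)" by simp
  have nth: "fps_nth F (Suc l) = 6 * real l * fps_nth F l + fps_nth (F * F) l + 6 * fps_nth F l + (if l = 0 then 5 else 0)" for l
    by (subst F_eq) (simp add: numeral_fps_const)
  show "f 1 = 5" using nth[of 0] by (simp add: F_def)
  show "f (Suc l) = (6 * real l + 6) * f l + (\<Sum>k = 1..<l. f k * f (l - k))" if "l \<ge> 1"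
  proof -
    obtain n where n: "l = Suc n" using \<open>l \<ge> 1\<close> by (cases l) auto
    have "fps_nth (F * F) l = (\<Sum>k = 0..l. fps_nth F k * fps_nth F (l - k))" by (simp add: fps_mult_nth)
    also have "\<dots> = (\<Sum>k = 1..n. fps_nth F k * fps_nth F (l - k))"
      by (subst sum.atLeast_Suc_atMost) (auto simp: n F_def)
    also have "\<dots> = (\<Sum>k = 1..n. f k * f (l - k))"
      by (rule sum.cong) (auto simp: F_def n)
    also have "{1..n} = {1..<l}" using n by auto
    finally show ?thesis using nth[of l] n by (simp add: F_def algebra_simps)
  qed
qed

text \<open>Modulo 2 the convolution pairs off, leaving only its middle term.\<close>

lemma odd_iff_Suc_power_2:
  fixes f :: "nat \<Rightarrow> nat"
  assumes f1: "f 1 = 5"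
    and rec: "\<And>l. l \<ge> 1 \<Longrightarrow> f (Suc l) = (6 * l + 6) * f l + (\<Sum>k = 1..<l. f k * f (l - k))"
    and "l \<ge> 1"
  shows "odd (f l) \<longleftrightarrow> (\<exists>k. l + 1 = 2 ^ k)"
  using \<open>l \<ge> 1\<close>
proof (induction l rule: less_induct)
  case (less l)
  have pair: "even (\<Sum>k\<in>{1..<n}. f k * f (n - k)) \<longleftrightarrow> odd n \<or> n = 0 \<or> even (f (n div 2))" for n
  proof -
    let ?A = "{k. 1 \<le> k \<and> 2 * k < n}" and ?B = "{k. n < 2 * k \<and> k < n}"
    have fin: "finite ?A" "finite ?B"
      by (rule finite_subset[of _ "{..n}"]; auto)+
    have AB: "(\<Sum>k\<in>?B. f k * f (n - k)) = (\<Sum>k\<in>?A. f k * f (n - k))"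
      by (rule sum.reindex_bij_witness[of _ "\<lambda>k. n - k" "\<lambda>k. n - k"]) auto
    show ?thesis
    proof (cases "even n \<and> n \<noteq> 0")
      case True
      then obtain j where j: "n = 2 * j" "j \<ge> 1" by (auto elim!: evenE)
      then have "{1..<n} = insert j (?A \<union> ?B)" by auto
      then have "(\<Sum>k\<in>{1..<n}. f k * f (n - k)) = f j * f j + (\<Sum>k\<in>?A \<union> ?B. f k * f (n - k))"
        using j fin by (simp add: mult_2)
      also have "(\<Sum>k\<in>?A \<union> ?B. f k * f (n - k)) = 2 * (\<Sum>k\<in>?A. f k * f (n - k))"
        using fin AB by (subst sum.union_disjoint) auto
      finally show ?thesis using j by simp
    next
      case False
      then have "{1..<n} = ?A \<union> ?B" by (auto elim!: oddE) presburger+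
      then have "(\<Sum>k\<in>{1..<n}. f k * f (n - k)) = (\<Sum>k\<in>?A \<union> ?B. f k * f (n - k))" by simp
      also have "\<dots> = 2 * (\<Sum>k\<in>?A. f k * f (n - k))"
        using fin AB by (subst sum.union_disjoint) auto
      finally show ?thesis using False by auto
    qed
  qed
  show ?case
  proof (cases "l = 1")
    case True
    have "(1::nat) + 1 = 2 ^ 1" by simp
    then show ?thesis using True f1 by (metis odd_numeral)
  next
    case False
    then obtain n where n: "l = Suc n" "n \<ge> 1" using less.prems by (cases l) auto
    have "odd (f l) \<longleftrightarrow> odd (\<Sum>k\<in>{1..<n}. f k * f (n - k))"
      using rec[OF n(2)] n(1) by simp
    also have "\<dots> \<longleftrightarrow> even n \<and> odd (f (n div 2))" using pair[of n] n by auto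
    also have "\<dots> \<longleftrightarrow> even n \<and> (\<exists>k. n div 2 + 1 = 2 ^ k)"
      using less.IH[of "n div 2"] n by (cases "even n") (auto elim!: evenE)
    \<comment> \<open>For even n, l + 1 = n + 2 is twice n div 2 + 1; the exponent 0 is excluded
      because l + 1 is at least 3.\<close>
    also have "\<dots> \<longleftrightarrow> (\<exists>k. l + 1 = 2 ^ k)"
    proof
      assume "even n \<and> (\<exists>k. n div 2 + 1 = 2 ^ k)"
      then obtain k where "even n" "n div 2 + 1 = 2 ^ k" by blast
      then have "l + 1 = 2 ^ Suc k" using n by (auto elim!: evenE)
      then show "\<exists>k. l + 1 = 2 ^ k" by blast
    next
      assume "\<exists>k. l + 1 = 2 ^ k"
      then obtain k where k: "l + 1 = 2 ^ k" by blast
      then obtain i where "k = Suc i" using n by (cases k) auto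
      then have "n + 2 = 2 * 2 ^ i" using k n by simp
      then have "even n" "n div 2 + 1 = 2 ^ i" by presburger+
      then show "even n \<and> (\<exists>k. n div 2 + 1 = 2 ^ k)" by blast
    qed
    finally show ?thesis .
  qed
qed

subsection \<open>The recurrence for free subgroup numbers\<close>

lemma card_pairs_hom_coeff:
  assumes "m > 0" "q \<ge> 2" "finite S" "card S = 2 * q * m * l"
  shows "real (card (pairs m q S)) = fact (2 * q * m * l) * ((real m ^ (q - 2)) ^ l * hom_coeff q l)"
proof -
  \<comment> \<open>The first summand is the power of m that cancels against the denominator from
    counting x.\<close>
  have exp: "(q - 1) * (2 * l) = q * l + (q - 2) * l"
  proof -
    obtain k where "q = k + 2" using assms(2) by (metis le_add_diff_inverse2)
    then show ?thesis by (simp add: algebra_simps)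
  qed
  define A :: real where "A = 2 ^ (q * l) * fact (q * l) * real q ^ (2 * l) * fact (2 * l)"
  have A: "A \<noteq> 0" using assms(2) by (simp add: A_def)
  have pow: "real m ^ ((q - 1) * (2 * l)) = real m ^ (q * l) * (real m ^ (q - 2)) ^ l"
    unfolding exp by (simp only: power_add power_mult)
  have "real (card (pairs m q S) * (((2 * m) ^ (q * l) * fact (q * l)) * (q ^ (2 * l) * fact (2 * l)))) =
      real (fact (2 * q * m * l) * (m ^ ((q - 1) * (2 * l)) * fact (q * (2 * l))))"
    using card_pairs[OF assms(1) _ assms(3,4)] assms(2) by simp
  then have "real (card (pairs m q S)) * (((2 * real m) ^ (q * l) * fact (q * l)) * (real q ^ (2 * l) * fact (2 * l))) =
      fact (2 * q * m * l) * (real m ^ ((q - 1) * (2 * l)) * fact (q * (2 * l)))"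
    by (simp only: of_nat_mult of_nat_power of_nat_fact of_nat_numeral)
  then have "real (card (pairs m q S)) * (real m ^ (q * l) * A) =
      fact (2 * q * m * l) * (real m ^ (q * l) * (real m ^ (q - 2)) ^ l * fact (2 * q * l))"
    unfolding pow A_def power_mult_distrib by (simp add: mult.left_commute mult.commute)
  then have "real (card (pairs m q S)) * A = fact (2 * q * m * l) * ((real m ^ (q - 2)) ^ l * fact (2 * q * l))"
    using assms(1) by simp
  also have "fact (2 * q * l) = hom_coeff q l * A" using A by (simp add: hom_coeff_def A_def)
  finally show ?thesis using A by simp
qed

context amalgam
begin

lemma free_subgroup_number_eq: "free_subgroup_number q l m = card (free_subs (2 * q * m * l))"
  by (simp add: free_subgroup_number_def free_subs_def G_eq)

lemma free_subgroup_number_recurrence: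
  assumes q: "odd q" "q \<ge> 3" and l: "l \<ge> 1"
  defines "h \<equiv> \<lambda>l. (real m ^ (q - 2)) ^ l * hom_coeff q l"
  shows "2 * real q * real m * real l * h l = (\<Sum>k = 1..l. real (free_subgroup_number q k m) * h (l - k))"
proof -
  define D where "D = 2 * q * m"
  define N where "N = D * l"
  let ?S = "{..<N}"
  let ?f = "\<lambda>n. real (card (free_subs n))"
  \<comment> \<open>The number of pairs on n points; it vanishes unless D divides n, so only orbit
    sizes divisible by D survive in the sum below.\<close>
  define P where "P n = (if D dvd n then fact n * h (n div D) else 0)" for n
  have D: "D > 0" using m_pos q_pos by (simp add: D_def)
  have N: "N > 0" using D l by (simp add: N_def)
  have P: "real (card (pairs m q V)) = P (card V)" if "finite V" for V :: "nat set"
  proof (cases "D dvd card V")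
    case True
    then obtain j where "card V = D * j" by blast
    then show ?thesis
      using card_pairs_hom_coeff[OF m_pos _ that, of q j] q D by (simp add: P_def h_def D_def)
  next
    case False
    then have "pairs m q V = {}" using pairs_dvd_card[OF m_pos q(1) that] by (auto simp: D_def)
    then show ?thesis using False by (simp add: P_def)
  qed
  have "fact N * h l = P N" using D by (simp add: P_def N_def)
  also have "\<dots> = real (card (pairs m q ?S))" using P[of ?S] by simp
  also have "\<dots> = (\<Sum>U | 0 \<in> U \<and> U \<subseteq> ?S. real (card (trans_pairs m q U 0)) * real (card (pairs m q (?S - U))))"
    using card_pairs_decompose[of ?S 0 m q] N by simp
  also have "\<dots> = (\<Sum>U | 0 \<in> U \<and> U \<subseteq> ?S. fact (card U - 1) * ?f (card U) * P (N - card U))"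
  proof (rule sum.cong[OF refl])
    fix U assume "U \<in> {U. 0 \<in> U \<and> U \<subseteq> ?S}"
    then have U: "0 \<in> U" "U \<subseteq> ?S" "finite U" using finite_subset[of U ?S] by auto
    have "card (?S - U) = N - card U" using card_Diff_subset[OF U(3,2)] by simp
    then show "real (card (trans_pairs m q U 0)) * real (card (pairs m q (?S - U))) =
        fact (card U - 1) * ?f (card U) * P (N - card U)"
      using card_trans_pairs[OF U(3,1)] P[of "?S - U"] by simp
  qed
  also have "\<dots> = (\<Sum>n = 1..card ?S. real ((card ?S - 1) choose (n - 1)) * (fact (n - 1) * ?f n * P (N - n)))"
    using N by (intro sum_pointed_subsets) auto
  also have "\<dots> = (\<Sum>n = 1..N. real ((N - 1) choose (n - 1)) * (fact (n - 1) * ?f n * P (N - n)))"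
    by simp
  also have "\<dots> = (\<Sum>n = 1..N. fact (N - 1) * (if D dvd n then ?f n * h (l - n div D) else 0))"
  proof (rule sum.cong[OF refl])
    fix n assume n: "n \<in> {1..N}"
    have dvd: "D dvd N - n \<longleftrightarrow> D dvd n"
      using n by (metis N_def atLeastAtMost_iff dvd_diffD1 dvd_diff_nat dvd_triv_left)
    show "real ((N - 1) choose (n - 1)) * (fact (n - 1) * ?f n * P (N - n)) =
        fact (N - 1) * (if D dvd n then ?f n * h (l - n div D) else 0)"
    proof (cases "D dvd n")
      case True
      then obtain k where k: "n = D * k" by blast
      then have "(N - n) div D = l - n div D" using D by (simp add: N_def flip: diff_mult_distrib2)
      \<comment> \<open>Choosing the orbit, labelling its cosets and the (N - n)! from the
        complement combine to (N - 1)! for every n. Against N! on the left this leaves the factor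
        N.\<close>
      moreover have "real ((N - 1) choose (n - 1)) * (fact (n - 1) * fact (N - n)) = fact (N - 1)"
      proof -
        have "n - 1 \<le> N - 1" "N - 1 - (n - 1) = N - n" using n by auto
        then show ?thesis using binomial_fact_lemma[of "n - 1" "N - 1"]
          by (metis (no_types, lifting) mult.commute of_nat_fact of_nat_mult)
      qed
      ultimately show ?thesis using True dvd by (simp add: P_def mult_ac)
    qed (simp add: P_def dvd)
  qed
  also have "\<dots> = fact (N - 1) * (\<Sum>n = 1..N. if D dvd n then ?f n * h (l - n div D) else 0)"
    by (simp only: sum_distrib_left)
  also have "(\<Sum>n = 1..N. if D dvd n then ?f n * h (l - n div D) else 0) =
      (\<Sum>n\<in>{n \<in> {1..N}. D dvd n}. ?f n * h (l - n div D))"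
    by (rule sum.inter_filter[symmetric]) simp
  also have "\<dots> = (\<Sum>k = 1..l. ?f (D * k) * h (l - k))"
  proof (rule sum.reindex_bij_witness[of _ "\<lambda>k. D * k" "\<lambda>n. n div D"])
    fix n assume "n \<in> {n \<in> {1..N}. D dvd n}"
    then obtain k where "n = D * k" "1 \<le> D * k" "D * k \<le> D * l" by (auto simp: N_def)
    then have "k \<le> l" "1 \<le> k" using D by (simp_all add: Suc_le_eq)
    then show "n div D \<in> {1..l}" using D \<open>n = D * k\<close> by simp
  qed (use D in \<open>auto simp: N_def\<close>)
  finally have "fact N * h l = fact (N - 1) * (\<Sum>k = 1..l. ?f (D * k) * h (l - k))" .
  moreover have "(fact N :: real) = fact (N - 1) * real N" using N by (cases N) (simp_all add: algebra_simps)
  ultimately have "fact (N - 1) * (real N * h l) = fact (N - 1) * (\<Sum>k = 1..l. ?f (D * k) * h (l - k))"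
    by (simp only: mult.assoc)
  then have "real N * h l = (\<Sum>k = 1..l. ?f (D * k) * h (l - k))" by simp
  then show ?thesis by (simp add: free_subgroup_number_eq N_def D_def)
qed

end

section \<open>Dependence on m, valuations and the theorem\<close>

lemma amalgamI: "m > 0 \<Longrightarrow> q > 0 \<Longrightarrow> amalgam m q"
  by unfold_locales

lemma free_subgroup_number_one_recurrence:
  assumes "odd q" "q \<ge> 3" "l \<ge> 1"
  shows "2 * real q * real l * hom_coeff q l =
    (\<Sum>k = 1..l. real (free_subgroup_number q k 1) * hom_coeff q (l - k))"
  using amalgam.free_subgroup_number_recurrence[OF amalgamI[of 1 q] assms] assms(2) by simp

lemma free_subgroup_number_one_pos:
  assumes "odd q" "q \<ge> 3" "l \<ge> 1"
  shows "free_subgroup_number q l 1 > 0"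
  using recurrence_pos[OF assms free_subgroup_number_one_recurrence[OF assms(1,2)]] by simp

lemma free_subgroup_number_scale:
  assumes "odd q" "q \<ge> 3" "m \<ge> 1" "l \<ge> 1"
  shows "free_subgroup_number q l m = m ^ (l * (q - 2) + 1) * free_subgroup_number q l 1"
proof -
  have "real (free_subgroup_number q l m) = real m * (real m ^ (q - 2)) ^ l * real (free_subgroup_number q l 1)"
    by (rule recurrence_scale[where a = "2 * real q" and c = "hom_coeff q"])
      (use assms amalgam.free_subgroup_number_recurrence[OF amalgamI[of m q]]
        free_subgroup_number_one_recurrence in simp_all)
  also have "\<dots> = real (m ^ (l * (q - 2) + 1) * free_subgroup_number q l 1)"
    by (simp add: mult.commute[of l] power_mult)
  finally show ?thesis by (simp only: of_nat_eq_iff)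
qed

lemma multiplicity_free_subgroup_number:
  assumes "odd q" "q \<ge> 3" "m \<ge> 1" "l \<ge> 1"
  shows "multiplicity 2 (free_subgroup_number q l m) =
    multiplicity 2 m * (l * (q - 2) + 1) + multiplicity 2 (free_subgroup_number q l 1)"
proof -
  have prime: "prime_elem (2 :: nat)" by (rule prime_imp_prime_elem[OF two_is_prime_nat])
  have "m ^ (l * (q - 2) + 1) \<noteq> 0" "free_subgroup_number q l 1 \<noteq> 0"
    using assms(3) free_subgroup_number_one_pos[OF assms(1,2,4)] by simp_all
  then have "multiplicity 2 (free_subgroup_number q l m) =
      multiplicity 2 (m ^ (l * (q - 2) + 1)) + multiplicity 2 (free_subgroup_number q l 1)"
    unfolding free_subgroup_number_scale[OF assms] by (rule prime_elem_multiplicity_mult_distrib[OF prime])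
  also have "multiplicity 2 (m ^ (l * (q - 2) + 1)) = (l * (q - 2) + 1) * multiplicity 2 m"
    using assms(3) by (intro prime_elem_multiplicity_power_distrib[OF prime]) simp
  finally show ?thesis by (simp only: mult.commute)
qed

lemma odd_free_subgroup_number_3_1:
  assumes "l \<ge> 1"
  shows "odd (free_subgroup_number 3 l 1) \<longleftrightarrow> (\<exists>k. l + 1 = 2 ^ k)"
proof -
  let ?f = "\<lambda>l. free_subgroup_number 3 l 1"
  have rec: "6 * real l * hom_coeff 3 l = (\<Sum>k = 1..l. real (?f k) * hom_coeff 3 (l - k))" if "l \<ge> 1" for l
    using free_subgroup_number_one_recurrence[of 3 l] that by simp
  note riccati = riccati_recurrence[of "\<lambda>l. real (?f l)", OF rec]
  have "?f 1 = 5" using riccati(1) by simp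
  moreover have "?f (Suc l) = (6 * l + 6) * ?f l + (\<Sum>k = 1..<l. ?f k * ?f (l - k))" if "l \<ge> 1" for l
  proof -
    have "real (?f (Suc l)) = real ((6 * l + 6) * ?f l + (\<Sum>k = 1..<l. ?f k * ?f (l - k)))"
      using riccati(2)[OF _ that] by simp
    then show ?thesis by (simp only: of_nat_eq_iff)
  qed
  ultimately show ?thesis using assms by (rule odd_iff_Suc_power_2)
qed

theorem proposition18:
  "(\<forall>m q :: nat. m \<ge> 1 \<longrightarrow> q \<ge> 3 \<longrightarrow> fermat_prime q \<longrightarrow>
      (\<forall>l \<ge> 1. multiplicity 2 (free_subgroup_number q l m) \<ge> multiplicity 2 m * (l + q - 2)) \<and>
      (even m \<longrightarrow> (\<forall>k. \<exists>L. \<forall>l \<ge> L. [free_subgroup_number q l m = 0] (mod 2 ^ k)))) \<and>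
   (\<forall>m \<ge> 1. \<forall>l \<ge> 1.
      multiplicity 2 (free_subgroup_number 3 l m) = multiplicity 2 m * (l + 1) \<longleftrightarrow>
      (\<exists>k. l + 1 = 2 ^ k))"
proof (intro conjI allI impI)
  fix m q l :: nat
  assume m: "m \<ge> 1" and q: "q \<ge> 3" "fermat_prime q" and l: "l \<ge> 1"
  have "odd q" using q(2) by (auto simp: fermat_prime_def)
  \<comment> \<open>In these variables the two sides of the inequality differ by i * j, that is (l -
    1)(q - 3).\<close>
  obtain i j where "l = i + 1" "q = j + 3" using l q(1) by (metis le_add_diff_inverse2)
  then have "l + q - 2 \<le> l * (q - 2) + 1" by (simp add: algebra_simps)
  then have "multiplicity 2 m * (l + q - 2) \<le> multiplicity 2 m * (l * (q - 2) + 1)"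
    by (rule mult_le_mono2)
  then show "multiplicity 2 (free_subgroup_number q l m) \<ge> multiplicity 2 m * (l + q - 2)"
    unfolding multiplicity_free_subgroup_number[OF \<open>odd q\<close> q(1) m l] by (rule trans_le_add1)
next
  fix m q k :: nat
  assume m: "m \<ge> 1" "even m" and q: "q \<ge> 3" "fermat_prime q"
  have "odd q" using q(2) by (auto simp: fermat_prime_def)
  \<comment> \<open>The threshold \<open>Suc k\<close> also ensures l \<ge> 1, where the scaling
    formula holds.\<close>
  have "[free_subgroup_number q l m = 0] (mod 2 ^ k)" if "l \<ge> Suc k" for l
  proof -
    have l: "l \<ge> 1" using that by simp
    have "l * 1 \<le> l * (q - 2)" using q(1) by (intro mult_le_mono2) simp
    then have "k \<le> l * (q - 2) + 1" using that by linarith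
    then have "2 ^ k dvd (2 :: nat) ^ (l * (q - 2) + 1)" by (rule le_imp_power_dvd)
    also have "\<dots> dvd m ^ (l * (q - 2) + 1)" using m(2) by (rule dvd_power_same)
    finally show ?thesis
      unfolding free_subgroup_number_scale[OF \<open>odd q\<close> q(1) m(1) l] cong_0_iff by (rule dvd_mult2)
  qed
  then show "\<exists>L. \<forall>l \<ge> L. [free_subgroup_number q l m = 0] (mod 2 ^ k)" by blast
next
  fix m l :: nat
  assume m: "m \<ge> 1" and l: "l \<ge> 1"
  let ?f = "free_subgroup_number 3 l 1"
  have "multiplicity 2 (free_subgroup_number 3 l m) = multiplicity 2 m * (l + 1) \<longleftrightarrow> multiplicity 2 ?f = 0"
    using multiplicity_free_subgroup_number[of 3 m l] m l by simp
  also have "\<dots> \<longleftrightarrow> odd ?f"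
    using free_subgroup_number_one_pos[of 3 l] l by (simp add: multiplicity_eq_zero_iff)
  also have "\<dots> \<longleftrightarrow> (\<exists>k. l + 1 = 2 ^ k)" using l by (rule odd_free_subgroup_number_3_1)
  finally show "multiplicity 2 (free_subgroup_number 3 l m) = multiplicity 2 m * (l + 1) \<longleftrightarrow>
      (\<exists>k. l + 1 = 2 ^ k)" .
qed

end
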